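(* For every integer $k\ge 0$ and every real $\alpha$ with $\frac{k}{k+1}<\alpha<1$ there is a constant $C=C(k,\alpha)$ such that for every function $p\colon\mathbb{N}\to[0,1]$ with $p(n)\ge C/n$ for all sufficiently large $n$, the pair $(\alpha,p)$ ensures $\mathcal{P}^{k+1}$, i.e. $$\lim_{n\to\infty}\ \min_{G}\ \mathbb{P}\big(G\cup G(n,p(n))\in\mathcal{P}^{k+1}_n\big)=1,$$ where the minimum is taken over all $n$-vertex graphs $G$ with minimum degree $\delta(G)\ge\alpha n$.
   Context: All graphs are finite and simple, and an $n$-vertex graph has vertex set $\{1,\dots,n\}$. $G(n,p)$ is the binomial random graph on $\{1,\dots,n\}$ in which each of the $\binom n2$ possible edges is present independently with probability $p$; $G\cup G(n,p)$ is the graph on $\{1,\dots,n\}$ whose edge set is the union of the two edge sets. For an integer $m\ge1$, the $m$-th power $H^m$ of a graph $H$ is the graph on the same vertex set in which two distinct vertices are adjacent if and only if their distance in $H$ is at most $m$. For integers $m\ge 1$ and $n\ge m+2$, $\mathcal{P}^m_n$ is the set of all $n$-vertex graphs that contain (as a not necessarily induced subgraph) the $m$-th power of a Hamiltonian cycle, i.e. of a cycle through all $n$ vertices. *)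

theory Defs
  imports "HOL-Probability.Probability"
begin

text \<open>
  A graph is represented by its set of edges, an edge being a two-element set of vertices; the
  vertex set is \<open>{1..n}\<close> throughout. Hence the union of two graphs on \<open>{1..n}\<close>
  is the union of their edge sets, and \<open>\<subseteq>\<close> is the subgraph relation between them.
\<close>

type_synonym 'a edges = "'a set set"

definition all_edges :: "nat \<Rightarrow> nat edges" where
  "all_edges n = {e. e \<subseteq> {1..n} \<and> card e = 2}"

definition graphs :: "nat \<Rightarrow> nat edges set" where
  "graphs n = Pow (all_edges n)"

definition degree :: "'a edges \<Rightarrow> 'a \<Rightarrow> nat" where
  "degree E v = card {e \<in> E. v \<in> e}"

definition min_degree :: "nat \<Rightarrow> nat edges \<Rightarrow> nat" where
  "min_degree n E = Min (degree E ` {1..n})"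

definition is_path :: "'a edges \<Rightarrow> 'a \<Rightarrow> 'a list \<Rightarrow> 'a \<Rightarrow> bool" where
  "is_path E u vs v \<longleftrightarrow> vs \<noteq> [] \<and> hd vs = u \<and> last vs = v \<and> distinct vs \<and>
     successively (\<lambda>x y. {x, y} \<in> E) vs"

text \<open>The distance is \<open>\<infinity>\<close> (the infimum of the empty set) if no path exists.\<close>

definition graph_dist :: "'a edges \<Rightarrow> 'a \<Rightarrow> 'a \<Rightarrow> enat" where
  "graph_dist E u v = Inf {enat (length vs - 1) | vs. is_path E u vs v}"

definition graph_power :: "nat \<Rightarrow> nat edges \<Rightarrow> nat \<Rightarrow> nat edges" where
  "graph_power n E m = {{u, v} | u v.
     u \<in> {1..n} \<and> v \<in> {1..n} \<and> u \<noteq> v \<and> graph_dist E u v \<le> enat m}"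

definition hamiltonian_cycle :: "nat \<Rightarrow> nat edges \<Rightarrow> bool" where
  "hamiltonian_cycle n H \<longleftrightarrow> n \<ge> 3 \<and> (\<exists>vs. distinct vs \<and> set vs = {1..n} \<and>
     H = {{vs ! i, vs ! ((i + 1) mod n)} | i. i < n})"

text \<open>
  Meant for \<open>m \<ge> 1\<close> and \<open>n \<ge> m + 2\<close>. Since the cycle spans all vertices
  and may visit them in any order, containing a copy of its power means containing its edges.
\<close>

definition power_ham :: "nat \<Rightarrow> nat \<Rightarrow> nat edges set" where
  "power_ham m n = {E \<in> graphs n. \<exists>H. hamiltonian_cycle n H \<and> graph_power n H m \<subseteq> E}"

definition gnp :: "nat \<Rightarrow> real \<Rightarrow> nat edges pmf" where
  "gnp n p = map_pmf (\<lambda>f. {e \<in> all_edges n. f e})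
     (Pi_pmf (all_edges n) False (\<lambda>_. bernoulli_pmf p))"

text \<open>
  The minimum ranges over a finite set. For \<open>\<alpha> < 1\<close> this set is nonempty for all large
  \<open>n\<close> (it contains the value for the complete graph); the finitely many other
  \<open>n\<close>, where \<^const>\<open>Min\<close> may be applied to the empty set, do not affect the limit.
\<close>

definition ensures :: "real \<Rightarrow> (nat \<Rightarrow> real) \<Rightarrow> (nat \<Rightarrow> nat edges set) \<Rightarrow> bool" where
  "ensures \<alpha> p \<P> \<longleftrightarrow>
     (\<lambda>n. Min ((\<lambda>G. measure_pmf.prob (gnp n (p n)) {R. G \<union> R \<in> \<P> n}) `
              {G \<in> graphs n. real (min_degree n G) \<ge> \<alpha> * real n})) \<longlonglongrightarrow> 1"

end

theory Submission
  imports Defs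
begin

text \<open>
  Write \<open>m = k + 1\<close>, \<open>V = {1..n}\<close>, and \<open>R\<close> for the random graph.

  Randomness enters through a single union bound. Suppose that for each \<open>G\<close> there are at most
  \<open>D ^ n\<close> sets of \<open>\<gamma> * n\<^sup>2\<close> or more edges each, such that every \<open>R\<close> meeting
  all of them gives a graph \<open>G \<union> R\<close> with the desired property. A fixed set is missed with
  probability at most \<open>exp (- p * \<gamma> * n\<^sup>2)\<close>, so for \<open>p \<ge> C / n\<close> with
  \<open>C = (ln D + 1) / \<gamma>\<close> the property fails with probability at most \<open>exp (- n)\<close>,
  uniformly in \<open>G\<close> (\<open>ensures_if_certified\<close>). What remains is deterministic: find such
  a family of edge sets, a certificate.

  For \<open>m = 1\<close> it suffices that \<open>R\<close> joins any two disjoint linear sets of vertices. Both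
  ends of a longest path in \<open>G \<union> R\<close> have linearly many chords in \<open>G\<close>, and one edge of
  \<open>R\<close> between suitable chords closes the path to a cycle on the same vertices; as the graph is
  connected, this cycle is Hamiltonian (\<open>certified_cycle\<close>).

  For \<open>m \<ge> 2\<close> the power of the cycle consists mostly of pairs of consecutive vertices. The
  two vertices of a pair are joined by an edge of \<open>R\<close>; all other adjacencies lie in
  \<open>G\<close>. Three facts make this possible.

  First, as \<open>\<delta>(G)\<close> exceeds \<open>(1 - 1 / m) * n\<close> by a linear amount, any \<open>m\<close>
  vertices have linearly many common neighbours in \<open>G\<close>. Hence any pattern that can be built up
  vertex by vertex with at most \<open>m\<close> earlier neighbours for each new vertex is found in \<open>G\<close>
  with positive density. Such a pattern exists that leads from an arbitrary ordered clique of \<open>m\<close>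
  vertices into an \<open>m\<close>-clique from an arbitrary dense family (\<open>patterns_dense\<close>).

  Second, a dense family of tuples has a dense blow-up (\<open>dense_blow_up\<close>), in which each
  vertex of the pattern is replaced by several pairs. Running around a blown-up clique of
  \<open>m\<close> vertices, one pair per vertex, is an \<open>m\<close>-th power of a path.

  Third, the pairs can be chosen one after another as edges of \<open>R\<close>: at each step, the pairs that
  leave densely many completions form a set of quadratically many edges, which is put into the
  certificate (\<open>paired_prefix_exists\<close>). There are polynomially many such sets for each choice
  of the set of available vertices, of the starting clique and of the target family, and
  exponentially many choices of these.

  The resulting segments (\<open>segment_exists\<close>) are strung together. Segments through neighbourhoods
  of vertices yield blocks of \<open>2 * m\<close> vertices that can absorb a vertex in their middle; with a
  linear number of segments, all but few vertices get linearly many such blocks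
  (\<open>many_absorbers\<close>), and the exceptional vertices are put on the path directly
  (\<open>cover_set\<close>). Then the path is extended over most of the remaining vertices
  (\<open>cover_most\<close>); here an exponential potential function guides the choice of the target
  cliques so that every vertex keeps its proportion of neighbours among the unvisited vertices. A last
  segment closes the path, and the few leftover vertices are absorbed (\<open>close_and_absorb\<close>).
\<close>

section \<open>Dense families of tuples and their blow-ups\<close>
definition tuples :: "'a set \<Rightarrow> nat \<Rightarrow> 'a list set" where
  "tuples V m = {xs. set xs \<subseteq> V \<and> length xs = m}"

lemma finite_tuples [simp, intro]: "finite V \<Longrightarrow> finite (tuples V m)"
  unfolding tuples_def by (rule finite_lists_length_eq)

lemma card_tuples: "finite V \<Longrightarrow> card (tuples V m) = card V ^ m"
  unfolding tuples_def by (rule card_lists_length_eq)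

lemma extensions_subset:
  assumes "T \<subseteq> tuples V (a + b)" "xs \<in> tuples V a"
  shows "{ys. xs @ ys \<in> T} \<subseteq> tuples V b"
proof
  fix ys assume "ys \<in> {ys. xs @ ys \<in> T}"
  then have "xs @ ys \<in> tuples V (a + b)" using assms(1) by blast
  then show "ys \<in> tuples V b" using assms(2) by (simp add: tuples_def)
qed

lemma card_eq_sum_extensions:
  assumes "finite V" "T \<subseteq> tuples V (a + b)"
  shows "card T = (\<Sum>xs\<in>tuples V a. card {ys. xs @ ys \<in> T})"
proof -
  have sub: "{ys. xs @ ys \<in> T} \<subseteq> tuples V b" if "xs \<in> tuples V a" for xs
    using extensions_subset[OF assms(2) that] .
  have fin: "finite {ys. xs @ ys \<in> T}" if "xs \<in> tuples V a" for xs
    using finite_subset[OF sub[OF that]] assms(1) by blast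
  have "bij_betw (\<lambda>(xs, ys). xs @ ys) (SIGMA xs:tuples V a. {ys. xs @ ys \<in> T}) T"
  proof (rule bij_betwI[where g = "\<lambda>zs. (take a zs, drop a zs)"])
    show "(\<lambda>(xs, ys). xs @ ys) \<in> (SIGMA xs:tuples V a. {ys. xs @ ys \<in> T}) \<rightarrow> T"
      by auto
    show "(\<lambda>zs. (take a zs, drop a zs)) \<in> T \<rightarrow> (SIGMA xs:tuples V a. {ys. xs @ ys \<in> T})"
    proof
      fix zs assume zs: "zs \<in> T"
      then have "zs \<in> tuples V (a + b)" using assms(2) by blast
      then have "take a zs \<in> tuples V a"
        by (auto simp: tuples_def dest: in_set_takeD)
      with zs show "(take a zs, drop a zs) \<in> (SIGMA xs:tuples V a. {ys. xs @ ys \<in> T})"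
        by simp
    qed
  qed (auto simp: tuples_def)
  then have "card T = card (SIGMA xs:tuples V a. {ys. xs @ ys \<in> T})"
    by (metis bij_betw_same_card)
  also have "\<dots> = (\<Sum>xs\<in>tuples V a. card {ys. xs @ ys \<in> T})"
    using assms(1) fin by (subst card_SigmaI) auto
  finally show ?thesis .
qed

text \<open>
  Averaging: prefixes with fewer than \<open>c / 2 * n ^ b\<close> completions account for at most half of
  \<open>T\<close>, and every other prefix has at most \<open>n ^ b\<close> completions.
\<close>
lemma card_popular_prefixes:
  fixes c :: real
  assumes V: "finite V" "V \<noteq> {}" and T: "T \<subseteq> tuples V (a + b)"
    and dense: "real (card T) \<ge> c * real (card V) ^ (a + b)"
  shows "real (card {xs \<in> tuples V a. real (card {ys. xs @ ys \<in> T}) \<ge> c / 2 * real (card V) ^ b})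
           \<ge> c / 2 * real (card V) ^ a"
proof -
  define n where "n = real (card V)"
  define P where "P = {xs \<in> tuples V a. real (card {ys. xs @ ys \<in> T}) \<ge> c / 2 * n ^ b}"
  have n: "n > 0" using V by (simp add: n_def card_gt_0_iff)
  have finP: "finite P" unfolding P_def using V(1) by auto
  have le: "real (card {ys. xs @ ys \<in> T}) \<le> n ^ b" if "xs \<in> tuples V a" for xs
  proof -
    have "{ys. xs @ ys \<in> T} \<subseteq> tuples V b"
      using extensions_subset[OF T that] .
    then have "card {ys. xs @ ys \<in> T} \<le> card V ^ b"
      using card_mono V(1) by (metis card_tuples finite_tuples)
    then show ?thesis unfolding n_def by (metis of_nat_le_iff of_nat_power)
  qed
  show ?thesis
  proof (cases "c \<ge> 0")
    case False
    have "c / 2 * n ^ a \<le> 0" using False n by (simp add: mult_nonpos_nonneg)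
    then show ?thesis unfolding n_def[symmetric] P_def[symmetric]
      by (meson of_nat_0_le_iff order_trans)
  next
    case True
    have "c * n ^ (a + b) \<le> real (card T)" using dense by (simp add: n_def)
    also have "\<dots> = (\<Sum>xs\<in>tuples V a. real (card {ys. xs @ ys \<in> T}))"
      using card_eq_sum_extensions[OF V(1) T] by simp
    also have "\<dots> \<le> (\<Sum>xs\<in>tuples V a. (if xs \<in> P then n ^ b else 0) + c / 2 * n ^ b)"
    proof (rule sum_mono)
      fix xs assume xs: "xs \<in> tuples V a"
      show "real (card {ys. xs @ ys \<in> T}) \<le> (if xs \<in> P then n ^ b else 0) + c / 2 * n ^ b"
      proof (cases "xs \<in> P")
        case True
        have "0 \<le> c / 2 * n ^ b" using \<open>c \<ge> 0\<close> n by simp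
        with True le[OF xs] show ?thesis by simp
      next
        case False
        then show ?thesis using xs unfolding P_def by auto
      qed
    qed
    also have "\<dots> = (\<Sum>xs\<in>tuples V a. if xs \<in> P then n ^ b else 0) + real (card (tuples V a)) * (c / 2 * n ^ b)"
      by (simp add: sum.distrib)
    also have "(\<Sum>xs\<in>tuples V a. if xs \<in> P then n ^ b else 0) = real (card P) * n ^ b"
    proof -
      have "(\<Sum>xs\<in>tuples V a. if xs \<in> P then n ^ b else 0) = (\<Sum>xs\<in>tuples V a \<inter> P. n ^ b)"
        using V(1) by (intro sum.inter_restrict[symmetric]) simp
      also have "tuples V a \<inter> P = P" unfolding P_def by auto
      finally show ?thesis by simp
    qed
    also have "real (card (tuples V a)) = n ^ a" using V(1) by (simp add: card_tuples n_def)
    finally have "c / 2 * n ^ a * n ^ b \<le> real (card P) * n ^ b"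
      by (simp add: power_add algebra_simps)
    then have "c / 2 * n ^ a \<le> real (card P)" using n by (simp add: mult_le_cancel_right)
    then show ?thesis unfolding n_def P_def .
  qed
qed

text \<open>Entry by entry there are at least \<open>M\<close> choices, however the preceding entries were chosen.\<close>
lemma card_greedy_tuples:
  fixes M :: real
  assumes "finite V" "M \<ge> 0"
    and sub: "\<And>xs. length xs < m \<Longrightarrow> set xs \<subseteq> V \<Longrightarrow> C xs \<subseteq> V"
    and big: "\<And>xs. length xs < m \<Longrightarrow> set xs \<subseteq> V \<Longrightarrow>
               \<forall>j<length xs. xs ! j \<in> C (take j xs) \<Longrightarrow> real (card (C xs)) \<ge> M"
  shows "{xs. length xs = m \<and> (\<forall>j<m. xs ! j \<in> C (take j xs))} \<subseteq> tuples V m \<and>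
         real (card {xs. length xs = m \<and> (\<forall>j<m. xs ! j \<in> C (take j xs))}) \<ge> M ^ m"
  using sub big
proof (induction m)
  case 0
  have "{xs::'a list. length xs = 0 \<and> (\<forall>j<0. xs ! j \<in> C (take j xs))} = {[]}" by auto
  then show ?case by (auto simp: tuples_def)
next
  case (Suc m)
  let ?G = "\<lambda>m. {xs. length xs = m \<and> (\<forall>j<m. xs ! j \<in> C (take j xs))}"
  have IH: "?G m \<subseteq> tuples V m" "real (card (?G m)) \<ge> M ^ m"
    using Suc.IH Suc.prems by auto
  have eq: "?G (Suc m) = (\<lambda>(xs, x). xs @ [x]) ` (SIGMA xs:?G m. C xs)"
  proof (intro set_eqI iffI)
    fix ys assume ys: "ys \<in> ?G (Suc m)"
    then have ne: "ys \<noteq> []" by auto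
    have l: "length (butlast ys) = m" using ys by simp
    have tb: "take j (butlast ys) = take j ys" if "j \<le> m" for j
      using that ys by (simp add: take_butlast)
    have "ys = butlast ys @ [last ys]" using ne by simp
    moreover have "butlast ys \<in> ?G m"
      using ys by (auto simp: nth_butlast tb)
    moreover have "last ys \<in> C (butlast ys)"
    proof -
      have "ys ! m \<in> C (take m ys)" using ys by auto
      moreover have "take m ys = butlast ys" using ys by (simp add: butlast_conv_take)
      moreover have "ys ! m = last ys" using ys ne by (simp add: last_conv_nth)
      ultimately show ?thesis by simp
    qed
    ultimately show "ys \<in> (\<lambda>(xs, x). xs @ [x]) ` (SIGMA xs:?G m. C xs)"
      by (intro image_eqI[where x = "(butlast ys, last ys)"]) auto
  next
    fix ys assume "ys \<in> (\<lambda>(xs, x). xs @ [x]) ` (SIGMA xs:?G m. C xs)"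
    then show "ys \<in> ?G (Suc m)"
      by (auto simp: nth_append less_Suc_eq)
  qed
  have inj: "inj_on (\<lambda>(xs, x). xs @ [x]) (SIGMA xs:?G m. C xs)"
    by (auto simp: inj_on_def)
  have CV: "C xs \<subseteq> V" if "xs \<in> ?G m" for xs
    using that IH(1) Suc.prems(1)[of xs] by (auto simp: tuples_def)
  have fin: "finite (C xs)" if "xs \<in> ?G m" for xs
    using CV[OF that] assms(1) finite_subset by blast
  have "M ^ Suc m = M ^ m * M" by simp
  also have "\<dots> \<le> real (card (?G m)) * M"
    using IH(2) assms(2) by (intro mult_right_mono) auto
  also have "\<dots> = (\<Sum>xs\<in>?G m. M)" by simp
  also have "\<dots> \<le> (\<Sum>xs\<in>?G m. real (card (C xs)))"
  proof (rule sum_mono)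
    fix xs assume xs: "xs \<in> ?G m"
    then have "set xs \<subseteq> V" using IH(1) by (auto simp: tuples_def)
    with xs show "M \<le> real (card (C xs))" by (intro Suc.prems(2)) auto
  qed
  also have "\<dots> = real (card (SIGMA xs:?G m. C xs))"
    using fin finite_subset[OF IH(1)] assms(1) by (subst card_SigmaI) auto
  also have "\<dots> = real (card (?G (Suc m)))"
    unfolding eq using inj by (simp add: card_image)
  finally have "real (card (?G (Suc m))) \<ge> M ^ Suc m" .
  moreover have "?G (Suc m) \<subseteq> tuples V (Suc m)"
  proof
    fix ys assume "ys \<in> ?G (Suc m)"
    then obtain xs x where "ys = xs @ [x]" "xs \<in> ?G m" "x \<in> C xs" unfolding eq by auto
    moreover from this have "xs \<in> tuples V m" "x \<in> V" using IH(1) CV by blast+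
    ultimately show "ys \<in> tuples V (Suc m)" by (simp add: tuples_def)
  qed
  ultimately show ?case by blast
qed

text \<open>
  Each of the first \<open>h\<close> coordinates of a tuple is replaced by \<open>s\<close> vertices, those of
  coordinate \<open>c\<close> standing at the positions \<open>c * s, \<dots>, c * s + s - 1\<close>; the remaining
  coordinates \<open>zs\<close> stay single. Every choice \<open>\<sigma>\<close> of one copy per coordinate has to
  give a member of \<open>T\<close>. Repetitions among the copies are not excluded here.
\<close>
definition blow_up :: "nat \<Rightarrow> nat \<Rightarrow> 'a list set \<Rightarrow> 'a list set" where
  "blow_up s h T = {X @ zs | X zs. length X = s * h \<and>
     (\<forall>\<sigma>. (\<forall>c<h. \<sigma> c < s) \<longrightarrow> map (\<lambda>c. X ! (c * s + \<sigma> c)) [0..<h] @ zs \<in> T)}"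

lemma blow_up_subset:
  assumes "s > 0" "T \<subseteq> tuples V (h + b)"
  shows "blow_up s h T \<subseteq> tuples V (s * h + b)"
proof
  fix ys assume "ys \<in> blow_up s h T"
  then obtain X zs where ys: "ys = X @ zs" and X: "length X = s * h"
    and tr: "\<And>\<sigma>. (\<forall>c<h. \<sigma> c < s) \<Longrightarrow> map (\<lambda>c. X ! (c * s + \<sigma> c)) [0..<h] @ zs \<in> T"
    unfolding blow_up_def by blast
  have "map (\<lambda>c. X ! (c * s + 0)) [0..<h] @ zs \<in> tuples V (h + b)"
    using tr[of "\<lambda>_. 0"] assms by auto
  then have zs: "set zs \<subseteq> V" "length zs = b" by (auto simp: tuples_def)
  have "X ! i \<in> V" if "i < s * h" for i
  proof -
    have "i div s < h" using that assms(1) by (simp add: less_mult_imp_div_less mult.commute)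
    have "map (\<lambda>c. X ! (c * s + i mod s)) [0..<h] @ zs \<in> tuples V (h + b)"
      using tr[of "\<lambda>_. i mod s"] assms by auto
    then have sub: "(\<lambda>c. X ! (c * s + i mod s)) ` {0..<h} \<subseteq> V" by (simp add: tuples_def)
    have "X ! (i div s * s + i mod s) \<in> V"
      by (rule subsetD[OF sub], rule imageI) (use \<open>i div s < h\<close> in simp)
    then show ?thesis by (simp add: div_mult_mod_eq)
  qed
  then have "set X \<subseteq> V" using X by (auto simp: in_set_conv_nth)
  then show "ys \<in> tuples V (s * h + b)" using ys X zs by (simp add: tuples_def)
qed

text \<open>
  One coordinate is replaced by \<open>s\<close> copies. A positive proportion of the tails have a positive
  proportion of vertices as first coordinate, and any \<open>s\<close> of those can serve as copies. Popularity
  thus takes the place of a convexity argument, at the price of a worse constant.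
\<close>
lemma dense_power_of_first_coordinate:
  fixes c :: real
  assumes V: "finite V" "V \<noteq> {}" and T: "T \<subseteq> tuples V (Suc m)" and c: "c > 0"
    and dense: "real (card T) \<ge> c * real (card V) ^ Suc m"
  shows "{X @ ys | X ys. length X = s \<and> ys \<in> tuples V m \<and> (\<forall>x\<in>set X. x # ys \<in> T)} \<subseteq> tuples V (s + m) \<and>
    real (card {X @ ys | X ys. length X = s \<and> ys \<in> tuples V m \<and> (\<forall>x\<in>set X. x # ys \<in> T)})
      \<ge> (c / 2) ^ Suc s * real (card V) ^ (s + m)"
proof -
  define n where "n = real (card V)"
  have n: "n > 0" using V by (simp add: n_def card_gt_0_iff)
  let ?f = "\<lambda>xs. tl xs @ [hd xs]"
  define T' where "T' = ?f ` T"
  have inj: "inj_on ?f T"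
  proof (rule inj_onI)
    fix x y assume "x \<in> T" "y \<in> T" and e: "tl x @ [hd x] = tl y @ [hd y]"
    then have "x \<noteq> []" "y \<noteq> []" using T by (auto simp: tuples_def)
    then show "x = y" using e by (metis append1_eq_conv list.collapse)
  qed
  have T'sub: "T' \<subseteq> tuples V (m + 1)"
  proof
    fix t' assume "t' \<in> T'"
    then obtain t where t: "t \<in> T" "t' = tl t @ [hd t]" unfolding T'_def by auto
    then have "t \<in> tuples V (Suc m)" using T by blast
    then have "t \<noteq> []" "set t \<subseteq> V" "length t = Suc m" by (auto simp: tuples_def)
    then show "t' \<in> tuples V (m + 1)"
      unfolding t(2) by (cases t) (auto simp: tuples_def)
  qed
  have T'mem: "ys @ [x] \<in> T' \<longleftrightarrow> x # ys \<in> T" for x ys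
  proof
    assume "ys @ [x] \<in> T'"
    then obtain t where t: "t \<in> T" "ys @ [x] = tl t @ [hd t]" unfolding T'_def by auto
    then have "t \<noteq> []" using T by (auto simp: tuples_def)
    then show "x # ys \<in> T" using t by simp
  next
    assume "x # ys \<in> T"
    then show "ys @ [x] \<in> T'" unfolding T'_def by force
  qed
  have "card T' = card T" unfolding T'_def using inj by (rule card_image)
  then have "real (card T') \<ge> c * n ^ (m + 1)" using dense by (simp add: n_def)
  define P where "P = {ys \<in> tuples V m. real (card {zs. ys @ zs \<in> T'}) \<ge> c / 2 * n ^ 1}"
  have P: "real (card P) \<ge> c / 2 * n ^ m"
    using card_popular_prefixes[OF V T'sub, of c] \<open>real (card T') \<ge> c * n ^ (m + 1)\<close>
    unfolding P_def n_def by simp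
  define N where "N ys = {x. x # ys \<in> T}" for ys
  have N: "N ys \<subseteq> V" "real (card (N ys)) \<ge> c / 2 * n" if "ys \<in> P" for ys
  proof -
    show "N ys \<subseteq> V" using T by (auto simp: N_def tuples_def)
    have "{zs. ys @ zs \<in> T'} = (\<lambda>x. [x]) ` N ys"
    proof (intro set_eqI iffI)
      fix zs assume "zs \<in> {zs. ys @ zs \<in> T'}"
      then have z: "ys @ zs \<in> T'" by simp
      then have "length zs = 1" using T'sub that by (auto simp: P_def tuples_def)
      then obtain x where "zs = [x]" by (metis One_nat_def length_0_conv length_Suc_conv)
      then show "zs \<in> (\<lambda>x. [x]) ` N ys" using z T'mem by (auto simp: N_def)
    qed (auto simp: N_def T'mem)
    then have "card {zs. ys @ zs \<in> T'} = card (N ys)"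
      by (simp add: card_image inj_on_def)
    then show "real (card (N ys)) \<ge> c / 2 * n" using that by (simp add: P_def)
  qed
  let ?R = "{X @ ys | X ys. length X = s \<and> ys \<in> tuples V m \<and> (\<forall>x\<in>set X. x # ys \<in> T)}"
  have sub: "?R \<subseteq> tuples V (s + m)"
  proof
    fix zs assume "zs \<in> ?R"
    then obtain X ys where z: "zs = X @ ys" "length X = s" "ys \<in> tuples V m" "\<forall>x\<in>set X. x # ys \<in> T"
      by blast
    have "set X \<subseteq> V"
    proof
      fix x assume "x \<in> set X"
      then have "x # ys \<in> tuples V (Suc m)" using z(4) T by blast
      then show "x \<in> V" by (simp add: tuples_def)
    qed
    then show "zs \<in> tuples V (s + m)" using z by (simp add: tuples_def)
  qed
  let ?S = "SIGMA ys:P. tuples (N ys) s"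
  have "(\<lambda>(ys, X). X @ ys) ` ?S \<subseteq> ?R"
  proof clarify
    fix ys X assume "ys \<in> P" "X \<in> tuples (N ys) s"
    then have "length X = s" "ys \<in> tuples V m" "\<forall>x\<in>set X. x # ys \<in> T"
      by (auto simp: P_def N_def tuples_def)
    then show "\<exists>X' ys'. X @ ys = X' @ ys' \<and> length X' = s \<and> ys' \<in> tuples V m \<and> (\<forall>x\<in>set X'. x # ys' \<in> T)"
      by blast
  qed
  moreover have "finite ?R" using sub V(1) finite_subset by blast
  moreover have "inj_on (\<lambda>(ys, X). X @ ys) ?S"
    by (auto simp: inj_on_def tuples_def)
  ultimately have "card ?S \<le> card ?R"
    by (intro card_inj_on_le)
  moreover have "real (card ?S) \<ge> c / 2 * n ^ m * (c / 2 * n) ^ s"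
  proof -
    have finP: "finite P" unfolding P_def using V(1) by auto
    have finN: "finite (N ys)" if "ys \<in> P" for ys using N(1)[OF that] V(1) finite_subset by blast
    have "c / 2 * n ^ m * (c / 2 * n) ^ s \<le> real (card P) * (c / 2 * n) ^ s"
      using P c n by (intro mult_right_mono) auto
    also have "\<dots> = (\<Sum>ys\<in>P. (c / 2 * n) ^ s)" by simp
    also have "\<dots> \<le> (\<Sum>ys\<in>P. real (card (tuples (N ys) s)))"
    proof (rule sum_mono)
      fix ys assume "ys \<in> P"
      then show "(c / 2 * n) ^ s \<le> real (card (tuples (N ys) s))"
        using N(2)[of ys] finN[of ys] c n by (simp add: card_tuples power_mono)
    qed
    also have "\<dots> = real (card ?S)"
      using finP finN by (subst card_SigmaI) auto
    finally show ?thesis .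
  qed
  ultimately have "real (card ?R) \<ge> c / 2 * n ^ m * (c / 2 * n) ^ s" by linarith
  also have "c / 2 * n ^ m * (c / 2 * n) ^ s = (c / 2) ^ Suc s * n ^ (s + m)"
    unfolding power_mult_distrib power_add power_Suc by (simp only: mult_ac)
  finally show ?thesis using sub unfolding n_def by blast
qed

text \<open>
  By induction on the number of coordinates: duplicate the first coordinate, fix a popular tuple of
  copies for it, and blow up the remaining coordinates of its completions. The constant depends only
  on \<open>c\<close>, \<open>s\<close> and the numbers of coordinates.
\<close>
lemma dense_blow_up:
  fixes c :: real
  assumes "c > 0" "s > 0"
  shows "\<exists>c'>0. \<forall>(V::'a set) T. finite V \<longrightarrow> V \<noteq> {} \<longrightarrow> T \<subseteq> tuples V (h + b) \<longrightarrow>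
           real (card T) \<ge> c * real (card V) ^ (h + b) \<longrightarrow>
           real (card (blow_up s h T)) \<ge> c' * real (card V) ^ (s * h + b)"
  using assms(1)
proof (induction h arbitrary: c)
  case 0
  have "blow_up s 0 T = T" for T :: "'a list set" unfolding blow_up_def by auto
  then show ?case using 0 by auto
next
  case (Suc h)
  define c1 where "c1 = (c / 2) ^ Suc s"
  have "c1 > 0" using Suc.prems by (simp add: c1_def)
  then have "c1 / 2 > 0" by simp
  from Suc.IH[OF this] obtain c2 where c2: "c2 > 0"
    and IH: "\<And>(V::'a set) T. finite V \<Longrightarrow> V \<noteq> {} \<Longrightarrow> T \<subseteq> tuples V (h + b) \<Longrightarrow>
           real (card T) \<ge> c1 / 2 * real (card V) ^ (h + b) \<Longrightarrow>
           real (card (blow_up s h T)) \<ge> c2 * real (card V) ^ (s * h + b)" by blast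
  show ?case
  proof (intro exI[of _ "c1 / 2 * c2"] conjI allI impI)
    show "c1 / 2 * c2 > 0" using c2 \<open>c1 > 0\<close> by simp
    fix V :: "'a set" and T
    assume V: "finite V" "V \<noteq> {}" and T: "T \<subseteq> tuples V (Suc h + b)"
      and dense: "real (card T) \<ge> c * real (card V) ^ (Suc h + b)"
    define n where "n = real (card V)"
    have n: "n > 0" using V by (simp add: n_def card_gt_0_iff)
    define T1 where "T1 = {X @ ys | X ys. length X = s \<and> ys \<in> tuples V (h + b) \<and> (\<forall>x\<in>set X. x # ys \<in> T)}"
    have T1: "T1 \<subseteq> tuples V (s + (h + b))" "real (card T1) \<ge> c1 * n ^ (s + (h + b))"
      using dense_power_of_first_coordinate[OF V, of T "h + b" c s] T Suc.prems dense
      unfolding T1_def c1_def n_def by auto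
    define P where "P = {X \<in> tuples V s. real (card {ys. X @ ys \<in> T1}) \<ge> c1 / 2 * n ^ (h + b)}"
    have P: "real (card P) \<ge> c1 / 2 * n ^ s"
      using card_popular_prefixes[OF V T1(1)] T1(2) unfolding P_def n_def by blast
    have finP: "finite P" unfolding P_def using V(1) by auto
    define B where "B X = blow_up s h {ys. X @ ys \<in> T1}" for X
    have sub: "{ys. X @ ys \<in> T1} \<subseteq> tuples V (h + b)" if "X \<in> P" for X
    by (rule extensions_subset[OF T1(1)]) (use that in \<open>simp add: P_def\<close>)
    have B: "B X \<subseteq> tuples V (s * h + b)" "real (card (B X)) \<ge> c2 * n ^ (s * h + b)" if "X \<in> P" for X
    proof -
      show "B X \<subseteq> tuples V (s * h + b)"
        using blow_up_subset[OF assms(2) sub[OF that]] unfolding B_def .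
      have "c1 / 2 * n ^ (h + b) \<le> real (card {ys. X @ ys \<in> T1})" using that unfolding P_def by simp
      then show "real (card (B X)) \<ge> c2 * n ^ (s * h + b)"
        using IH[OF V sub[OF that]] unfolding B_def n_def by simp
    qed
    have finB: "finite (B X)" if "X \<in> P" for X
      using B(1)[OF that] V(1) finite_subset by blast
    let ?S = "SIGMA X:P. B X"
    have "(\<lambda>(X, ys). X @ ys) ` ?S \<subseteq> blow_up s (Suc h) T"
    proof clarify
      fix X0 W assume X0: "X0 \<in> P" and W: "W \<in> B X0"
      from W obtain X zs where W_eq: "W = X @ zs" and X: "length X = s * h"
        and tr: "\<And>\<sigma>. (\<forall>c<h. \<sigma> c < s) \<Longrightarrow> X0 @ map (\<lambda>c. X ! (c * s + \<sigma> c)) [0..<h] @ zs \<in> T1"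
        unfolding B_def blow_up_def by blast
      have lX0: "length X0 = s" using X0 by (simp add: P_def tuples_def)
      have "map (\<lambda>c. (X0 @ X) ! (c * s + \<sigma> c)) [0..<Suc h] @ zs \<in> T"
        if \<sigma>: "\<forall>c<Suc h. \<sigma> c < s" for \<sigma>
      proof -
        have "X0 @ map (\<lambda>c. X ! (c * s + \<sigma> (Suc c))) [0..<h] @ zs \<in> T1"
          using tr[of "\<lambda>c. \<sigma> (Suc c)"] \<sigma> by auto
        then have "\<forall>x\<in>set X0. x # map (\<lambda>c. X ! (c * s + \<sigma> (Suc c))) [0..<h] @ zs \<in> T"
          unfolding T1_def using lX0 by auto
        then have "X0 ! \<sigma> 0 # map (\<lambda>c. X ! (c * s + \<sigma> (Suc c))) [0..<h] @ zs \<in> T"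
          using \<sigma> lX0 by auto
        moreover have "map (\<lambda>c. (X0 @ X) ! (c * s + \<sigma> c)) [0..<Suc h] =
            X0 ! \<sigma> 0 # map (\<lambda>c. X ! (c * s + \<sigma> (Suc c))) [0..<h]"
        proof -
          have "[0..<Suc h] = 0 # map Suc [0..<h]"
            by (simp add: map_Suc_upt upt_conv_Cons del: upt_Suc)
          then show ?thesis using \<sigma> lX0 by (simp add: nth_append add.assoc del: upt_Suc)
        qed
        ultimately show ?thesis by simp
      qed
      then show "X0 @ W \<in> blow_up s (Suc h) T"
        unfolding blow_up_def W_eq using lX0 X
        by (intro CollectI exI[of _ "X0 @ X"] exI[of _ zs] conjI allI impI) auto
    qed
    moreover have "finite (blow_up s (Suc h) T)"
      using blow_up_subset[OF assms(2) T] V(1) finite_subset by blast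
    moreover have "inj_on (\<lambda>(X, ys). X @ ys) ?S"
      by (auto simp: inj_on_def P_def tuples_def)
    ultimately have "card ?S \<le> card (blow_up s (Suc h) T)"
      by (intro card_inj_on_le)
    moreover have "real (card ?S) \<ge> c1 / 2 * n ^ s * (c2 * n ^ (s * h + b))"
    proof -
      have "c1 / 2 * n ^ s * (c2 * n ^ (s * h + b)) \<le> real (card P) * (c2 * n ^ (s * h + b))"
        using P c2 n by (intro mult_right_mono) auto
      also have "\<dots> = (\<Sum>X\<in>P. c2 * n ^ (s * h + b))" by simp
      also have "\<dots> \<le> (\<Sum>X\<in>P. real (card (B X)))" using B(2) by (intro sum_mono) auto
      also have "\<dots> = real (card ?S)" using finP finB by (subst card_SigmaI) auto
      finally show ?thesis .
    qed
    ultimately have "real (card (blow_up s (Suc h) T)) \<ge> c1 / 2 * n ^ s * (c2 * n ^ (s * h + b))" by linarith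
    also have "c1 / 2 * n ^ s * (c2 * n ^ (s * h + b)) = c1 / 2 * c2 * n ^ (s * Suc h + b)"
      by (simp add: power_add algebra_simps)
    finally show "real (card (blow_up s (Suc h) T)) \<ge> c1 / 2 * c2 * real (card V) ^ (s * Suc h + b)"
      unfolding n_def .
  qed
qed

section \<open>From certificates to probabilities\<close>
definition certified :: "real \<Rightarrow> real \<Rightarrow> nat \<Rightarrow> nat edges \<Rightarrow> nat edges set \<Rightarrow> bool" where
  "certified \<gamma> D n G P \<longleftrightarrow> (\<exists>\<Q>. finite \<Q> \<and> real (card \<Q>) \<le> D ^ n \<and>
     (\<forall>Q\<in>\<Q>. Q \<subseteq> all_edges n \<and> real (card Q) \<ge> \<gamma> * (real n)\<^sup>2) \<and>
     (\<forall>R\<subseteq>all_edges n. (\<forall>Q\<in>\<Q>. R \<inter> Q \<noteq> {}) \<longrightarrow> G \<union> R \<in> P))"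

lemma finite_all_edges [simp, intro]: "finite (all_edges n)"
  unfolding all_edges_def by (rule finite_subset[of _ "Pow {1..n}"]) auto

lemma prob_gnp_misses:
  assumes "Q \<subseteq> all_edges n" "0 \<le> p" "p \<le> 1"
  shows "measure_pmf.prob (gnp n p) {R. R \<inter> Q = {}} \<le> exp (- p * real (card Q))"
proof -
  let ?B = "\<lambda>e. if e \<in> Q then {False} else UNIV"
  have "measure_pmf.prob (gnp n p) {R. R \<inter> Q = {}} =
        measure_pmf.prob (Pi_pmf (all_edges n) False (\<lambda>_. bernoulli_pmf p)) (Pi (all_edges n) ?B)"
    unfolding gnp_def measure_map_pmf using assms(1)
    by (intro arg_cong2[where f = measure_pmf.prob]) (auto simp: Pi_def split: if_splits)
  also have "\<dots> = (\<Prod>e\<in>all_edges n. measure_pmf.prob (bernoulli_pmf p) (?B e))"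
    by (rule measure_Pi_pmf_Pi) simp
  also have "\<dots> = (\<Prod>e\<in>all_edges n. if e \<in> Q then 1 - p else 1)"
    using assms(2,3) by (intro prod.cong) (auto simp: measure_pmf_single)
  also have "\<dots> = (\<Prod>e\<in>all_edges n \<inter> Q. 1 - p)"
    by (subst prod.inter_restrict) auto
  also have "\<dots> = (1 - p) ^ card Q" using assms(1) by (simp add: Int_absorb1)
  also have "\<dots> \<le> exp (- p) ^ card Q"
    using assms exp_ge_add_one_self[of "- p"] by (intro power_mono) auto
  also have "\<dots> = exp (- p * real (card Q))" using exp_of_nat_mult[of "card Q" "- p"] by (simp add: mult.commute)
  finally show ?thesis .
qed

lemma set_pmf_gnp: "set_pmf (gnp n p) \<subseteq> Pow (all_edges n)"
  unfolding gnp_def by auto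

text \<open>Union bound over the at most \<open>D ^ n\<close> sets of a certificate.\<close>
lemma prob_ge_if_certified:
  assumes cert: "certified \<gamma> D n G P" and p: "0 \<le> p" "p \<le> 1" and D: "D > 0"
    and large: "p * \<gamma> * (real n)\<^sup>2 \<ge> real n * (ln D + 1)"
  shows "measure_pmf.prob (gnp n p) {R. G \<union> R \<in> P} \<ge> 1 - exp (- real n)"
proof -
  obtain \<Q> where fin: "finite \<Q>" and card: "real (card \<Q>) \<le> D ^ n"
    and Q: "\<And>Q. Q \<in> \<Q> \<Longrightarrow> Q \<subseteq> all_edges n \<and> real (card Q) \<ge> \<gamma> * (real n)\<^sup>2"
    and suff: "\<And>R. R \<subseteq> all_edges n \<Longrightarrow> \<forall>Q\<in>\<Q>. R \<inter> Q \<noteq> {} \<Longrightarrow> G \<union> R \<in> P"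
    using cert unfolding certified_def by metis
  let ?M = "measure_pmf.prob (gnp n p)"
  have "?M (- {R. G \<union> R \<in> P}) \<le> ?M (\<Union>Q\<in>\<Q>. {R. R \<inter> Q = {}})"
  proof (rule measure_pmf.finite_measure_mono_AE)
    show "AE R in measure_pmf (gnp n p). R \<in> - {R. G \<union> R \<in> P} \<longrightarrow> R \<in> (\<Union>Q\<in>\<Q>. {R. R \<inter> Q = {}})"
      unfolding AE_measure_pmf_iff
    proof (intro ballI impI)
      fix R assume "R \<in> set_pmf (gnp n p)" "R \<in> - {R. G \<union> R \<in> P}"
      then have "R \<subseteq> all_edges n" "G \<union> R \<notin> P" using set_pmf_gnp by auto
      then show "R \<in> (\<Union>Q\<in>\<Q>. {R. R \<inter> Q = {}})" using suff[of R] by auto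
    qed
  qed simp
  also have "\<dots> \<le> (\<Sum>Q\<in>\<Q>. ?M {R. R \<inter> Q = {}})"
    using fin by (intro measure_pmf.finite_measure_subadditive_finite) auto
  also have "\<dots> \<le> (\<Sum>Q\<in>\<Q>. exp (- (real n * (ln D + 1))))"
  proof (rule sum_mono)
    fix Q' assume Q': "Q' \<in> \<Q>"
    have "p * (\<gamma> * (real n)\<^sup>2) \<le> p * real (card Q')"
      using Q[OF Q'] p by (intro mult_left_mono) auto
    then have "real n * (ln D + 1) \<le> p * real (card Q')" using large by (simp add: mult.assoc)
    then have "exp (- p * real (card Q')) \<le> exp (- (real n * (ln D + 1)))" by simp
    then show "?M {R. R \<inter> Q' = {}} \<le> exp (- (real n * (ln D + 1)))"
      using prob_gnp_misses[of Q' n p] Q[OF Q'] p by linarith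
  qed
  also have "\<dots> = real (card \<Q>) * exp (- (real n * (ln D + 1)))" by simp
  also have "\<dots> \<le> D ^ n * exp (- (real n * (ln D + 1)))" using card by (intro mult_right_mono) auto
  also have "\<dots> = exp (- real n)"
  proof -
    have "D ^ n = exp (real n * ln D)" using D exp_of_nat_mult[of n "ln D"] by simp
    then have "D ^ n * exp (- (real n * (ln D + 1))) = exp (real n * ln D + - (real n * (ln D + 1)))"
      by (simp only: exp_add)
    also have "real n * ln D + - (real n * (ln D + 1)) = - real n" by (simp add: algebra_simps)
    finally show ?thesis .
  qed
  finally have "?M (- {R. G \<union> R \<in> P}) \<le> exp (- real n)" .
  moreover have "?M (- {R. G \<union> R \<in> P}) = 1 - ?M {R. G \<union> R \<in> P}"
    using measure_pmf.prob_compl[of "{R. G \<union> R \<in> P}" "gnp n p"] by (simp add: Compl_eq_Diff_UNIV)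
  ultimately show ?thesis by linarith
qed

lemma degree_complete:
  assumes "v \<in> {1..n}"
  shows "degree (all_edges n) v = n - 1"
proof -
  have "{e \<in> all_edges n. v \<in> e} = (\<lambda>u. {v, u}) ` ({1..n} - {v})"
  proof (intro set_eqI iffI)
    fix e assume "e \<in> {e \<in> all_edges n. v \<in> e}"
    then have e: "e \<subseteq> {1..n}" "card e = 2" "v \<in> e" by (auto simp: all_edges_def)
    then obtain u where "e = {v, u}" "u \<noteq> v" by (auto simp: card_2_iff)
    then show "e \<in> (\<lambda>u. {v, u}) ` ({1..n} - {v})" using e by auto
  qed (use assms in \<open>auto simp: all_edges_def\<close>)
  moreover have "inj_on (\<lambda>u. {v, u}) ({1..n} - {v})" by (auto simp: inj_on_def doubleton_eq_iff)
  ultimately show ?thesis using assms unfolding degree_def by (simp add: card_image)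
qed

text \<open>
  Uniformity of the bound in \<open>G\<close> gives the bound for the minimum over \<open>G\<close>. The hypothesis
  \<open>\<alpha> < 1\<close> makes the complete graph one of the competing \<open>G\<close> for large \<open>n\<close>, so
  that the minimum is attained and is a probability.
\<close>
theorem ensures_if_certified:
  assumes \<alpha>: "\<alpha> < 1" and \<gamma>: "\<gamma> > 0" and D: "D > 0"
    and cert: "\<And>n G. n \<ge> N \<Longrightarrow> G \<in> graphs n \<Longrightarrow> real (min_degree n G) \<ge> \<alpha> * real n \<Longrightarrow>
                 certified \<gamma> D n G (P n)"
  shows "\<exists>C::real. \<forall>p. range p \<subseteq> {0..1} \<longrightarrow>
           (\<forall>\<^sub>F n in sequentially. p n \<ge> C / real n) \<longrightarrow> ensures \<alpha> p P"
proof (intro exI[of _ "(ln D + 1) / \<gamma>"] allI impI)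
  fix p :: "nat \<Rightarrow> real"
  assume p: "range p \<subseteq> {0..1}" and large: "\<forall>\<^sub>F n in sequentially. p n \<ge> (ln D + 1) / \<gamma> / real n"
  let ?A = "\<lambda>n. {G \<in> graphs n. real (min_degree n G) \<ge> \<alpha> * real n}"
  let ?f = "\<lambda>n G. measure_pmf.prob (gnp n (p n)) {R. G \<union> R \<in> P n}"
  have finA: "finite (?A n)" for n by (simp add: graphs_def)
  have "\<forall>\<^sub>F n in sequentially. \<alpha> * real n \<le> real n - 1"
    using eventually_ge_at_top[of "nat \<lceil>1 / (1 - \<alpha>)\<rceil>"]
  proof eventually_elim
    case (elim n)
    then have "1 / (1 - \<alpha>) \<le> real n" by linarith
    then show ?case using \<alpha> by (simp add: field_simps)
  qed
  then have ne: "\<forall>\<^sub>F n in sequentially. ?A n \<noteq> {}"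
    using eventually_gt_at_top[of 0]
  proof eventually_elim
    case (elim n)
    have "degree (all_edges n) ` {1..n} = {n - 1}"
    proof -
      have "degree (all_edges n) ` {1..n} = (\<lambda>_. n - 1) ` {1..n}"
        using degree_complete by (intro image_cong) auto
      then show ?thesis using elim(2) by (simp add: image_constant_conv)
    qed
    then have "min_degree n (all_edges n) = n - 1" unfolding min_degree_def by simp
    then have "all_edges n \<in> ?A n" using elim by (simp add: graphs_def of_nat_diff)
    then show ?case by blast
  qed
  have lower: "\<forall>\<^sub>F n in sequentially. 1 - exp (- real n) \<le> Min (?f n ` ?A n)"
    using ne large eventually_ge_at_top[of N] eventually_gt_at_top[of 0]
  proof eventually_elim
    case (elim n)
    have "?f n G \<ge> 1 - exp (- real n)" if "G \<in> ?A n" for G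
    proof (rule prob_ge_if_certified[OF _ _ _ D])
      show "certified \<gamma> D n G (P n)" using cert elim that by auto
      have "p n \<in> {0..1}" using p by blast
      then show "0 \<le> p n" "p n \<le> 1" by simp_all
      have "(ln D + 1) / \<gamma> / real n * (\<gamma> * (real n)\<^sup>2) \<le> p n * (\<gamma> * (real n)\<^sup>2)"
        using elim \<gamma> by (intro mult_right_mono) auto
      then show "p n * \<gamma> * (real n)\<^sup>2 \<ge> real n * (ln D + 1)"
        using elim \<gamma> by (simp add: power2_eq_square mult_ac)
    qed
    then show ?case using elim finA by (subst Min_ge_iff) auto
  qed
  have upper: "\<forall>\<^sub>F n in sequentially. Min (?f n ` ?A n) \<le> 1"
    using ne
  proof eventually_elim
    case (elim n)
    then obtain G where "G \<in> ?A n" by blast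
    then have "Min (?f n ` ?A n) \<le> ?f n G" using finA by (intro Min_le) auto
    also have "\<dots> \<le> 1" by (rule measure_pmf.prob_le_1)
    finally show ?case .
  qed
  have "(\<lambda>n. exp (- real n)) \<longlonglongrightarrow> 0"
    by (intro filterlim_compose[OF exp_at_bot] filterlim_compose[OF filterlim_uminus_at_bot_at_top]
          filterlim_real_sequentially)
  from tendsto_diff[OF tendsto_const this] have "(\<lambda>n. 1 - exp (- real n)) \<longlonglongrightarrow> 1"
    by simp
  then show "ensures \<alpha> p P"
    unfolding ensures_def by (rule tendsto_sandwich[OF lower upper]) simp
qed

section \<open>Choosing pairs of consecutive entries as edges\<close>

text \<open>
  The first \<open>2 * a\<close> entries of the tuples in \<open>T\<close> are regarded as \<open>a\<close> pairs. Given
  a prefix \<open>xs\<close> of \<open>j\<close> pairs, the pairs eligible for position \<open>j\<close> are those that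
  leave at least the proportion \<open>c / 2 ^ Suc j\<close> of all completions. The set of eligible pairs is
  queried only if it is large, which is the case when \<open>xs\<close> itself has many completions; the
  other prefixes never occur.
\<close>
definition queries :: "'a set \<Rightarrow> nat \<Rightarrow> nat \<Rightarrow> real \<Rightarrow> 'a list set \<Rightarrow> 'a edges set" where
  "queries V a b c T = {Q. \<exists>j<a. \<exists>xs\<in>tuples V (2 * j).
     Q = {{x, y} | x y. real (card {zs. xs @ x # y # zs \<in> T})
            \<ge> c / 2 ^ Suc j * real (card V) ^ (2 * (a - Suc j) + b)} \<and>
     real (card Q) \<ge> c / 2 ^ Suc a * (real (card V))\<^sup>2}"

lemma query_pair:
  assumes "T \<subseteq> tuples V (2 * a + b)" "\<And>ts. ts \<in> T \<Longrightarrow> distinct (take (2 * a) ts)"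
    and "length xs = 2 * j" "j < a" "{zs. xs @ x # y # zs \<in> T} \<noteq> {}"
  shows "x \<in> V" "y \<in> V" "x \<noteq> y"
proof -
  from assms(5) obtain zs where z: "xs @ x # y # zs \<in> T" by auto
  then have "xs @ x # y # zs \<in> tuples V (2 * a + b)" using assms(1) by blast
  then show "x \<in> V" "y \<in> V" by (auto simp: tuples_def)
  have e: "2 * a = length xs + Suc (Suc (2 * a - length xs - 2))" using assms(3,4) by simp
  have "distinct (take (2 * a) (xs @ x # y # zs))" using assms(2) z by blast
  then show "x \<noteq> y" by (subst (asm) e) simp
qed

lemma queries_edges:
  assumes V: "finite V" "V \<noteq> {}" and c: "c > 0"
    and T: "T \<subseteq> tuples V (2 * a + b)" "\<And>ts. ts \<in> T \<Longrightarrow> distinct (take (2 * a) ts)"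
    and Q: "Q \<in> queries V a b c T"
  shows "Q \<subseteq> {e. e \<subseteq> V \<and> card e = 2}"
    and "real (card Q) \<ge> c / 2 ^ Suc a * (real (card V))\<^sup>2"
proof -
  obtain j xs where j: "j < a" "xs \<in> tuples V (2 * j)"
    and Q_eq: "Q = {{x, y} | x y. real (card {zs. xs @ x # y # zs \<in> T})
            \<ge> c / 2 ^ Suc j * real (card V) ^ (2 * (a - Suc j) + b)}"
    and card: "real (card Q) \<ge> c / 2 ^ Suc a * (real (card V))\<^sup>2"
    using Q unfolding queries_def by blast
  show "real (card Q) \<ge> c / 2 ^ Suc a * (real (card V))\<^sup>2" by fact
  have pos: "c / 2 ^ Suc j * real (card V) ^ (2 * (a - Suc j) + b) > 0"
    using c V by (simp add: card_gt_0_iff)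
  show "Q \<subseteq> {e. e \<subseteq> V \<and> card e = 2}"
  proof
    fix e assume "e \<in> Q"
    then obtain x y where e: "e = {x, y}" and "real (card {zs. xs @ x # y # zs \<in> T})
            \<ge> c / 2 ^ Suc j * real (card V) ^ (2 * (a - Suc j) + b)"
      unfolding Q_eq by blast
    then have "real (card {zs. xs @ x # y # zs \<in> T}) > 0" using pos by linarith
    then have "{zs. xs @ x # y # zs \<in> T} \<noteq> {}" by (metis card.empty of_nat_0 less_irrefl)
    from query_pair[OF T _ j(1) this] j(2) show "e \<in> {e. e \<subseteq> V \<and> card e = 2}"
      by (auto simp: e tuples_def)
  qed
qed

text \<open>There is at most one query for each prefix consisting of fewer than \<open>a\<close> pairs.\<close>
lemma card_queries:
  assumes "finite V" "V \<noteq> {}"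
  shows "finite (queries V a b c T)" "card (queries V a b c T) \<le> a * card V ^ (2 * a)"
proof -
  let ?I = "SIGMA j:{..<a}. tuples V (2 * j)"
  define f where "f = (\<lambda>(j, xs). {{x, y} | x y. real (card {zs. xs @ x # y # zs \<in> T})
            \<ge> c / 2 ^ Suc j * real (card V) ^ (2 * (a - Suc j) + b)})"
  have fin: "finite ?I" using assms by auto
  have sub: "queries V a b c T \<subseteq> f ` ?I"
    unfolding queries_def f_def by force
  show "finite (queries V a b c T)" using finite_subset[OF sub] fin by blast
  have "card (queries V a b c T) \<le> card (f ` ?I)" using sub fin by (intro card_mono) auto
  also have "\<dots> \<le> card ?I" by (rule card_image_le[OF fin])
  also have "\<dots> = (\<Sum>j<a. card V ^ (2 * j))" using assms by (subst card_SigmaI) (auto simp: card_tuples)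
  also have "\<dots> \<le> (\<Sum>j<a. card V ^ (2 * a))"
    using assms by (intro sum_mono power_increasing) (auto simp: Suc_le_eq card_gt_0_iff)
  finally show "card (queries V a b c T) \<le> a * card V ^ (2 * a)" by simp
qed

text \<open>
  If \<open>R\<close> meets all queries, pairs can be chosen from left to right. By averaging, each choice
  loses only a factor of \<open>2\<close> in the density of completions.
\<close>
lemma paired_prefix_exists:
  assumes V: "finite V" "V \<noteq> {}" and c: "c > 0"
    and T: "T \<subseteq> tuples V (2 * a + b)" "\<And>ts. ts \<in> T \<Longrightarrow> distinct (take (2 * a) ts)"
    and dense: "real (card T) \<ge> c * real (card V) ^ (2 * a + b)"
    and hit: "\<And>Q. Q \<in> queries V a b c T \<Longrightarrow> R \<inter> Q \<noteq> {}"
  shows "\<exists>xs\<in>tuples V (2 * a). (\<forall>j<a. {xs ! (2 * j), xs ! (2 * j + 1)} \<in> R) \<and>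
           real (card {zs. xs @ zs \<in> T}) \<ge> c / 2 ^ a * real (card V) ^ b"
proof -
  define n where "n = real (card V)"
  have n: "n > 0" using V by (simp add: n_def card_gt_0_iff)
  have "\<exists>xs\<in>tuples V (2 * j). (\<forall>i<j. {xs ! (2 * i), xs ! (2 * i + 1)} \<in> R) \<and>
           real (card {zs. xs @ zs \<in> T}) \<ge> c / 2 ^ j * n ^ (2 * (a - j) + b)" if "j \<le> a" for j
    using that
  proof (induction j)
    case 0
    show ?case using dense by (intro bexI[of _ "[]"]) (auto simp: n_def tuples_def)
  next
    case (Suc j)
    then have j: "j < a" by simp
    obtain xs where xs: "xs \<in> tuples V (2 * j)" "\<forall>i<j. {xs ! (2 * i), xs ! (2 * i + 1)} \<in> R"
      and card: "real (card {zs. xs @ zs \<in> T}) \<ge> c / 2 ^ j * n ^ (2 * (a - j) + b)"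
      using Suc by auto
    define B where "B = 2 * (a - Suc j) + b"
    have AB: "2 * (a - j) + b = 2 + B" using j by (simp add: B_def)
    let ?T = "{zs. xs @ zs \<in> T}"
    have "2 * a + b = 2 * j + (2 + B)" using j by (simp add: B_def)
    then have "T \<subseteq> tuples V (2 * j + (2 + B))" using T(1) by (simp only:)
    from extensions_subset[OF this xs(1)] have sub: "?T \<subseteq> tuples V (2 + B)" .
    define good where "good x y \<longleftrightarrow> real (card {zs. xs @ x # y # zs \<in> T}) \<ge> c / 2 ^ Suc j * n ^ B" for x y
    have pos: "c / 2 ^ Suc j * n ^ B > 0" using c n by simp
    have good: "x \<in> V \<and> y \<in> V \<and> x \<noteq> y" if "good x y" for x y
    proof -
      have "real (card {zs. xs @ x # y # zs \<in> T}) > 0" using that pos unfolding good_def by linarith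
      then have "{zs. xs @ x # y # zs \<in> T} \<noteq> {}" by (metis card.empty of_nat_0 less_irrefl)
      from query_pair[OF T _ j this] xs(1) show ?thesis by (auto simp: tuples_def)
    qed
    define P where "P = {ps \<in> tuples V 2. real (card {zs. ps @ zs \<in> ?T}) \<ge> c / 2 ^ j / 2 * n ^ B}"
    have P: "real (card P) \<ge> c / 2 ^ j / 2 * n\<^sup>2"
      using card_popular_prefixes[OF V sub, of "c / 2 ^ j"] card unfolding AB P_def n_def by simp
    define Q where "Q = {{x, y} | x y. good x y}"
    have QV: "Q \<subseteq> Pow V" unfolding Q_def using good by blast
    then have finQ: "finite Q" using V(1) finite_subset by blast
    have "P \<subseteq> (\<Union>e\<in>Q. {ps. set ps = e \<and> length ps = 2})"
    proof
      fix ps assume ps: "ps \<in> P"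
      then have "length ps = Suc (Suc 0)" by (simp add: P_def tuples_def)
      then obtain x y where xy: "ps = [x, y]" by (auto simp: length_Suc_conv)
      then have "good x y" using ps unfolding P_def good_def by simp
      then have "{x, y} \<in> Q" unfolding Q_def by blast
      then show "ps \<in> (\<Union>e\<in>Q. {ps. set ps = e \<and> length ps = 2})" using xy by auto
    qed
    moreover have two: "finite {ps. set ps = e \<and> length ps = 2} \<and> card {ps. set ps = e \<and> length ps = 2} \<le> 2"
      if eQ: "e \<in> Q" for e
    proof -
      obtain x y where e: "e = {x, y}" and "good x y" using eQ unfolding Q_def by blast
      have sub2: "{ps. set ps = e \<and> length ps = 2} \<subseteq> {[x, y], [y, x]}"
      proof
        fix ps assume a: "ps \<in> {ps. set ps = e \<and> length ps = 2}"
        then have "length ps = Suc (Suc 0)" by simp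
        then obtain u w where ps: "ps = [u, w]" by (auto simp: length_Suc_conv)
        then have "{u, w} = {x, y}" using a e by simp
        then have "u = x \<and> w = y \<or> u = y \<and> w = x" by (simp only: doubleton_eq_iff)
        then show "ps \<in> {[x, y], [y, x]}" using ps by blast
      qed
      have "card {[x, y], [y, x]} \<le> 2"
        using card_length[of "[[x, y], [y, x]]"] by simp
      moreover have "card {ps. set ps = e \<and> length ps = 2} \<le> card {[x, y], [y, x]}"
        by (rule card_mono[OF _ sub2]) simp
      moreover have "finite {ps. set ps = e \<and> length ps = 2}"
        by (rule finite_subset[OF sub2]) simp
      ultimately show ?thesis by linarith
    qed
    ultimately have "card P \<le> card (\<Union>e\<in>Q. {ps. set ps = e \<and> length ps = 2})"
      using finQ by (intro card_mono) auto
    also have "\<dots> \<le> (\<Sum>e\<in>Q. card {ps. set ps = e \<and> length ps = 2})"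
      by (rule card_UN_le[OF finQ])
    also have "\<dots> \<le> (\<Sum>e\<in>Q. 2)" using two by (intro sum_mono) auto
    finally have "card P \<le> 2 * card Q" by simp
    then have "real (card P) \<le> 2 * real (card Q)" by linarith
    with P have "c / 2 ^ j / 2 * n\<^sup>2 \<le> 2 * real (card Q)" by (rule order_trans)
    then have "c * n\<^sup>2 / 2 ^ Suc (Suc j) \<le> real (card Q)" by (simp add: field_simps)
    moreover have "c * n\<^sup>2 / 2 ^ Suc a \<le> c * n\<^sup>2 / 2 ^ Suc (Suc j)"
      using c n j by (intro divide_left_mono power_increasing) auto
    ultimately have "real (card Q) \<ge> c / 2 ^ Suc a * n\<^sup>2" by simp
    then have "Q \<in> queries V a b c T"
      unfolding queries_def using j xs(1) unfolding Q_def good_def B_def n_def by blast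
    then obtain x y where xy: "{x, y} \<in> R" "good x y"
      using hit unfolding Q_def by blast
    show ?case
    proof (intro bexI[of _ "xs @ [x, y]"] conjI allI impI)
      have l: "length xs = 2 * j" using xs(1) by (simp add: tuples_def)
      show "xs @ [x, y] \<in> tuples V (2 * Suc j)" using xs(1) good[OF xy(2)] by (simp add: tuples_def)
      fix i assume "i < Suc j"
      then consider "i < j" | "i = j" by linarith
      then show "{(xs @ [x, y]) ! (2 * i), (xs @ [x, y]) ! (2 * i + 1)} \<in> R"
        by cases (use xs(2) xy(1) l in \<open>auto simp: nth_append\<close>)
    next
      show "c / 2 ^ Suc j * n ^ (2 * (a - Suc j) + b) \<le> real (card {zs. (xs @ [x, y]) @ zs \<in> T})"
        using xy(2) unfolding good_def B_def by simp
    qed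
  qed
  from this[of a] show ?thesis by (simp add: n_def)
qed

text \<open>
  A certificate may be given by families of tuples instead of sets of edges: a family contributes
  polynomially many queries, and a polynomial in \<open>n\<close> is bounded by an exponential function.
\<close>
lemma certifiedI:
  assumes n: "1 \<le> n" and A: "1 \<le> A" and c: "0 < c0" and D: "0 < D"
    and \<T>: "finite \<T>" "real (card \<T>) \<le> D ^ n"
    and T: "\<And>a c T. (a, c, T) \<in> \<T> \<Longrightarrow> a \<le> A \<and> c0 \<le> c \<and> T \<subseteq> tuples {1..n} (2 * a + b) \<and> (\<forall>ts\<in>T. distinct (take (2 * a) ts))"
    and suff: "\<And>R. R \<subseteq> all_edges n \<Longrightarrow> (\<And>a c T Q. (a, c, T) \<in> \<T> \<Longrightarrow> Q \<in> queries {1..n} a b c T \<Longrightarrow> R \<inter> Q \<noteq> {}) \<Longrightarrow> G \<union> R \<in> P"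
  shows "certified (c0 / 2 ^ Suc A) (D * (real A * 4 ^ A)) n G P"
proof -
  let ?V = "{1..n}"
  define \<Q> where "\<Q> = (\<Union>(a, c, T)\<in>\<T>. queries ?V a b c T)"
  have V: "finite ?V" "?V \<noteq> {}" using n by auto
  have cQ: "finite (queries ?V a b c T)" "card (queries ?V a b c T) \<le> A * n ^ (2 * A)" if "(a, c, T) \<in> \<T>" for a c T
  proof -
    have "a * n ^ (2 * a) \<le> A * n ^ (2 * A)" using T[OF that] n by (intro mult_le_mono power_increasing) auto
    then show "finite (queries ?V a b c T)" "card (queries ?V a b c T) \<le> A * n ^ (2 * A)"
      using card_queries[OF V, of a b c T] by simp_all
  qed
  show ?thesis unfolding certified_def
  proof (intro exI[of _ \<Q>] conjI ballI allI impI)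
    show "finite \<Q>" unfolding \<Q>_def using \<T>(1) cQ(1) by auto
    have "card \<Q> \<le> (\<Sum>x\<in>\<T>. card (case x of (a, c, T) \<Rightarrow> queries ?V a b c T))"
      unfolding \<Q>_def by (rule card_UN_le[OF \<T>(1)])
    also have "\<dots> \<le> (\<Sum>x\<in>\<T>. A * n ^ (2 * A))" using cQ(2) by (intro sum_mono) auto
    also have "\<dots> = card \<T> * (A * n ^ (2 * A))" by simp
    finally have "real (card \<Q>) \<le> real (card \<T>) * (real A * real n ^ (2 * A))"
      by (metis of_nat_le_iff of_nat_mult of_nat_power)
    also have "\<dots> \<le> D ^ n * (real A ^ n * (4 ^ A) ^ n)"
    proof (intro mult_mono \<T>(2))
      show "real A \<le> real A ^ n" using A n by (intro self_le_power) auto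
      have "n < 2 ^ n" by (rule less_exp)
      then have "real n \<le> 2 ^ n" by (metis less_imp_le of_nat_le_iff of_nat_numeral of_nat_power)
      then have "real n ^ (2 * A) \<le> (2 ^ n) ^ (2 * A)" by (intro power_mono) auto
      also have "\<dots> = (((2::real) ^ 2) ^ A) ^ n"
        by (simp only: power_mult[symmetric]) (simp only: mult_ac)
      also have "(2::real) ^ 2 = 4" by simp
      finally show "real n ^ (2 * A) \<le> (4 ^ A) ^ n" .
    qed (use D in auto)
    also have "\<dots> = (D * (real A * 4 ^ A)) ^ n" by (simp add: power_mult_distrib)
    finally show "real (card \<Q>) \<le> (D * (real A * 4 ^ A)) ^ n" .
    fix Q assume "Q \<in> \<Q>"
    then obtain a c T where aT: "(a, c, T) \<in> \<T>" "Q \<in> queries ?V a b c T" unfolding \<Q>_def by blast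
    have c': "0 < c" "c0 \<le> c" using T[OF aT(1)] c by auto
    note q = queries_edges[OF V c'(1) _ _ aT(2)]
    show "Q \<subseteq> all_edges n" using q(1) T[OF aT(1)] unfolding all_edges_def by blast
    have "c0 / 2 ^ Suc A * (real n)\<^sup>2 \<le> c / 2 ^ Suc a * (real n)\<^sup>2"
      using T[OF aT(1)] c by (intro mult_right_mono frac_le power_increasing) auto
    also have "\<dots> \<le> real (card Q)" using q(2) T[OF aT(1)] by simp
    finally show "c0 / 2 ^ Suc A * (real n)\<^sup>2 \<le> real (card Q)" .
  next
    fix R assume "R \<subseteq> all_edges n" "\<forall>Q\<in>\<Q>. R \<inter> Q \<noteq> {}"
    then show "G \<union> R \<in> P" by (intro suff) (auto simp: \<Q>_def)
  qed
qed

section \<open>Powers of paths and of cycles\<close>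
fun power_path :: "nat \<Rightarrow> 'a edges \<Rightarrow> 'a list \<Rightarrow> bool" where
  "power_path m E [] \<longleftrightarrow> True"
| "power_path m E (x # xs) \<longleftrightarrow> (\<forall>y\<in>set (take m xs). {x, y} \<in> E) \<and> power_path m E xs"

lemma power_path_iff_nth:
  "power_path m E xs \<longleftrightarrow>
     (\<forall>i j. i < j \<longrightarrow> j < length xs \<longrightarrow> j \<le> i + m \<longrightarrow> {xs ! i, xs ! j} \<in> E)"
proof (induction xs)
  case (Cons x xs)
  have "(\<forall>y\<in>set (take m xs). {x, y} \<in> E) \<longleftrightarrow> (\<forall>j<length xs. j < m \<longrightarrow> {x, xs ! j} \<in> E)"
    by (auto simp: set_conv_nth)
  then show ?case
    unfolding power_path.simps Cons.IH
    by (auto simp: nth_Cons split: nat.splits)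
qed simp

lemma power_path_prefix: "power_path m E (xs @ ys) \<Longrightarrow> power_path m E xs"
  by (induction xs) auto

lemma power_path_suffix: "power_path m E (xs @ ys) \<Longrightarrow> power_path m E ys"
  by (induction xs) auto

text \<open>An overlap of \<open>m\<close> vertices separates the two ends far enough that nothing is required between them.\<close>
lemma power_path_glue:
  assumes "power_path m E (xs @ ys)" "power_path m E (ys @ zs)" "m \<le> length ys"
  shows "power_path m E (xs @ ys @ zs)"
  using assms by (induction xs) auto

lemma power_path_insert:
  assumes "power_path m E (xs @ ys)"
    and "\<And>u. u \<in> set (drop (length xs - m) xs) \<Longrightarrow> {v, u} \<in> E"
    and "\<And>u. u \<in> set (take m ys) \<Longrightarrow> {v, u} \<in> E"
  shows "power_path m E (xs @ v # ys)"
  using assms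
proof (induction xs)
  case (Cons x xs)
  have "power_path m E (xs @ v # ys)"
  proof (rule Cons.IH)
    show "power_path m E (xs @ ys)" using Cons.prems(1) by simp
    fix u assume u: "u \<in> set (drop (length xs - m) xs)"
    have "set (drop (length xs - m) xs) \<subseteq> set (drop (length (x # xs) - m) (x # xs))"
      by (cases "length xs < m") (auto simp: Suc_diff_le)
    then show "{v, u} \<in> E" using u Cons.prems(2) by blast
  qed (use Cons.prems in auto)
  moreover have "{x, y} \<in> E" if y: "y \<in> set (take m (xs @ v # ys))" for y
  proof (cases "length xs < m")
    case False
    then show ?thesis using y Cons.prems(1) by simp
  next
    case True
    then have "{v, x} \<in> E" using Cons.prems(2)[of x] by (simp add: Suc_leI)
    moreover have "y \<in> set xs \<or> y = v \<or> y \<in> set (take (m - Suc (length xs)) ys)"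
      using y True by (auto simp: take_Cons' split: if_splits)
    moreover have "set (take (m - Suc (length xs)) ys) \<subseteq> set (take (m - length xs) ys)"
      by (rule set_take_subset_set_take) simp
    moreover have "\<forall>y\<in>set xs \<union> set (take (m - length xs) ys). {x, y} \<in> E"
      using Cons.prems(1) True by auto
    ultimately show ?thesis by (auto simp: insert_commute)
  qed
  ultimately show ?case by simp
qed simp

lemma power_path_cyclic:
  assumes "power_path m E (vs @ take m vs)" "m < length vs" "i < length vs" "0 < d" "d \<le> m"
  shows "{vs ! i, vs ! ((i + d) mod length vs)} \<in> E"
proof (cases "i + d < length vs")
  case True
  then have "{(vs @ take m vs) ! i, (vs @ take m vs) ! (i + d)} \<in> E"
    using assms unfolding power_path_iff_nth by auto
  then show ?thesis using True assms by (simp add: nth_append)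
next
  case False
  define j where "j = i + d - length vs"
  have j: "i + d = length vs + j" "j < m" using False assms by (auto simp: j_def)
  have "i < i + d" "i + d < length (vs @ take m vs)" "i + d \<le> i + m" using assms j by auto
  then have "{(vs @ take m vs) ! i, (vs @ take m vs) ! (i + d)} \<in> E"
    using assms(1) unfolding power_path_iff_nth by blast
  moreover have "(i + d) mod length vs = j" using j assms(2) by simp
  ultimately show ?thesis using assms j by (simp add: nth_append)
qed

text \<open>
  Each step along the cycle changes the index by \<open>1\<close> or \<open>- 1\<close> modulo \<open>n\<close>. Hence
  the distance of two vertices on the cycle bounds the cyclic difference of their indices.
\<close>
lemma path_in_cycle_short:
  assumes n: "n = length vs" and "n > 0"
    and H: "H = {{vs ! i, vs ! ((i + 1) mod n)} | i. i < n}" and "distinct vs"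
    and ws: "successively (\<lambda>x y. {x, y} \<in> H) ws" "ws ! 0 = vs ! i" "i < n"
    and "t < length ws"
  shows "\<exists>d::int. \<bar>d\<bar> \<le> int t \<and> ws ! t = vs ! nat ((int i + d) mod int n)"
  using \<open>t < length ws\<close>
proof (induction t)
  case 0
  then show ?case using ws by (intro exI[of _ 0]) auto
next
  case (Suc t)
  then obtain d where d: "\<bar>d\<bar> \<le> int t" "ws ! t = vs ! nat ((int i + d) mod int n)" by auto
  have "{ws ! t, ws ! Suc t} \<in> H" using successively_nth[OF ws(1)] Suc.prems by blast
  then obtain j where j: "j < n" "{ws ! t, ws ! Suc t} = {vs ! j, vs ! ((j + 1) mod n)}"
    unfolding H by blast
  define p where "p = nat ((int i + d) mod int n)"
  have p: "int p = (int i + d) mod int n" "p < n" using \<open>n > 0\<close> by (auto simp: p_def nat_less_iff)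
  have inj: "a = b" if "vs ! a = vs ! b" "a < n" "b < n" for a b
    using that \<open>distinct vs\<close> n nth_eq_iff_index_eq by blast
  from j(2) d(2) consider "vs ! p = vs ! j" "ws ! Suc t = vs ! ((j + 1) mod n)"
    | "vs ! p = vs ! ((j + 1) mod n)" "ws ! Suc t = vs ! j"
    by (auto simp: doubleton_eq_iff p_def)
  then show ?case
  proof cases
    case 1
    then have "j = p" using inj p(2) j(1) by metis
    have "int ((j + 1) mod n) = (int i + (d + 1)) mod int n"
      unfolding \<open>j = p\<close> by (simp add: zmod_int p(1) mod_simps ac_simps)
    then show ?thesis using 1(2) d(1)
      by (intro exI[of _ "d + 1"]) (auto simp flip: \<open>int ((j + 1) mod n) = _\<close>)
  next
    case 2
    then have "(j + 1) mod n = p" using inj p(2) \<open>n > 0\<close> by (metis mod_less_divisor)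
    then have "int p = (int j + 1) mod int n" by (metis of_nat_1 of_nat_add zmod_int)
    then have "(int j + 1) mod int n = (int i + d) mod int n" using p(1) by simp
    then have "(int j + 1 - 1) mod int n = (int i + d - 1) mod int n" by (metis mod_diff_left_eq)
    then have "int j = (int i + (d - 1)) mod int n" using j(1) by (simp add: add_diff_eq)
    then have "nat ((int i + (d - 1)) mod int n) = j" by (metis nat_int)
    then show ?thesis using 2(2) d(1) by (intro exI[of _ "d - 1"]) auto
  qed
qed

text \<open>
  Repeating the first \<open>m\<close> vertices at the end expresses cyclicity by a power of a path.
\<close>
lemma power_hamI:
  assumes "E \<in> graphs n" "0 < m" "m < n" "3 \<le> n"
    and vs: "distinct vs" "set vs = {1..n}" "power_path m E (vs @ take m vs)"
  shows "E \<in> power_ham m n"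
proof -
  define H where "H = {{vs ! i, vs ! ((i + 1) mod n)} | i. i < n}"
  have n: "n = length vs" using vs(1,2) distinct_card by fastforce
  have "hamiltonian_cycle n H" unfolding hamiltonian_cycle_def H_def using assms by blast
  moreover have "graph_power n H m \<subseteq> E"
  proof
    fix e assume "e \<in> graph_power n H m"
    then obtain u v where e: "e = {u, v}" "u \<in> {1..n}" "v \<in> {1..n}" "u \<noteq> v" "graph_dist H u v \<le> enat m"
      unfolding graph_power_def by blast
    then have "graph_dist H u v < enat (Suc m)" by (metis enat_ord_simps(2) le_less_trans lessI)
    then obtain ws where ws: "is_path H u ws v" "length ws - 1 < Suc m"
      unfolding graph_dist_def Inf_less_iff by auto
    from ws(1) have ws': "ws \<noteq> []" "hd ws = u" "last ws = v" "successively (\<lambda>x y. {x, y} \<in> H) ws"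
      unfolding is_path_def by auto
    obtain i where i: "i < n" "vs ! i = u" using e(2) vs(2) n by (metis in_set_conv_nth)
    obtain d :: int where d: "\<bar>d\<bar> \<le> int (length ws - 1)"
      "ws ! (length ws - 1) = vs ! nat ((int i + d) mod int n)"
      using path_in_cycle_short[OF n _ H_def vs(1) ws'(4), of i "length ws - 1"] ws' i assms(3)
      by (auto simp: hd_conv_nth)
    define j where "j = nat ((int i + d) mod int n)"
    have j: "int j = (int i + d) mod int n" "j < n" using assms(3) by (auto simp: j_def nat_less_iff)
    have v: "vs ! j = v" using d(2) ws' by (simp add: last_conv_nth j_def)
    have dm: "\<bar>d\<bar> \<le> int m" using d(1) ws(2) by linarith
    have "d \<noteq> 0"
    proof
      assume "d = 0"
      then have "j = i" using j i by simp
      then show False using v i e(4) by simp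
    qed
    then consider "d > 0" | "d < 0" by linarith
    then show "e \<in> E"
    proof cases
      case 1
      have "int ((i + nat d) mod n) = int j" using j(1) 1 by (simp add: zmod_int)
      then have "(i + nat d) mod n = j" by (rule of_nat_eq_iff[THEN iffD1])
      then show ?thesis
        using power_path_cyclic[OF vs(3), of i "nat d"] i v n e(1) 1 dm assms(3) by auto
    next
      case 2
      have "int ((j + nat (- d)) mod n) = ((int i + d) mod int n - d) mod int n"
        using j(1) 2 by (simp add: zmod_int)
      also have "\<dots> = int i mod int n" by (simp add: mod_diff_left_eq)
      also have "\<dots> = int i" using i by simp
      finally have "(j + nat (- d)) mod n = i" by (rule of_nat_eq_iff[THEN iffD1])
      then have "{vs ! j, vs ! i} \<in> E"
        using power_path_cyclic[OF vs(3), of j "nat (- d)"] j v n 2 dm assms(3) by auto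
      then show ?thesis using i v e(1) by (simp add: insert_commute)
    qed
  qed
  ultimately show ?thesis using assms(1) unfolding power_ham_def by blast
qed

text \<open>
  If all \<open>2 * m\<close> vertices of a block are adjacent to \<open>v\<close>, then \<open>v\<close> can be inserted in
  its middle: \<open>v\<close> then sees \<open>m\<close> vertices of the block on either side, and inserting a vertex
  only increases the distances of the other vertices on the path.
\<close>
definition absorbs :: "nat \<Rightarrow> 'a edges \<Rightarrow> 'a list \<Rightarrow> 'a \<Rightarrow> bool" where
  "absorbs m G b v \<longleftrightarrow> length b = 2 * m \<and> (\<forall>x\<in>set b. {v, x} \<in> G)"

lemma power_path_absorb:
  assumes "power_path m E (xs @ b @ ys)" "absorbs m G b v" "G \<subseteq> E"
  shows "power_path m E (xs @ (take m b @ v # drop m b) @ ys)"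
proof -
  have b: "length b = 2 * m" "\<And>x. x \<in> set b \<Longrightarrow> {v, x} \<in> E"
    using assms(2,3) by (auto simp: absorbs_def)
  have "power_path m E ((xs @ take m b) @ v # (drop m b @ ys))"
  proof (rule power_path_insert)
    show "power_path m E ((xs @ take m b) @ drop m b @ ys)"
      using assms(1) by (metis append.assoc append_take_drop_id)
  qed (use b in \<open>auto dest: in_set_takeD in_set_dropD\<close>)
  then show ?thesis by simp
qed

text \<open>
  A block is used up by absorbing a vertex, so the vertices of \<open>L\<close> can be absorbed one by one if
  each of them has at least \<open>card L\<close> blocks at its disposal.
\<close>
lemma absorb_all:
  assumes "finite L" "G \<subseteq> E"
    and "distinct (concat bs)" "L \<inter> set (concat bs) = {}" "power_path m E (xs @ concat bs @ ys)"
    and "\<And>v. v \<in> L \<Longrightarrow> card L \<le> length (filter (\<lambda>b. absorbs m G b v) bs)"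
  shows "\<exists>zs. distinct zs \<and> set zs = set (concat bs) \<union> L \<and> power_path m E (xs @ zs @ ys)"
  using assms(1,3-)
proof (induction L arbitrary: bs rule: finite_induct)
  case empty
  then show ?case by blast
next
  case (insert v L)
  have "Suc (card L) \<le> length (filter (\<lambda>b. absorbs m G b v) bs)"
    using insert.prems(4)[of v] insert.hyps by simp
  then have "0 < length (filter (\<lambda>b. absorbs m G b v) bs)" by linarith
  then obtain b where "b \<in> set bs" "absorbs m G b v"
    by (metis filter_False length_0_conv less_irrefl)
  then obtain bs1 bs2 where bs: "bs = bs1 @ b # bs2" by (metis split_list)
  define b' where "b' = take m b @ v # drop m b"
  define bs' where "bs' = bs1 @ b' # bs2"
  have set_b': "set b' = insert v (set b)"
  proof -
    have "set b = set (take m b) \<union> set (drop m b)" by (metis append_take_drop_id set_append)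
    then show ?thesis by (auto simp: b'_def)
  qed
  have set': "set (concat bs') = insert v (set (concat bs))"
    by (auto simp: bs'_def bs set_b')
  have "distinct b'" using insert.prems(1,2)
  proof -
    have "distinct (take m b @ drop m b)" "v \<notin> set b" using insert.prems(1,2) by (auto simp: bs)
    then show ?thesis unfolding b'_def distinct_append by (auto dest: in_set_takeD in_set_dropD)
  qed
  then have "distinct (concat bs')"
    using insert.prems(1,2) set_b' by (auto simp: bs bs'_def)
  moreover have "L \<inter> set (concat bs') = {}" using insert.prems(2) insert.hyps set' by auto
  moreover have "power_path m E (xs @ concat bs' @ ys)"
  proof -
    have "power_path m E ((xs @ concat bs1) @ b @ (concat bs2 @ ys))"
      using insert.prems(3) by (simp add: bs)
    from power_path_absorb[OF this \<open>absorbs m G b v\<close> assms(2)] show ?thesis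
      by (simp add: bs'_def b'_def)
  qed
  moreover have "card L \<le> length (filter (\<lambda>b. absorbs m G b u) bs')" if "u \<in> L" for u
  proof -
    have "Suc (card L) \<le> length (filter (\<lambda>b. absorbs m G b u) bs)"
      using insert.prems(4)[of u] that insert.hyps by simp
    also have "\<dots> \<le> Suc (length (filter (\<lambda>b. absorbs m G b u) bs'))"
      by (simp add: bs bs'_def)
    finally show ?thesis by simp
  qed
  ultimately obtain zs where "distinct zs" "set zs = set (concat bs') \<union> L" "power_path m E (xs @ zs @ ys)"
    using insert.IH[of bs'] by blast
  then show ?case using set' by auto
qed

section \<open>Hamiltonian cycles\<close>
definition neighbours :: "'a edges \<Rightarrow> 'a \<Rightarrow> 'a set" where
  "neighbours G v = {x. {v, x} \<in> G}"

lemma neighbours_subset: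
  assumes "G \<in> graphs n"
  shows "neighbours G v \<subseteq> {1..n} - {v}"
  using assms by (auto simp: graphs_def all_edges_def neighbours_def)

lemma card_neighbours_ge:
  assumes G: "G \<in> graphs n" and deg: "real (min_degree n G) \<ge> d" and v: "v \<in> {1..n}"
  shows "real (card (neighbours G v)) \<ge> d"
proof -
  have "{e \<in> G. v \<in> e} \<subseteq> (\<lambda>x. {v, x}) ` neighbours G v"
  proof
    fix e assume e: "e \<in> {e \<in> G. v \<in> e}"
    then have "card e = 2" using G by (auto simp: graphs_def all_edges_def)
    then obtain a b where ab: "e = {a, b}" by (auto simp: card_2_iff)
    then have "v = a \<or> v = b" using e by simp
    then obtain x where "e = {v, x}" using ab by (metis insert_commute)
    with e show "e \<in> (\<lambda>x. {v, x}) ` neighbours G v" by (auto simp: neighbours_def)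
  qed
  moreover have fin: "finite (neighbours G v)"
    using neighbours_subset[OF G] by (rule finite_subset) simp
  ultimately have "degree G v \<le> card (neighbours G v)"
    unfolding degree_def by (meson card_image_le card_mono finite_imageI order_trans)
  moreover have "min_degree n G \<le> degree G v"
    unfolding min_degree_def using v by (intro Min_le) auto
  ultimately show ?thesis using deg by linarith
qed

definition joined :: "nat \<Rightarrow> 'a set \<Rightarrow> 'a edges \<Rightarrow> bool" where
  "joined s V R \<longleftrightarrow> (\<forall>X Y. X \<subseteq> V \<longrightarrow> Y \<subseteq> V \<longrightarrow> X \<inter> Y = {} \<longrightarrow> s \<le> card X \<longrightarrow> s \<le> card Y \<longrightarrow>
     (\<exists>x\<in>X. \<exists>y\<in>Y. {x, y} \<in> R))"

text \<open>
  If the chords at the two ends of a path do not overlap, an edge between the vertex before the end of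
  the first chord and the vertex after the end of the second one closes the path to a cycle.
\<close>
lemma closing_parallel_chords:
  assumes A: "\<And>x y. A x y \<Longrightarrow> A y x" and ne: "p \<noteq> []" "q \<noteq> []" "r \<noteq> []"
    and path: "successively A (p @ q @ r)"
    and "A (hd p) (hd q)" "A (last q) (last r)" "A (last p) (hd r)"
  shows "successively A ((rev p @ q @ rev r) @ [hd (rev p @ q @ rev r)])"
proof -
  have "successively (\<lambda>x y. A y x) p" "successively (\<lambda>x y. A y x) r" "successively A q"
    using path A by (auto simp: successively_append_iff intro: successively_mono)
  then show ?thesis using assms
    by (auto simp: successively_append_iff last_rev hd_rev hd_append last_append)
qed

text \<open>
  If the chords at the two ends of a path cross, the missing edge joins the vertices that precede the
  inner ends of the two chords.
\<close>
lemma closing_crossing_chords: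
  assumes A: "\<And>x y. A x y \<Longrightarrow> A y x" and ne: "p \<noteq> []" "q \<noteq> []" "r \<noteq> []"
    and path: "successively A (p @ q @ r)"
    and "A (hd q) (last r)" "A (hd r) (hd p)" "A (last p) (last q)"
  shows "successively A ((rev q @ rev r @ p) @ [hd (rev q @ rev r @ p)])"
proof -
  have "successively (\<lambda>x y. A y x) q" "successively (\<lambda>x y. A y x) r" "successively A p"
    using path A by (auto simp: successively_append_iff intro: successively_mono)
  then show ?thesis using assms
    by (auto simp: successively_append_iff last_rev hd_rev hd_append last_append)
qed

lemma median_threshold:
  fixes I :: "nat set"
  assumes "finite I" "s + t \<le> card I"
  shows "\<exists>\<theta>. s \<le> card (I \<inter> {..<\<theta>}) \<and> t \<le> card (I \<inter> {\<theta>..})"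
proof -
  have "I \<inter> {..<Suc (Max I)} = I" using assms(1) by (auto simp: less_Suc_eq_le)
  then have ex: "\<exists>\<theta>. s \<le> card (I \<inter> {..<\<theta>})" using assms(2) by (metis add_leE)
  define \<theta> where "\<theta> = (LEAST \<theta>. s \<le> card (I \<inter> {..<\<theta>}))"
  have \<theta>: "s \<le> card (I \<inter> {..<\<theta>})" unfolding \<theta>_def using ex by (rule LeastI_ex)
  have "card (I \<inter> {..<\<theta>}) \<le> s"
  proof (cases \<theta>)
    case (Suc \<theta>')
    then have "\<theta>' < (LEAST \<theta>. s \<le> card (I \<inter> {..<\<theta>}))" unfolding \<theta>_def by simp
    from not_less_Least[OF this] have "card (I \<inter> {..<\<theta>'}) < s" by simp
    moreover have "I \<inter> {..<\<theta>} \<subseteq> insert \<theta>' (I \<inter> {..<\<theta>'})" using Suc by auto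
    then have "card (I \<inter> {..<\<theta>}) \<le> Suc (card (I \<inter> {..<\<theta>'}))"
      using card_mono[of "insert \<theta>' (I \<inter> {..<\<theta>'})"] by (simp add: card_insert_if split: if_splits)
    ultimately show ?thesis by simp
  qed simp
  moreover have "card I = card (I \<inter> {..<\<theta>}) + card (I \<inter> {\<theta>..})"
    using assms(1) by (subst card_Un_disjoint[symmetric]) (auto intro!: arg_cong[where f = card])
  ultimately show ?thesis using \<theta> assms(2) by (intro exI[of _ \<theta>]) linarith
qed

text \<open>
  All neighbours of the two ends of a longest path lie on the path, so that \<open>G\<close> provides linearly
  many chords at each end. Splitting the chords of the first end at a threshold \<open>\<theta>\<close> leaves
  linearly many of them on either side. The chords of the last end are numerous on one side; they are
  combined with the chords of the first end on the other side. Depending on the side, all chords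
  combined are parallel or all of them cross, and an edge of \<open>R\<close> between the two linear sets of
  vertices next to their ends closes the cycle.
\<close>
lemma longest_path_closes:
  fixes P :: "'a list"
  assumes E: "E = G \<union> R" and V: "finite V" "set P \<subseteq> V"
    and P: "distinct P" "successively (\<lambda>x y. {x, y} \<in> E) P" "P \<noteq> []"
    and longest: "\<And>Q. distinct Q \<Longrightarrow> set Q \<subseteq> V \<Longrightarrow> successively (\<lambda>x y. {x, y} \<in> E) Q \<Longrightarrow> length Q \<le> length P"
    and nbs: "\<And>v. v \<in> V \<Longrightarrow> neighbours G v \<subseteq> V - {v} \<and> 4 * s + 2 \<le> card (neighbours G v)"
    and join: "joined s V R" and "s > 0"
  shows "\<exists>C. distinct C \<and> set C = set P \<and> successively (\<lambda>x y. {x, y} \<in> E) (C @ [hd C])"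
proof -
  define l where "l = length P"
  let ?A = "\<lambda>x y. {x, y} \<in> E"
  have sym: "?A y x" if "?A x y" for x y using that by (simp add: insert_commute)
  define x y where "x = hd P" and "y = last P"
  have xy: "x \<in> V" "y \<in> V" using P(3) V(2) by (auto simp: x_def y_def)
  have l0: "l > 0" using P(3) by (simp add: l_def)
  have x_nth: "x = P ! 0" and y_nth: "y = P ! (l - 1)"
    using P(3) by (auto simp: x_def y_def l_def hd_conv_nth last_conv_nth)
  have nx: "neighbours G x \<subseteq> set P"
  proof (rule ccontr)
    assume "\<not> neighbours G x \<subseteq> set P"
    then obtain u where u: "{x, u} \<in> G" "u \<notin> set P" by (auto simp: neighbours_def)
    then have "u \<in> V" using nbs[OF xy(1)] by (auto simp: neighbours_def)
    then have "length (u # P) \<le> length P"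
      using u P V(2) E by (intro longest) (auto simp: successively_Cons x_def insert_commute)
    then show False by simp
  qed
  have ny: "neighbours G y \<subseteq> set P"
  proof (rule ccontr)
    assume "\<not> neighbours G y \<subseteq> set P"
    then obtain u where u: "{y, u} \<in> G" "u \<notin> set P" by (auto simp: neighbours_def)
    then have "u \<in> V" using nbs[OF xy(2)] by (auto simp: neighbours_def)
    then have "length (P @ [u]) \<le> length P"
      using u P V(2) E by (intro longest) (auto simp: successively_append_iff y_def)
    then show False by simp
  qed
  define ind where "ind v = {i. i < l \<and> {v, P ! i} \<in> G}" for v
  have card_ind: "card (ind v) \<ge> 4 * s + 2" if "v \<in> V" "neighbours G v \<subseteq> set P" for v
  proof -
    have "neighbours G v = (\<lambda>i. P ! i) ` ind v"
      using that(2) by (auto simp: neighbours_def ind_def l_def in_set_conv_nth subset_iff)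
    then have "card (neighbours G v) \<le> card (ind v)"
      by (simp add: card_image_le ind_def)
    then show ?thesis using nbs[OF that(1)] by linarith
  qed
  define I J where "I = ind x" and "J = ind y"
  have I: "card I \<ge> 4 * s + 2" "finite I" and J: "card J \<ge> 4 * s + 2" "finite J"
    using card_ind nx ny xy by (auto simp: I_def J_def ind_def)
  have nthV: "P ! i \<in> V" if "i < l" for i using that V(2) by (auto simp: l_def)
  have I_bd: "0 < i \<and> i < l" if "i \<in> I" for i
  proof -
    have "P ! i \<noteq> x" using that nbs[OF xy(1)] by (auto simp: I_def ind_def neighbours_def)
    then show ?thesis using that x_nth by (auto simp: I_def ind_def intro: gr0I)
  qed
  have J_bd: "Suc j < l" if "j \<in> J" for j
  proof -
    have "P ! j \<noteq> y" using that nbs[OF xy(2)] by (auto simp: J_def ind_def neighbours_def)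
    then have "j \<noteq> l - 1" "j < l" using that y_nth by (auto simp: J_def ind_def)
    then show ?thesis by simp
  qed
  have P_inj: "i = j" if "P ! i = P ! j" "i < l" "j < l" for i j
    using that P(1) by (simp add: l_def nth_eq_iff_index_eq)
  have card_shift: "card ((\<lambda>i. P ! f i) ` K) = card K" if "inj_on f K" "\<And>i. i \<in> K \<Longrightarrow> f i < l" for f and K :: "nat set"
    by (rule card_image) (use that P_inj in \<open>auto simp: inj_on_def\<close>)
  have inj_pred: "inj_on (\<lambda>i. i - Suc 0) K" if "\<And>i. i \<in> K \<Longrightarrow> 0 < i" for K :: "nat set"
    by (rule inj_onI) (metis that Suc_pred)
  obtain \<theta> where \<theta>: "s \<le> card (I \<inter> {..<\<theta>})" "s \<le> card (I \<inter> {\<theta>..})"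
    using median_threshold[OF I(2), of s s] I(1) by auto
  have "card J = card (J \<inter> {..<\<theta>}) + card (J \<inter> {\<theta>..})"
    using J(2) by (subst card_Un_disjoint[symmetric]) (auto intro!: arg_cong[where f = card])
  \<comment> \<open>In the second case one more chord is needed as index \<open>0\<close> has no predecessor.\<close>
  then consider "s \<le> card (J \<inter> {\<theta>..})" | "Suc s \<le> card (J \<inter> {..<\<theta>})" using J(1) by linarith
  then show ?thesis
  proof cases
    case 1
    define X Y where "X = (\<lambda>i. P ! (i - 1)) ` (I \<inter> {..<\<theta>})" and "Y = (\<lambda>j. P ! Suc j) ` (J \<inter> {\<theta>..})"
    have "card X = card (I \<inter> {..<\<theta>})" unfolding X_def
      by (rule card_shift) (auto intro!: inj_pred dest: I_bd)
    moreover have "card Y = card (J \<inter> {\<theta>..})" unfolding Y_def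
      by (rule card_shift) (auto simp: inj_on_def dest: J_bd)
    moreover have "X \<inter> Y = {}"
    proof (rule ccontr)
      assume "X \<inter> Y \<noteq> {}"
      then obtain i j where "i \<in> I" "i < \<theta>" "j \<in> J" "\<theta> \<le> j" "P ! (i - 1) = P ! Suc j"
        by (auto simp: X_def Y_def)
      moreover from this have "i - 1 < l" "0 < i" "Suc j < l" using I_bd[of i] J_bd[of j] by auto
      ultimately show False using P_inj[of "i - 1" "Suc j"] by simp
    qed
    moreover have "X \<subseteq> V" unfolding X_def using I_bd nthV by (metis (no_types, lifting) IntD1 image_subsetI less_imp_diff_less)
    moreover have "Y \<subseteq> V" unfolding Y_def using J_bd nthV by auto
    ultimately obtain u w where uw: "u \<in> X" "w \<in> Y" "{u, w} \<in> R"
      using join 1 \<theta>(1) unfolding joined_def by metis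
    then obtain i j where ij: "i \<in> I" "i < \<theta>" "u = P ! (i - 1)" "j \<in> J" "\<theta> \<le> j" "w = P ! Suc j"
      by (auto simp: X_def Y_def)
    have bd: "0 < i" "i \<le> j" "Suc j < l" using I_bd[of i] J_bd[of j] ij by auto
    define p q r where "p = take i P" and "q = drop i (take (Suc j) P)" and "r = drop (Suc j) P"
    have "P = take i (take (Suc j) P) @ drop i (take (Suc j) P) @ drop (Suc j) P"
      by (metis append.assoc append_take_drop_id)
    moreover have "take i (take (Suc j) P) = p" using bd by (simp add: p_def min_def)
    ultimately have P_eq: "P = p @ q @ r" by (simp add: q_def r_def)
    have ne: "p \<noteq> []" "q \<noteq> []" "r \<noteq> []" using bd by (auto simp: p_def q_def r_def l_def)
    have hp: "hd p = x" using P_eq ne by (metis hd_append x_def)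
    have lr: "last r = y" using ne bd by (simp add: r_def y_def l_def)
    have hq: "hd q = P ! i" using bd by (simp add: q_def hd_drop_conv_nth l_def)
    have lq: "last q = P ! j" using ne bd unfolding q_def by (simp add: last_conv_nth l_def)
    have lp: "last p = u" using ne bd ij by (simp add: p_def last_conv_nth l_def)
    have hr: "hd r = w" using bd ij by (simp add: r_def hd_drop_conv_nth l_def)
    have "?A (hd p) (hd q)" using ij(1) hp hq E by (simp add: I_def ind_def)
    moreover have "?A (last q) (last r)" using ij(4) lq lr E by (simp add: J_def ind_def insert_commute)
    moreover have "?A (last p) (hd r)" using uw(3) lp hr E by simp
    ultimately have "successively ?A ((rev p @ q @ rev r) @ [hd (rev p @ q @ rev r)])"
      using closing_parallel_chords[of ?A p q r] sym ne P(2) P_eq by metis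
    moreover have "distinct (rev p @ q @ rev r)" "set (rev p @ q @ rev r) = set P"
      using P(1) unfolding P_eq by auto
    ultimately show ?thesis by blast
  next
    case 2
    define X Y where "X = (\<lambda>i. P ! (i - 1)) ` (I \<inter> {\<theta>..})" and "Y = (\<lambda>j. P ! (j - 1)) ` (J \<inter> {..<\<theta>} - {0})"
    have "card X = card (I \<inter> {\<theta>..})" unfolding X_def
      by (rule card_shift) (auto intro!: inj_pred dest: I_bd)
    moreover have "card Y = card (J \<inter> {..<\<theta>} - {0})" unfolding Y_def
      by (rule card_shift) (auto intro!: inj_pred dest: J_bd)
    moreover have "s \<le> card (J \<inter> {..<\<theta>} - {0})"
      using 2 by (auto simp: card_Diff_singleton_if)
    moreover have "X \<inter> Y = {}"
    proof (rule ccontr)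
      assume "X \<inter> Y \<noteq> {}"
      then obtain i j where "i \<in> I" "\<theta> \<le> i" "j \<in> J" "j < \<theta>" "0 < j" "P ! (i - 1) = P ! (j - 1)"
        by (auto simp: X_def Y_def)
      moreover from this have "i - 1 < l" "0 < i" "j - 1 < l" using I_bd[of i] J_bd[of j] by auto
      ultimately show False using P_inj[of "i - 1" "j - 1"] by simp
    qed
    moreover have "X \<subseteq> V" unfolding X_def using I_bd nthV by (metis (no_types, lifting) IntD1 image_subsetI less_imp_diff_less)
    moreover have "Y \<subseteq> V" unfolding Y_def using J_bd nthV by force
    ultimately obtain u w where uw: "u \<in> X" "w \<in> Y" "{u, w} \<in> R"
      using join \<theta>(2) unfolding joined_def by metis
    then obtain i j where ij: "i \<in> I" "\<theta> \<le> i" "u = P ! (i - 1)" "j \<in> J" "j < \<theta>" "0 < j" "w = P ! (j - 1)"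
      by (auto simp: X_def Y_def)
    have bd: "0 < j" "j < i" "i < l" using I_bd[of i] ij by auto
    define p q r where "p = take j P" and "q = drop j (take i P)" and "r = drop i P"
    have "P = take j (take i P) @ drop j (take i P) @ drop i P"
      by (metis append.assoc append_take_drop_id)
    moreover have "take j (take i P) = p" using bd by (simp add: p_def min_def)
    ultimately have P_eq: "P = p @ q @ r" by (simp add: q_def r_def)
    have ne: "p \<noteq> []" "q \<noteq> []" "r \<noteq> []" using bd by (auto simp: p_def q_def r_def l_def)
    have hp: "hd p = x" using P_eq ne by (metis hd_append x_def)
    have lr: "last r = y" using ne bd by (simp add: r_def y_def l_def)
    have hq: "hd q = P ! j" using bd by (simp add: q_def hd_drop_conv_nth l_def)
    have lq: "last q = u" using ne bd ij unfolding q_def by (simp add: last_conv_nth l_def)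
    have lp: "last p = w" using ne bd ij by (simp add: p_def last_conv_nth l_def)
    have hr: "hd r = P ! i" using bd by (simp add: r_def hd_drop_conv_nth l_def)
    have "?A (hd q) (last r)" using ij(4) hq lr E by (simp add: J_def ind_def insert_commute)
    moreover have "?A (hd r) (hd p)" using ij(1) hp hr E by (simp add: I_def ind_def insert_commute)
    moreover have "?A (last p) (last q)" using uw(3) lp lq E by (simp add: insert_commute)
    ultimately have "successively ?A ((rev q @ rev r @ p) @ [hd (rev q @ rev r @ p)])"
      using closing_crossing_chords[of ?A p q r] sym ne P(2) P_eq by metis
    moreover have "distinct (rev q @ rev r @ p)" "set (rev q @ rev r @ p) = set P"
      using P(1) unfolding P_eq by auto
    ultimately show ?thesis by blast
  qed
qed

text \<open>
  A vertex outside the cycle that closes a longest path is not adjacent to it, for otherwise there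
  would be a longer path. But the cycle and its complement both contain the neighbourhoods of their
  vertices and hence at least \<open>s\<close> vertices each, so some edge of \<open>R\<close> joins them.
\<close>
lemma hamiltonian_if_joined:
  fixes V :: "'a set"
  assumes E: "E = G \<union> R" and V: "finite V" "V \<noteq> {}"
    and nbs: "\<And>v. v \<in> V \<Longrightarrow> neighbours G v \<subseteq> V - {v} \<and> 4 * s + 2 \<le> card (neighbours G v)"
    and join: "joined s V R" and "s > 0"
  shows "\<exists>C. distinct C \<and> set C = V \<and> successively (\<lambda>x y. {x, y} \<in> E) (C @ [hd C])"
proof -
  let ?A = "\<lambda>x y. {x, y} \<in> E"
  define paths where "paths P \<longleftrightarrow> distinct P \<and> set P \<subseteq> V \<and> successively ?A P" for P
  have len: "length P \<le> card V" if "paths P" for P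
    using that card_mono[OF V(1)] by (metis paths_def distinct_card)
  obtain v0 where "v0 \<in> V" using V(2) by blast
  then have "paths [v0]" by (simp add: paths_def)
  then obtain P where P: "paths P" "\<And>Q. paths Q \<Longrightarrow> length Q \<le> length P"
    using ex_has_greatest_nat[of paths "[v0]" length "Suc (card V)"] len by (metis le_imp_less_Suc)
  have "P \<noteq> []" using P(2)[OF \<open>paths [v0]\<close>] by auto
  obtain C where C: "distinct C" "set C = set P" "successively ?A (C @ [hd C])"
    using longest_path_closes[OF E V(1) _ _ _ _ _ nbs join \<open>s > 0\<close>, of P] P \<open>P \<noteq> []\<close>
    unfolding paths_def by auto
  have "set C = V"
  proof (rule ccontr)
    assume "set C \<noteq> V"
    then obtain u where u: "u \<in> V" "u \<notin> set C" using C(2) P(1) by (auto simp: paths_def)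
    have CV: "set C \<subseteq> V" using C(2) P(1) by (simp add: paths_def)
    have no: "{w, c} \<notin> E" if w: "w \<in> V" "w \<notin> set C" and c: "c \<in> set C" for w c
    proof
      assume e: "{w, c} \<in> E"
      obtain c1 c2 where cc: "C = c1 @ c # c2" using c by (metis split_list)
      have "successively ?A (w # c # c2 @ c1)"
        using C(3) e unfolding cc by (cases c1) (auto simp: successively_append_iff successively_Cons hd_append split: if_splits)
      then have "paths (w # c # c2 @ c1)" using C(1) CV w unfolding paths_def cc by auto
      then have "length (w # c # c2 @ c1) \<le> length P" by (rule P(2))
      moreover have "length P = length C" using C(1,2) P(1) by (metis distinct_card paths_def)
      ultimately show False by (simp add: cc)
    qed
    obtain c where c: "c \<in> set C" using C(2) \<open>P \<noteq> []\<close> by (metis list.set_intros(1) neq_Nil_conv)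
    have "neighbours G u \<subseteq> V - set C"
      using nbs[OF u(1)] no[OF u] E by (auto simp: neighbours_def)
    then have "s \<le> card (V - set C)"
      using nbs[OF u(1)] card_mono[of "V - set C" "neighbours G u"] V(1) by auto
    moreover have "neighbours G c \<subseteq> set C"
      using nbs[of c] c CV no E by (auto simp: neighbours_def insert_commute)
    then have "s \<le> card (set C)"
      using nbs[of c] c CV card_mono[of "set C" "neighbours G c"] by auto
    ultimately obtain a b where "a \<in> set C" "b \<in> V - set C" "{a, b} \<in> R"
      using join CV unfolding joined_def by (metis Diff_disjoint Diff_subset)
    then show False using no[of b a] E by (auto simp: insert_commute)
  qed
  with C show ?thesis by blast
qed

text \<open>
  The certificate consists of the complete bipartite graphs between disjoint sets of
  \<open>s = \<lceil>\<alpha> * n / 8\<rceil>\<close> or more vertices. There are at most \<open>4 ^ n\<close> pairs of vertex sets,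
  and \<open>\<alpha> * n \<ge> 12\<close> ensures \<open>4 * s + 2 \<le> \<alpha> * n\<close>.
\<close>
lemma certified_cycle:
  assumes \<alpha>: "\<alpha> > 0" and n: "real n \<ge> 12 / \<alpha>" "n \<ge> 3" and G: "G \<in> graphs n"
    and deg: "real (min_degree n G) \<ge> \<alpha> * real n"
  shows "certified ((\<alpha> / 8)\<^sup>2) 4 n G (power_ham 1 n)"
proof -
  define V where "V = {1..n}"
  define s where "s = nat \<lceil>\<alpha> / 8 * real n\<rceil>"
  have pos: "\<alpha> / 8 * real n > 0" using \<alpha> n(2) by simp
  have s: "real s \<ge> \<alpha> / 8 * real n" "real s \<le> \<alpha> / 8 * real n + 1"
    unfolding s_def using pos by linarith+
  then have "s > 0" using pos by (cases s) auto
  define prod where "prod X Y = {{x, y} | x y. x \<in> X \<and> y \<in> Y}" for X Y :: "nat set"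
  define \<Q> where "\<Q> = {prod X Y | X Y. X \<subseteq> V \<and> Y \<subseteq> V \<and> X \<inter> Y = {} \<and> s \<le> card X \<and> s \<le> card Y}"
  have fin: "finite (Pow V \<times> Pow V)" by (simp add: V_def)
  have sub: "\<Q> \<subseteq> (\<lambda>(X, Y). prod X Y) ` (Pow V \<times> Pow V)" unfolding \<Q>_def by auto
  show ?thesis unfolding certified_def
  proof (intro exI[of _ \<Q>] conjI ballI allI impI)
    show "finite \<Q>" by (rule finite_subset[OF sub finite_imageI[OF fin]])
    have "card \<Q> \<le> card (Pow V \<times> Pow V)"
      using card_mono[OF finite_imageI[OF fin] sub] card_image_le[OF fin] by (rule order_trans)
    also have "\<dots> = 4 ^ n" by (simp add: V_def card_cartesian_product card_Pow power_mult_distrib[symmetric])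
    finally have "card \<Q> \<le> 4 ^ n" .
    then have "real (card \<Q>) \<le> real (4 ^ n)" by (rule of_nat_mono)
    then show "real (card \<Q>) \<le> 4 ^ n" by simp
    fix Q assume "Q \<in> \<Q>"
    then obtain X Y where Q: "Q = prod X Y" and XY: "X \<subseteq> V" "Y \<subseteq> V" "X \<inter> Y = {}" "s \<le> card X" "s \<le> card Y"
      unfolding \<Q>_def by blast
    show "Q \<subseteq> all_edges n"
    proof
      fix e assume "e \<in> Q"
      then obtain x y where "e = {x, y}" "x \<in> X" "y \<in> Y" unfolding Q prod_def by blast
      moreover from this have "x \<noteq> y" using XY(3) by blast
      ultimately show "e \<in> all_edges n" using XY(1,2) by (auto simp: all_edges_def V_def)
    qed
    have "Q = (\<lambda>(x, y). {x, y}) ` (X \<times> Y)" unfolding Q prod_def by auto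
    moreover have "inj_on (\<lambda>(x, y). {x, y}) (X \<times> Y)"
      using XY(3) by (auto simp: inj_on_def doubleton_eq_iff)
    ultimately have "card Q = card X * card Y" by (simp add: card_image card_cartesian_product)
    then have "s\<^sup>2 \<le> card Q" using XY(4,5) by (simp add: power2_eq_square mult_mono)
    then have "(real s)\<^sup>2 \<le> real (card Q)" by (metis of_nat_le_iff of_nat_power)
    moreover have "(\<alpha> / 8 * real n)\<^sup>2 \<le> (real s)\<^sup>2" using s(1) \<alpha> by (intro power_mono) auto
    ultimately show "(\<alpha> / 8)\<^sup>2 * (real n)\<^sup>2 \<le> real (card Q)"
      unfolding power_mult_distrib by linarith
  next
    fix R assume R: "R \<subseteq> all_edges n" and hit: "\<forall>Q\<in>\<Q>. R \<inter> Q \<noteq> {}"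
    have "joined s V R" unfolding joined_def
    proof (intro allI impI)
      fix X Y assume "X \<subseteq> V" "Y \<subseteq> V" "X \<inter> Y = {}" "s \<le> card X" "s \<le> card Y"
      then have "prod X Y \<in> \<Q>" unfolding \<Q>_def by blast
      then have "R \<inter> prod X Y \<noteq> {}" using hit by blast
      then show "\<exists>x\<in>X. \<exists>y\<in>Y. {x, y} \<in> R" unfolding prod_def by blast
    qed
    moreover have "neighbours G v \<subseteq> V - {v} \<and> 4 * s + 2 \<le> card (neighbours G v)" if "v \<in> V" for v
    proof -
      have "real (card (neighbours G v)) \<ge> \<alpha> * real n"
        using card_neighbours_ge[OF G deg] that by (simp add: V_def)
      moreover have "\<alpha> * real n \<ge> 12" using n(1) \<alpha> by (simp add: field_simps)
      ultimately have "real (4 * s + 2) \<le> real (card (neighbours G v))" using s(2) by simp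
      then show ?thesis using neighbours_subset[OF G] unfolding V_def by (metis of_nat_le_iff)
    qed
    ultimately obtain C where C: "distinct C" "set C = V" "successively (\<lambda>x y. {x, y} \<in> G \<union> R) (C @ [hd C])"
      using hamiltonian_if_joined[of "G \<union> R" G R V s] \<open>s > 0\<close> n(2) by (auto simp: V_def)
    have "C \<noteq> []" using C(2) n(2) by (auto simp: V_def)
    then have C1: "take 1 C = [hd C]" by (cases C) auto
    have "power_path 1 (G \<union> R) (C @ take 1 C)"
      unfolding power_path_iff_nth C1
    proof (intro allI impI)
      fix i j :: nat assume "i < j" "j < length (C @ [hd C])" "j \<le> i + 1"
      moreover from this have "j = Suc i" by simp
      ultimately show "{(C @ [hd C]) ! i, (C @ [hd C]) ! j} \<in> G \<union> R"
        using C(3) unfolding successively_conv_nth by blast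
    qed
    moreover have "G \<union> R \<in> graphs n" using G R by (auto simp: graphs_def)
    ultimately show "G \<union> R \<in> power_ham 1 n"
      using C(1,2) n(2) by (intro power_hamI) (auto simp: V_def)
  qed
qed

section \<open>Patterns that lead into a target clique\<close>

text \<open>
  A pattern describes a walk from an ordered clique \<open>E\<close> of \<open>m\<close> vertices into a target
  clique \<open>b\<^sub>0, \<dots>, b\<^bsub>m - 1\<^esub>\<close>. Any two entries of the walk less than \<open>m\<close> places apart
  have to be adjacent in \<open>G\<close>; when each entry is replaced by a pair of vertices, this gives all
  adjacencies of an \<open>m\<close>-th power of a path except those within pairs, because entries that are
  \<open>m\<close> places apart are then at least \<open>2 * m - 1 > m\<close> vertices apart.

  The coordinates of a pattern are the target vertices (\<open>0, \<dots>, m - 1\<close>), followed by one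
  coordinate \<open>m + l\<close> for each place \<open>l\<close> of the first \<open>m + 1\<close> periods of length
  \<open>m\<close> of the walk, followed by a clique of \<open>m\<close> vertices, the end of the pattern, which is
  not blown up.

  The target vertices come first, and must enter the walk without giving any new vertex more than
  \<open>m\<close> earlier neighbours. They are therefore introduced one at a time: in period \<open>P\<close> the
  places \<open>i < P - 1\<close> are occupied by \<open>b\<^sub>i\<close> and the others by new vertices. From period
  \<open>m + 1\<close> on, the walk circles around the target clique.
\<close>
definition slot :: "nat \<Rightarrow> nat \<Rightarrow> nat" where
  "slot m l = (if l div m \<le> m \<and> l div m \<le> Suc (l mod m) then m + l else l mod m)"

text \<open>
  The coordinates before \<open>c\<close> to which coordinate \<open>c\<close> has to be adjacent. A new vertex in
  period \<open>P \<ge> 1\<close> must be adjacent to the \<open>m - 1\<close> entries before it and to those of the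
  \<open>m - 1\<close> entries after it that are target vertices. The latter belong to period \<open>P + 1\<close>;
  all of them but \<open>b\<^bsub>P - 1\<^esub>\<close> also occur among the entries before it. So there are at most
  \<open>m\<close> conditions. New vertices in period \<open>0\<close> are subject to conditions from \<open>E\<close>
  instead. Vertex \<open>i\<close> of the final clique follows \<open>b\<^sub>i, \<dots>, b\<^bsub>m - 1\<^esub>\<close> and its
  predecessors in that clique. Coordinates \<open>m + l\<close> with \<open>slot m l < m\<close> do not occur in
  the walk and are unconstrained.
\<close>
definition earlier :: "nat \<Rightarrow> nat \<Rightarrow> nat set" where
  "earlier m c =
     (if c < 2 * m then {m..<c}
      else if c < m * (m + 2) then
        (if (c - m) div m \<le> Suc ((c - m) mod m)
         then insert ((c - m) div m - 1) (slot m ` {c - m - (m - 1)..<c - m}) else {})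
      else {c - m * (m + 2)..<m} \<union> {m * (m + 2)..<c})"

lemma slot_le: "0 < m \<Longrightarrow> slot m l \<le> m + l"
  by (auto simp: slot_def intro: trans_le_add2)

lemma slot_less:
  assumes "0 < m"
  shows "slot m l < m * (m + 2)"
proof (cases "l div m \<le> m \<and> l div m \<le> Suc (l mod m)")
  case True
  have "l = l div m * m + l mod m" by simp
  also have "\<dots> < m * m + m" using True assms by (intro add_le_less_mono mult_le_mono1) auto
  finally show ?thesis using True by (simp add: slot_def algebra_simps)
next
  case False
  have "l mod m < m" using assms by simp
  also have "m \<le> m * (m + 2)" by simp
  finally show ?thesis using False by (auto simp: slot_def)
qed

lemma slot_less_iff: "0 < m \<Longrightarrow> slot m l < m \<longleftrightarrow> \<not> (l div m \<le> m \<and> l div m \<le> Suc (l mod m))"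
  by (simp add: slot_def)

lemma earlier_less:
  assumes "0 < m" "m \<le> c" "d \<in> earlier m c"
  shows "d < c"
proof (cases "c < 2 * m \<or> m * (m + 2) \<le> c")
  case True
  have "m \<le> m * (m + 2)" by simp
  with True show ?thesis using assms(3) by (auto simp: earlier_def split: if_splits)
next
  case False
  then have "d = (c - m) div m - 1 \<or> d \<in> slot m ` {c - m - (m - 1)..<c - m}"
    using assms(3) by (auto simp: earlier_def split: if_splits)
  then show ?thesis
  proof
    assume "d = (c - m) div m - 1"
    moreover have "(c - m) div m \<le> c - m" by (rule div_le_dividend)
    ultimately show ?thesis using assms(1,2) by linarith
  next
    assume "d \<in> slot m ` {c - m - (m - 1)..<c - m}"
    then obtain l where "d = slot m l" "l < c - m" by auto
    then show ?thesis using slot_le[OF assms(1), of l] by linarith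
  qed
qed

lemma finite_earlier [simp]: "finite (earlier m c)"
  by (simp add: earlier_def)

lemma card_earlier:
  assumes "0 < m" "2 * m \<le> c" "c < m * (m + 3)"
  shows "card (earlier m c) \<le> m"
proof (cases "c < m * (m + 2)")
  case True
  have "card (insert ((c - m) div m - 1) (slot m ` {c - m - (m - 1)..<c - m})) \<le> Suc (card (slot m ` {c - m - (m - 1)..<c - m}))"
    by (simp add: card_insert_if)
  also have "\<dots> \<le> Suc (card {c - m - (m - 1)..<c - m})"
    by (intro Suc_le_mono[THEN iffD2] card_image_le) simp
  also have "\<dots> \<le> m" using assms(1) by simp
  finally show ?thesis using assms True by (simp add: earlier_def)
next
  case False
  have "card ({c - m * (m + 2)..<m} \<union> {m * (m + 2)..<c}) \<le> (m - (c - m * (m + 2))) + (c - m * (m + 2))"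
    using card_Un_le[of "{c - m * (m + 2)..<m}" "{m * (m + 2)..<c}"] by simp
  also have "\<dots> = m" using False assms(3) by (simp add: algebra_simps)
  finally show ?thesis using assms False by (simp add: earlier_def)
qed

text \<open>
  Since distinct target vertices are adjacent, the conditions recorded in \<^const>\<open>earlier\<close>
  suffice for all pairs of entries less than \<open>m\<close> places apart.
\<close>
lemma slots_related:
  assumes m: "2 \<le> m" and l: "l < l'" "l' \<le> l + (m - 1)"
  shows "slot m l < m \<and> slot m l' < m \<and> slot m l \<noteq> slot m l' \<or>
    m \<le> slot m l' \<and> slot m l \<in> earlier m (slot m l') \<or>
    m \<le> slot m l \<and> slot m l' \<in> earlier m (slot m l)"
proof -
  define P i P' i' where "P = l div m" and "i = l mod m" and "P' = l' div m" and "i' = l' mod m"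
  have eqs: "l = P * m + i" "l' = P' * m + i'" and im: "i < m" "i' < m"
    using m by (simp_all add: P_def i_def P'_def i'_def)
  have "P \<le> P'" unfolding P_def P'_def using l by (intro div_le_mono) simp
  moreover have "P' \<le> Suc P"
  proof -
    have "l' div m \<le> (l + m) div m" using l by (intro div_le_mono) simp
    then show ?thesis using m by (simp add: P_def P'_def)
  qed
  ultimately consider "P' = P" "i < i'" | "P' = Suc P" "i' < i"
    using l m im unfolding eqs by (cases "P' = P") (auto simp: le_Suc_eq)
  note cases_P = this
  have fresh: "slot m l = (if P \<le> m \<and> P \<le> Suc i then m + l else i)"
      "slot m l' = (if P' \<le> m \<and> P' \<le> Suc i' then m + l' else i')"
    by (simp_all add: slot_def P_def i_def P'_def i'_def)
  show ?thesis
  proof (cases "P' \<le> m \<and> P' \<le> Suc i'")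
    case True
    then have s': "slot m l' = m + l'" using fresh by simp
    have "slot m l \<in> earlier m (m + l')"
    proof (cases "l' < m")
      case True
      then have "P = 0" "P' = 0" using l by (simp_all add: P_def P'_def)
      then have "slot m l = m + l" using fresh by simp
      then show ?thesis using True l by (simp add: earlier_def)
    next
      case False
      have "m + l' < m * (m + 2)" using slot_less[of m l'] s' m by simp
      moreover have "(m + l' - m) div m \<le> Suc ((m + l' - m) mod m)"
        using True by (simp add: P'_def i'_def)
      moreover have "l \<in> {m + l' - m - (m - 1)..<m + l' - m}" using l False by auto
      ultimately show ?thesis using False by (simp add: earlier_def)
    qed
    then show ?thesis using s' by simp
  next
    case False
    then have s': "slot m l' = i'" using fresh by auto
    show ?thesis
    proof (cases "P \<le> m \<and> P \<le> Suc i")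
      case nfresh: False
      then have "slot m l = i" using fresh by auto
      moreover have "i \<noteq> i'" using cases_P by cases auto
      ultimately show ?thesis using s' im by simp
    next
      case True
      then have s: "slot m l = m + l" using fresh by simp
      have P': "P' = Suc P" "i' < i" using cases_P True False by (cases; auto)+
      have "Suc i' \<le> P" using False True P' m im by auto
      then have "1 \<le> P" by simp
      have lm: "m \<le> l" unfolding eqs using \<open>1 \<le> P\<close> by (metis le_add1 mult_le_mono1 nat_mult_1 order_trans)
      have "m + l < m * (m + 2)" using slot_less[of m l] s m by simp
      moreover have "(m + l - m) div m \<le> Suc ((m + l - m) mod m)" using True by (simp add: P_def i_def)
      moreover have "i' = P - 1 \<or> i' \<in> slot m ` {l - (m - 1)..<l}"
      proof (cases "i' = P - 1")
        case False
        then have "i' < P - 1" using \<open>Suc i' \<le> P\<close> by simp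
        define l'' where "l'' = P * m + i'"
        have "l'' div m = P" "l'' mod m = i'" using im by (simp_all add: l''_def)
        then have "slot m l'' = i'" using \<open>i' < P - 1\<close> by (auto simp: slot_def)
        moreover have "l'' \<in> {l - (m - 1)..<l}" using P' im unfolding l''_def eqs by auto
        ultimately show ?thesis by (metis image_eqI)
      qed simp
      ultimately have "i' \<in> earlier m (m + l)" using lm by (auto simp: earlier_def P_def)
      then show ?thesis using s s' by simp
    qed
  qed
qed

text \<open>
  Candidates for the next coordinate of the pattern \<open>ys\<close>. Entry \<open>l\<close> of period \<open>0\<close>
  is also adjacent to all but the first \<open>l\<close> vertices of \<open>E\<close>, again \<open>m\<close> conditions
  together with its \<open>l\<close> predecessors.
\<close>
definition allowed :: "'a edges \<Rightarrow> nat \<Rightarrow> 'a set \<Rightarrow> 'a list \<Rightarrow> 'a list \<Rightarrow> 'a set" where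
  "allowed G m W E ys = {x \<in> W. (\<forall>d\<in>earlier m (length ys). {ys ! d, x} \<in> G) \<and>
     (length ys < 2 * m \<longrightarrow> (\<forall>e\<in>set (drop (length ys - m) E). {e, x} \<in> G))}"

text \<open>
  The target cliques come with a tag \<open>v\<close>, the vertex that is to be absorbed in the
  applications; it stands at the end of the tuple.
\<close>
definition patterns :: "'a edges \<Rightarrow> nat \<Rightarrow> 'a set \<Rightarrow> 'a list \<Rightarrow> 'a list set \<Rightarrow> 'a list set" where
  "patterns G m W E \<B> = {ys @ [v] | ys v. length ys = m * (m + 3) \<and> take m ys @ [v] \<in> \<B> \<and>
     (\<forall>c. m \<le> c \<and> c < m * (m + 3) \<longrightarrow> ys ! c \<in> allowed G m W E (take c ys))}"

definition min_density :: "'a edges \<Rightarrow> 'a set \<Rightarrow> 'a set \<Rightarrow> real \<Rightarrow> bool" where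
  "min_density G V W d \<longleftrightarrow> (\<forall>v\<in>V. real (card (W \<inter> neighbours G v)) \<ge> d * real (card W))"

text \<open>
  Each of the at most \<open>m\<close> vertices excludes at most the proportion \<open>1 / m - \<epsilon>\<close> of
  \<open>W\<close>.
\<close>
lemma common_neighbours:
  assumes dens: "min_density G V W (1 - 1 / real m + \<epsilon>)" and "finite W" "S \<subseteq> V" "finite S" "card S \<le> m"
    and "0 < m" "0 \<le> \<epsilon>" "\<epsilon> \<le> 1 / real m"
  shows "real (card {x \<in> W. \<forall>s\<in>S. {s, x} \<in> G}) \<ge> \<epsilon> * real (card W)"
proof -
  let ?N = "\<lambda>s. W - neighbours G s"
  define w where "w = real (card W)"
  have miss: "real (card (?N s)) \<le> (1 / real m - \<epsilon>) * w" if "s \<in> S" for s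
  proof -
    have "card (?N s) = card W - card (W \<inter> neighbours G s)" using assms(2) by (metis card_Diff_subset_Int finite_Int)
    moreover have "card (W \<inter> neighbours G s) \<le> card W" using assms(2) by (intro card_mono) auto
    moreover have "(1 - 1 / real m + \<epsilon>) * w \<le> real (card (W \<inter> neighbours G s))"
      using dens that assms(3) unfolding min_density_def w_def by blast
    ultimately have "real (card (?N s)) \<le> w - (1 - 1 / real m + \<epsilon>) * w" by (simp add: w_def of_nat_diff)
    then show ?thesis by (simp add: algebra_simps)
  qed
  have "W \<subseteq> {x \<in> W. \<forall>s\<in>S. {s, x} \<in> G} \<union> (\<Union>s\<in>S. ?N s)" by (auto simp: neighbours_def)
  then have "card W \<le> card ({x \<in> W. \<forall>s\<in>S. {s, x} \<in> G} \<union> (\<Union>s\<in>S. ?N s))"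
    using assms(2,4) by (intro card_mono) auto
  also have "\<dots> \<le> card {x \<in> W. \<forall>s\<in>S. {s, x} \<in> G} + (\<Sum>s\<in>S. card (?N s))"
    using card_UN_le[OF assms(4), of ?N] card_Un_le[of "{x \<in> W. \<forall>s\<in>S. {s, x} \<in> G}" "\<Union>s\<in>S. ?N s"] by linarith
  finally have "real (card W) \<le> real (card {x \<in> W. \<forall>s\<in>S. {s, x} \<in> G} + (\<Sum>s\<in>S. card (?N s)))"
    by (rule of_nat_mono)
  then have "w \<le> real (card {x \<in> W. \<forall>s\<in>S. {s, x} \<in> G}) + (\<Sum>s\<in>S. real (card (?N s)))"
    by (simp add: w_def)
  also have "(\<Sum>s\<in>S. real (card (?N s))) \<le> (\<Sum>s\<in>S. (1 / real m - \<epsilon>) * w)"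
    using miss by (rule sum_mono)
  also have "\<dots> = real (card S) * ((1 / real m - \<epsilon>) * w)" by simp
  also have "\<dots> \<le> real m * ((1 / real m - \<epsilon>) * w)"
    using assms(5,8) by (intro mult_right_mono) (auto simp: w_def)
  also have "\<dots> = w - real m * \<epsilon> * w" using assms(6) by (simp add: field_simps)
  finally have "real m * \<epsilon> * w \<le> real (card {x \<in> W. \<forall>s\<in>S. {s, x} \<in> G})" by simp
  moreover have "1 * (\<epsilon> * w) \<le> real m * (\<epsilon> * w)"
    using assms(6,7) by (intro mult_right_mono) (auto simp: w_def)
  ultimately show ?thesis by (simp add: w_def mult.assoc)
qed

lemma card_allowed:
  assumes dens: "min_density G V W (1 - 1 / real m + \<epsilon>)" and fin: "finite W" and V: "W \<subseteq> V" "set E \<subseteq> V" "set ys \<subseteq> V"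
    and m: "0 < m" "0 \<le> \<epsilon>" "\<epsilon> \<le> 1 / real m" and E: "length E = m" and ys: "m \<le> length ys" "length ys < m * (m + 3)"
  shows "real (card (allowed G m W E ys)) \<ge> \<epsilon> * real (card W)"
proof -
  define c where "c = length ys"
  define S where "S = (\<lambda>d. ys ! d) ` earlier m c \<union> (if c < 2 * m then set (drop (c - m) E) else {})"
  have "S \<subseteq> V"
  proof -
    have "ys ! d \<in> V" if "d \<in> earlier m c" for d
      using earlier_less[OF m(1) _ that] ys(1) V(3) by (auto simp: c_def)
    then show ?thesis using V(2) by (auto simp: S_def dest: in_set_dropD)
  qed
  moreover have "card S \<le> m"
  proof (cases "c < 2 * m")
    case True
    then have "card ((\<lambda>d. ys ! d) ` earlier m c) \<le> c - m"
      using card_image_le[of "earlier m c" "\<lambda>d. ys ! d"] by (simp add: earlier_def)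
    moreover have "card (set (drop (c - m) E)) \<le> m - (c - m)"
      using card_length[of "drop (c - m) E"] E by simp
    ultimately show ?thesis
      using True ys(1) card_Un_le[of "(\<lambda>d. ys ! d) ` earlier m c" "set (drop (c - m) E)"]
      unfolding S_def c_def by simp
  next
    case False
    then have "card S \<le> card (earlier m c)" by (simp add: S_def card_image_le)
    also have "\<dots> \<le> m" using False ys m by (intro card_earlier) (auto simp: c_def)
    finally show ?thesis .
  qed
  moreover have "finite S" by (simp add: S_def)
  ultimately have "real (card {x \<in> W. \<forall>s\<in>S. {s, x} \<in> G}) \<ge> \<epsilon> * real (card W)"
    using common_neighbours[OF dens fin] m by blast
  moreover have "{x \<in> W. \<forall>s\<in>S. {s, x} \<in> G} = allowed G m W E ys"
    unfolding S_def allowed_def c_def by auto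
  ultimately show ?thesis by simp
qed

text \<open>
  Tagged target cliques are dense by assumption, and every further coordinate has at most \<open>m\<close>
  earlier neighbours and thus at least \<open>\<epsilon> * card W\<close> candidates.
\<close>
lemma patterns_dense:
  assumes dens: "min_density G V W (1 - 1 / real m + \<epsilon>)" and V: "finite V" "W \<subseteq> V" "set E \<subseteq> V" "length E = m"
    and m: "0 < m" "0 < \<epsilon>" "\<epsilon> \<le> 1 / real m"
    and W: "real (card W) \<ge> \<omega> * real (card V)" "0 < \<omega>"
    and \<B>: "\<B> \<subseteq> tuples V (m + 1)" "real (card \<B>) \<ge> c * real (card V) ^ (m + 1)" "0 < c"
  shows "patterns G m W E \<B> \<subseteq> tuples V (m * (m + 2) + (m + 1))"
    and "real (card (patterns G m W E \<B>)) \<ge> c * (\<epsilon> * \<omega>) ^ (m * (m + 2)) * real (card V) ^ (m * (m + 2) + (m + 1))"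
proof -
  define n where "n = real (card V)"
  define k where "k = m * (m + 2)"
  have k: "m * (m + 3) = m + k" by (simp add: k_def algebra_simps)
  have finW: "finite W" using V finite_subset by blast
  show "patterns G m W E \<B> \<subseteq> tuples V (m * (m + 2) + (m + 1))"
  proof
    fix ts assume "ts \<in> patterns G m W E \<B>"
    then obtain ys v where ts: "ts = ys @ [v]" "length ys = m * (m + 3)" "take m ys @ [v] \<in> \<B>"
      and al: "\<And>c. m \<le> c \<Longrightarrow> c < m * (m + 3) \<Longrightarrow> ys ! c \<in> allowed G m W E (take c ys)"
      unfolding patterns_def by blast
    have "take m ys @ [v] \<in> tuples V (m + 1)" using ts(3) \<B>(1) by blast
    then have B: "set (take m ys @ [v]) \<subseteq> V" by (simp add: tuples_def)
    have "ys ! c \<in> V" if "c < length ys" for c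
    proof (cases "c < m")
      case True
      then have "ys ! c \<in> set (take m ys)" using that by (metis in_set_conv_nth length_take min_less_iff_conj nth_take)
      then show ?thesis using B by auto
    next
      case False
      then have "ys ! c \<in> W" using al[of c] that ts(2) by (auto simp: allowed_def)
      then show ?thesis using V(2) by auto
    qed
    then have "set ys \<subseteq> V" by (auto simp: in_set_conv_nth)
    then show "ts \<in> tuples V (m * (m + 2) + (m + 1))" using ts B by (simp add: tuples_def algebra_simps)
  qed
  then have finP: "finite (patterns G m W E \<B>)" using V(1) finite_subset by blast
  have finB: "finite \<B>" using \<B>(1) V(1) finite_subset by blast
  define greedy where "greedy B = {Y. length Y = k \<and> (\<forall>j<k. Y ! j \<in> allowed G m W E (B @ take j Y))}" for B
  have g: "real (card (greedy (take m b))) \<ge> (\<epsilon> * \<omega> * n) ^ k" "finite (greedy (take m b))" if "b \<in> \<B>" for b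
  proof -
    have b: "set (take m b) \<subseteq> V" "length (take m b) = m"
      using that \<B>(1) by (auto simp: tuples_def dest: in_set_takeD)
    have "greedy (take m b) \<subseteq> tuples V k \<and> real (card (greedy (take m b))) \<ge> (\<epsilon> * \<omega> * n) ^ k"
      unfolding greedy_def
    proof (rule card_greedy_tuples[OF V(1)])
      show "0 \<le> \<epsilon> * \<omega> * n" using m W by (simp add: n_def)
      fix xs assume xs: "length xs < k" "set xs \<subseteq> V"
      show "allowed G m W E (take m b @ xs) \<subseteq> V" using V(2) by (auto simp: allowed_def)
      have "\<epsilon> * \<omega> * n \<le> \<epsilon> * real (card W)" using W m by (simp add: n_def mult.assoc)
      also have "\<dots> \<le> real (card (allowed G m W E (take m b @ xs)))"
        using xs b V m k by (intro card_allowed[OF dens finW]) auto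
      finally show "\<epsilon> * \<omega> * n \<le> real (card (allowed G m W E (take m b @ xs)))" .
    qed
    then show "real (card (greedy (take m b))) \<ge> (\<epsilon> * \<omega> * n) ^ k" "finite (greedy (take m b))"
      using V(1) finite_subset by auto
  qed
  let ?f = "\<lambda>(b, Y). take m b @ Y @ drop m b"
  let ?S = "SIGMA b:\<B>. greedy (take m b)"
  have "?f ` ?S \<subseteq> patterns G m W E \<B>"
  proof clarify
    fix b Y assume b: "b \<in> \<B>" and Y: "Y \<in> greedy (take m b)"
    then have lb: "length b = m + 1" using \<B>(1) by (auto simp: tuples_def)
    then obtain v where v: "drop m b = [v]" by (metis add_diff_cancel_left' length_0_conv length_Suc_conv length_drop One_nat_def)
    define ys where "ys = take m b @ Y"
    have lY: "length Y = k" using Y by (simp add: greedy_def)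
    have "ys ! c \<in> allowed G m W E (take c ys)" if "m \<le> c" "c < m * (m + 3)" for c
    proof -
      have "Y ! (c - m) \<in> allowed G m W E (take m b @ take (c - m) Y)"
        using Y that k unfolding greedy_def by auto
      moreover have "ys ! c = Y ! (c - m)" "take c ys = take m b @ take (c - m) Y"
        using that lb by (auto simp: ys_def nth_append)
      ultimately show ?thesis by simp
    qed
    moreover have "take m ys @ [v] \<in> \<B>" using b lb v by (simp add: ys_def flip: v)
    moreover have "length ys = m * (m + 3)" using lb lY k by (simp add: ys_def)
    ultimately show "take m b @ Y @ drop m b \<in> patterns G m W E \<B>"
      unfolding patterns_def v ys_def[symmetric] append.assoc[symmetric] by blast
  qed
  moreover have "inj_on ?f ?S"
  proof (rule inj_onI, clarify)
    fix b Y b' Y' assume a: "b \<in> \<B>" "Y \<in> greedy (take m b)" "b' \<in> \<B>" "Y' \<in> greedy (take m b')"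
      and e: "take m b @ Y @ drop m b = take m b' @ Y' @ drop m b'"
    have "length b = m + 1" "length b' = m + 1" using a \<B>(1) by (auto simp: tuples_def)
    moreover have "length Y = length Y'" using a by (simp add: greedy_def)
    ultimately have "take m b = take m b'" "Y = Y'" "drop m b = drop m b'" using e by auto
    then show "b = b' \<and> Y = Y'" by (metis append_take_drop_id)
  qed
  ultimately have "card ?S \<le> card (patterns G m W E \<B>)" using finP by (intro card_inj_on_le)
  moreover have "real (card ?S) = (\<Sum>b\<in>\<B>. real (card (greedy (take m b))))"
    using finB g(2) by (subst card_SigmaI) auto
  moreover have "(\<Sum>b\<in>\<B>. real (card (greedy (take m b)))) \<ge> (\<Sum>b\<in>\<B>. (\<epsilon> * \<omega> * n) ^ k)"
    using g(1) by (intro sum_mono) auto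
  moreover have "(\<Sum>b\<in>\<B>. (\<epsilon> * \<omega> * n) ^ k) \<ge> c * n ^ (m + 1) * (\<epsilon> * \<omega> * n) ^ k"
    using \<B>(2) m W by (simp add: n_def mult_right_mono)
  ultimately have "real (card (patterns G m W E \<B>)) \<ge> c * n ^ (m + 1) * (\<epsilon> * \<omega> * n) ^ k" by linarith
  also have "c * n ^ (m + 1) * (\<epsilon> * \<omega> * n) ^ k = c * (\<epsilon> * \<omega>) ^ k * n ^ (k + (m + 1))"
    unfolding power_mult_distrib power_add by (simp only: mult_ac)
  finally show "real (card (patterns G m W E \<B>)) \<ge> c * (\<epsilon> * \<omega>) ^ (m * (m + 2)) * real (card V) ^ (m * (m + 2) + (m + 1))"
    unfolding n_def k_def .
qed

lemma card_repetitive_tuples: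
  assumes V: "finite V" and pq: "0 < p + q"
  shows "card {ts \<in> tuples V (p + q). \<not> distinct (take p ts)} \<le> p\<^sup>2 * card V ^ (p + q - 1)"
proof -
  define N where "N i j = {ts \<in> tuples V (p + q). ts ! i = ts ! j}" for i j
  have N: "card (N i j) \<le> card V ^ (p + q - 1)" if "i < j" "j < p" for i j
  proof -
    let ?f = "\<lambda>ts. take j ts @ drop (Suc j) ts"
    have "?f ` N i j \<subseteq> tuples V (p + q - 1)"
    proof clarify
      fix ts assume "ts \<in> N i j"
      then have "set ts \<subseteq> V" "length ts = p + q" by (auto simp: N_def tuples_def)
      then show "take j ts @ drop (Suc j) ts \<in> tuples V (p + q - 1)"
        using that set_take_subset[of j ts] set_drop_subset[of "Suc j" ts] by (auto simp: tuples_def)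
    qed
    moreover have "inj_on ?f (N i j)"
    proof (rule inj_onI)
      fix x y assume x: "x \<in> N i j" and y: "y \<in> N i j" and e: "?f x = ?f y"
      have l: "length x = p + q" "length y = p + q" using x y by (auto simp: N_def tuples_def)
      then have tk: "take j x = take j y" and dr: "drop (Suc j) x = drop (Suc j) y"
        using e that by auto
      have "x ! i = y ! i" using tk that by (metis nth_take)
      then have "x ! j = y ! j" using x y by (simp add: N_def)
      moreover have "x = take j x @ x ! j # drop (Suc j) x" "y = take j y @ y ! j # drop (Suc j) y"
        using l that by (simp_all add: id_take_nth_drop)
      ultimately show "x = y" using tk dr by metis
    qed
    ultimately show ?thesis
      using card_inj_on_le[of ?f "N i j" "tuples V (p + q - 1)"] V by (simp add: card_tuples)
  qed
  have "{ts \<in> tuples V (p + q). \<not> distinct (take p ts)} \<subseteq> (\<Union>(i, j)\<in>{(i, j). i < j \<and> j < p}. N i j)"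
  proof
    fix ts assume ts: "ts \<in> {ts \<in> tuples V (p + q). \<not> distinct (take p ts)}"
    then obtain i j where "i < length (take p ts)" "j < length (take p ts)" "i \<noteq> j" "take p ts ! i = take p ts ! j"
      unfolding distinct_conv_nth by blast
    then have "\<exists>i j. i < j \<and> j < p \<and> ts ! i = ts ! j"
      by (cases "i < j") (auto intro: exI[of _ i] exI[of _ j], metis linorder_neqE_nat)
    then show "ts \<in> (\<Union>(i, j)\<in>{(i, j). i < j \<and> j < p}. N i j)" using ts by (auto simp: N_def)
  qed
  moreover have fin: "finite {(i, j). i < j \<and> j < p}"
    by (rule finite_subset[of _ "{..<p} \<times> {..<p}"]) auto
  ultimately have "card {ts \<in> tuples V (p + q). \<not> distinct (take p ts)} \<le> card (\<Union>(i, j)\<in>{(i, j). i < j \<and> j < p}. N i j)"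
    using V by (intro card_mono) (auto simp: N_def)
  also have "\<dots> \<le> (\<Sum>(i, j)\<in>{(i, j). i < j \<and> j < p}. card (N i j))"
    using card_UN_le[OF fin, of "\<lambda>(i, j). N i j"] by (simp add: case_prod_unfold)
  also have "\<dots> \<le> (\<Sum>(i, j)\<in>{(i, j). i < j \<and> j < p}. card V ^ (p + q - 1))"
    using N by (intro sum_mono) auto
  also have "\<dots> = card {(i, j). i < j \<and> j < p} * card V ^ (p + q - 1)" by simp
  also have "card {(i, j). i < j \<and> j < p} \<le> card ({..<p} \<times> {..<p})"
    by (rule card_mono) auto
  finally show ?thesis by (simp add: power2_eq_square card_cartesian_product)
qed

section \<open>Segments of the path\<close>
lemma mult_add_div_mod:
  fixes a p D :: nat
  assumes "p < D"
  shows "(a * D + p) div D = a" "(a * D + p) mod D = p"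
  using assms by simp_all

lemma mult_add_less_cancel:
  fixes a b p q D :: nat
  assumes "a * D + p = b * D + q" "p < D" "q < D"
  shows "a = b" "p = q"
proof -
  have "a = (a * D + p) div D" "b = (b * D + q) div D" using assms(2,3) by simp_all
  then show "a = b" using assms(1) by simp
  then show "p = q" using assms(1) by simp
qed

lemma slot_ge: "0 < m \<Longrightarrow> \<not> slot m l < m \<Longrightarrow> slot m l = m + l"
  by (metis slot_def slot_less_iff)

lemma slot_small: "0 < m \<Longrightarrow> slot m l < m \<Longrightarrow> slot m l = l mod m"
  by (metis slot_def slot_less_iff)

lemma sum_lessThan_mult:
  fixes g :: "nat \<Rightarrow> 'a :: comm_monoid_add"
  shows "(\<Sum>i<a * b. g i) = (\<Sum>s<b. \<Sum>j<a. g (a * s + j))"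
proof (induction b)
  case (Suc b)
  have "(\<Sum>i<a * Suc b. g i) = (\<Sum>i<a * b. g i) + (\<Sum>i=a * b..<a * b + a. g i)"
    by (simp add: add.commute lessThan_atLeast0 sum.atLeastLessThan_concat)
  also have "(\<Sum>i=a * b..<a * b + a. g i) = (\<Sum>j<a. g (a * b + j))"
    using sum.shift_bounds_nat_ivl[of g 0 "a * b" a] by (simp add: lessThan_atLeast0 add.commute)
  finally show ?case using Suc by simp
qed simp

lemma sum_lessThan_double:
  fixes g :: "nat \<Rightarrow> 'a :: comm_monoid_add"
  shows "(\<Sum>i<2 * b. g i) = (\<Sum>i<b. g (2 * i)) + (\<Sum>i<b. g (2 * i + 1))"
  by (induction b) (simp_all add: ac_simps)

text \<open>
  Each coordinate has \<open>2 * r\<close> copies, that is, \<open>r\<close> pairs. The walk uses pair number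
  \<open>P\<close> of a coordinate in its period \<open>P\<close>, so that no pair is used twice.
\<close>
definition segments :: "'a edges \<Rightarrow> nat \<Rightarrow> 'a set \<Rightarrow> 'a list \<Rightarrow> 'a list set \<Rightarrow> nat \<Rightarrow> 'a list set" where
  "segments G m W E \<B> r = {ts \<in> blow_up (2 * r) (m * (m + 2)) (patterns G m W E \<B>).
     distinct (take (2 * (r * (m * (m + 2))) + m) ts)}"

text \<open>
  For large \<open>V\<close>, tuples with repeated vertices are rare compared to the positive density of the
  blow-up of the patterns.
\<close>
lemma segments_dense:
  fixes \<epsilon> \<omega> c :: real
  assumes m: "0 < m" "0 < r" and \<epsilon>: "0 < \<epsilon>" "\<epsilon> \<le> 1 / real m" and "0 < \<omega>" "0 < c"
  shows "\<exists>\<gamma>>0. \<exists>n0. \<forall>G (V :: 'a set) W E \<B>. n0 \<le> card V \<longrightarrow> finite V \<longrightarrow> W \<subseteq> V \<longrightarrow> E \<in> tuples V m \<longrightarrow>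
     min_density G V W (1 - 1 / real m + \<epsilon>) \<longrightarrow> real (card W) \<ge> \<omega> * real (card V) \<longrightarrow>
     \<B> \<subseteq> tuples V (m + 1) \<longrightarrow> real (card \<B>) \<ge> c * real (card V) ^ (m + 1) \<longrightarrow>
     segments G m W E \<B> r \<subseteq> tuples V (2 * (r * (m * (m + 2))) + (m + 1)) \<and>
     real (card (segments G m W E \<B> r)) \<ge> \<gamma> * real (card V) ^ (2 * (r * (m * (m + 2))) + (m + 1))"
proof -
  define h where "h = m * (m + 2)"
  define c1 where "c1 = c * (\<epsilon> * \<omega>) ^ h"
  have "c1 > 0" using assms by (simp add: c1_def)
  obtain c2 where c2: "c2 > 0" and blow: "\<And>(V :: 'a set) T. finite V \<Longrightarrow> V \<noteq> {} \<Longrightarrow> T \<subseteq> tuples V (h + (m + 1)) \<Longrightarrow>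
           real (card T) \<ge> c1 * real (card V) ^ (h + (m + 1)) \<Longrightarrow>
           real (card (blow_up (2 * r) h T)) \<ge> c2 * real (card V) ^ (2 * r * h + (m + 1))"
    using dense_blow_up[OF \<open>c1 > 0\<close>, of "2 * r" h "m + 1"] m(2) by auto
  define p where "p = 2 * (r * h) + m"
  define n0 where "n0 = Suc (nat \<lceil>2 * (real p)\<^sup>2 / c2\<rceil>)"
  show ?thesis
  proof (intro exI[of _ "c2 / 2"] conjI exI[of _ n0] allI impI)
    show "c2 / 2 > 0" using c2 by simp
    fix G and V :: "'a set" and W E \<B>
    assume n0: "n0 \<le> card V" and V: "finite V" "W \<subseteq> V" and E: "E \<in> tuples V m"
      and dens: "min_density G V W (1 - 1 / real m + \<epsilon>)" "real (card W) \<ge> \<omega> * real (card V)"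
      and \<B>: "\<B> \<subseteq> tuples V (m + 1)" "real (card \<B>) \<ge> c * real (card V) ^ (m + 1)"
    define n where "n = real (card V)"
    have "V \<noteq> {}" using n0 by (auto simp: n0_def)
    have E': "set E \<subseteq> V" "length E = m" using E by (auto simp: tuples_def)
    note pat = patterns_dense[OF dens(1) V E' m(1) \<epsilon> dens(2) \<open>0 < \<omega>\<close> \<B> \<open>0 < c\<close>, folded h_def, folded c1_def]
    define Bl where "Bl = blow_up (2 * r) h (patterns G m W E \<B>)"
    have Bl: "Bl \<subseteq> tuples V (p + 1)" "real (card Bl) \<ge> c2 * n ^ (p + 1)"
    proof -
      have "2 * r * h + (m + 1) = p + 1" by (simp add: p_def)
      then show "Bl \<subseteq> tuples V (p + 1)" "real (card Bl) \<ge> c2 * n ^ (p + 1)"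
        using blow_up_subset[OF _ pat(1), of "2 * r"] blow[OF V(1) \<open>V \<noteq> {}\<close> pat] m(2)
        unfolding Bl_def n_def by auto
    qed
    define bad where "bad = {ts \<in> tuples V (p + 1). \<not> distinct (take p ts)}"
    have bad: "real (card bad) \<le> c2 / 2 * n ^ (p + 1)"
    proof -
      have "card bad \<le> p\<^sup>2 * card V ^ p" using card_repetitive_tuples[OF V(1), of p 1] by (simp add: bad_def)
      then have "real (card bad) \<le> real (p\<^sup>2 * card V ^ p)" by (rule of_nat_mono)
      then have "real (card bad) \<le> (real p)\<^sup>2 * n ^ p" by (simp add: n_def)
      also have "\<dots> \<le> (c2 / 2 * n) * n ^ p"
      proof (rule mult_right_mono)
        have "2 * (real p)\<^sup>2 / c2 \<le> real n0" unfolding n0_def by linarith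
        also have "\<dots> \<le> n" using n0 by (simp add: n_def)
        finally show "(real p)\<^sup>2 \<le> c2 / 2 * n" using c2 by (simp add: field_simps)
      qed (simp add: n_def)
      finally show ?thesis by (simp add: mult.assoc)
    qed
    have eq: "segments G m W E \<B> r = Bl - bad"
      using Bl(1) unfolding segments_def bad_def Bl_def p_def h_def by auto
    have "finite bad" using V(1) by (simp add: bad_def)
    then have "card Bl \<le> card (Bl - bad) + card bad"
      using diff_card_le_card_Diff[of bad Bl] by linarith
    then have "real (card Bl) \<le> real (card (Bl - bad)) + real (card bad)" by linarith
    then have "c2 / 2 * n ^ (p + 1) \<le> real (card (segments G m W E \<B> r))"
      using Bl(2) bad unfolding eq by (simp add: field_simps)
    moreover have "segments G m W E \<B> r \<subseteq> tuples V (p + 1)" using Bl(1) eq by auto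
    moreover have "p + 1 = 2 * (r * (m * (m + 2))) + (m + 1)" by (simp add: p_def h_def)
    ultimately show "segments G m W E \<B> r \<subseteq> tuples V (2 * (r * (m * (m + 2))) + (m + 1))"
      "real (card (segments G m W E \<B> r)) \<ge> c2 / 2 * real (card V) ^ (2 * (r * (m * (m + 2))) + (m + 1))"
      unfolding n_def by metis+
  qed
qed

lemma patterns_adjacent:
  assumes "ys @ [v] \<in> patterns G m W E \<B>" "m \<le> c" "c < m * (m + 3)"
  shows "ys ! c \<in> W"
    and "0 < m \<Longrightarrow> d \<in> earlier m c \<Longrightarrow> {ys ! d, ys ! c} \<in> G"
    and "c < 2 * m \<Longrightarrow> e \<in> set (drop (c - m) E) \<Longrightarrow> {e, ys ! c} \<in> G"
proof -
  have l: "length ys = m * (m + 3)" and al: "ys ! c \<in> allowed G m W E (take c ys)"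
    using assms unfolding patterns_def by auto
  then have tk: "length (take c ys) = c" using assms(3) by simp
  show "ys ! c \<in> W" using al by (simp add: allowed_def)
  show "{ys ! d, ys ! c} \<in> G" if "0 < m" "d \<in> earlier m c"
    using al that earlier_less[OF that(1) assms(2) that(2)] unfolding allowed_def tk by auto
  show "{e, ys ! c} \<in> G" if "c < 2 * m" "e \<in> set (drop (c - m) E)"
    using al that unfolding allowed_def tk by blast
qed

text \<open>
  The path can be extended beyond the clique \<open>E\<close> inside \<open>W\<close>: \<open>S\<close> leads to the
  target, \<open>Q\<close> runs around it \<open>t\<close> times, and \<open>z\<close> is a clique from which the next
  segment can start. The last three clauses express that \<open>Q\<close> consists of target cliques, in the
  forms suited to absorption, to keeping costs low, and to closing the cycle. In the first one, the
  tags in \<open>U\<close> are compatible with all of these target cliques simultaneously. In the second one,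
  each loop accounts for two target cliques, formed by the first and by the second vertices of its
  pairs.
\<close>
definition has_segment ::
    "'a edges \<Rightarrow> 'a edges \<Rightarrow> 'a set \<Rightarrow> nat \<Rightarrow> nat \<Rightarrow> real \<Rightarrow> 'a set \<Rightarrow> 'a list \<Rightarrow> 'a list set \<Rightarrow> bool" where
  "has_segment G R V m t g W E \<B> \<longleftrightarrow> (\<exists>S Q z U. length S = 2 * m * (m + 1) \<and> length Q = 2 * m * t \<and> length z = m \<and>
     distinct (S @ Q @ z) \<and> set (S @ Q @ z) \<subseteq> W \<and> power_path m (G \<union> R) (E @ S @ Q @ z) \<and>
     U \<subseteq> V \<and> real (card U) \<ge> g * real (card V) \<and>
     (\<forall>x\<in>set Q. \<forall>v\<in>U. \<exists>B. B @ [v] \<in> \<B> \<and> length B = m \<and> x \<in> set B) \<and>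
     (\<forall>(f :: 'a \<Rightarrow> real) b. (\<forall>B v. B @ [v] \<in> \<B> \<longrightarrow> length B = m \<longrightarrow> sum_list (map f B) \<le> b) \<longrightarrow> sum_list (map f Q) \<le> 2 * real t * b) \<and>
     (\<forall>i<2 * m. \<exists>B v. B @ [v] \<in> \<B> \<and> length B = m \<and> Q ! (2 * m * (t - 1) + i) = B ! (i div 2)))"

text \<open>
  Choose the pairs as edges of \<open>R\<close> from the tuples in \<open>T\<close>. The completions that remain
  consist of the final clique and the tag; a popular final clique leaves a linear number of tags.
\<close>
lemma segment_exists:
  assumes m: "2 \<le> m" and t: "1 \<le> t" and V: "finite V" "V \<noteq> {}" and E: "length E = m" "power_path m (G \<union> R) E"
    and clique: "\<And>B v. B @ [v] \<in> \<B> \<Longrightarrow> length B = m \<Longrightarrow> set B \<subseteq> W \<and> (\<forall>i j. i < j \<longrightarrow> j < m \<longrightarrow> {B ! i, B ! j} \<in> G)"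
    and a: "a = (m + 1 + t) * (m * (m + 2))"
    and T: "T = segments G m W (E :: 'a list) \<B> (m + 1 + t)" "T \<subseteq> tuples V (2 * a + (m + 1))"
    and dense: "real (card T) \<ge> \<gamma> * real (card V) ^ (2 * a + (m + 1))" "0 < \<gamma>"
    and hit: "\<And>Q. Q \<in> queries V a (m + 1) \<gamma> T \<Longrightarrow> R \<inter> Q \<noteq> {}"
  shows "has_segment G R V m t (\<gamma> / 2 ^ (a + 1)) W E \<B>"
proof -
  define h r n where "h = m * (m + 2)" and "r = m + 1 + t" and "n = real (card V)"
  have n: "n > 0" using V by (simp add: n_def card_gt_0_iff)
  have a': "a = r * h" by (simp add: a h_def r_def)
  have h3: "m * (m + 3) = h + m" by (simp add: h_def algebra_simps)
  have mh: "2 * m \<le> h" using m by (simp add: h_def)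
  have T_distinct: "distinct (take (2 * a) ts)" if "ts \<in> T" for ts
  proof -
    have "distinct (take (2 * (r * h) + m) ts)" using that T(1) by (simp add: segments_def r_def h_def)
    then have "distinct (take (2 * a) (take (2 * (r * h) + m) ts))" by (rule distinct_take)
    then show ?thesis by (simp add: a' min_def)
  qed
  obtain X where X: "X \<in> tuples V (2 * a)" "\<And>j. j < a \<Longrightarrow> {X ! (2 * j), X ! (2 * j + 1)} \<in> R"
    and ext: "real (card {zs. X @ zs \<in> T}) \<ge> \<gamma> / 2 ^ a * n ^ (m + 1)"
    using paired_prefix_exists[OF V dense(2) T(2) T_distinct dense(1) hit] unfolding n_def by blast
  define Z where "Z = {zs. X @ zs \<in> T}"
  have Z: "Z \<subseteq> tuples V (m + 1)" unfolding Z_def by (rule extensions_subset[OF T(2) X(1)])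
  have "real (card {z \<in> tuples V m. real (card {ys. z @ ys \<in> Z}) \<ge> \<gamma> / 2 ^ a / 2 * n ^ 1}) \<ge> \<gamma> / 2 ^ a / 2 * n ^ m"
    using card_popular_prefixes[OF V Z, of "\<gamma> / 2 ^ a"] ext unfolding n_def Z_def by blast
  moreover have "\<gamma> / 2 ^ a / 2 * n ^ m > 0" using n dense(2) by simp
  ultimately have "{z \<in> tuples V m. real (card {ys. z @ ys \<in> Z}) \<ge> \<gamma> / 2 ^ a / 2 * n ^ 1} \<noteq> {}"
    by (metis card.empty of_nat_0 not_less)
  then obtain z where z: "z \<in> tuples V m" "real (card {ys. z @ ys \<in> Z}) \<ge> \<gamma> / 2 ^ a / 2 * n" by auto
  have lz: "length z = m" using z(1) by (simp add: tuples_def)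
  define U where "U = {v. z @ [v] \<in> Z}"
  have "{ys. z @ ys \<in> Z} = (\<lambda>v. [v]) ` U"
  proof (intro set_eqI iffI)
    fix ys assume ys: "ys \<in> {ys. z @ ys \<in> Z}"
    then have "z @ ys \<in> tuples V (m + 1)" using Z by blast
    then have "length ys = Suc 0" using lz by (simp add: tuples_def)
    then obtain v where "ys = [v]" by (auto simp: length_Suc_conv)
    then show "ys \<in> (\<lambda>v. [v]) ` U" using ys by (simp add: U_def)
  qed (auto simp: U_def)
  then have "card {ys. z @ ys \<in> Z} = card U" by (simp add: card_image inj_on_def)
  then have U_card: "real (card U) \<ge> \<gamma> / 2 ^ (a + 1) * n" using z(2) by simp
  have UV: "U \<subseteq> V" using Z by (auto simp: U_def tuples_def)
  have "\<gamma> / 2 ^ (a + 1) * n > 0" using n dense(2) by simp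
  then have "real (card U) > 0" using U_card by linarith
  then have "U \<noteq> {}" by (metis card.empty of_nat_0 less_irrefl)
  have lX: "length X = 2 * r * h" using X(1) by (simp add: tuples_def a')
  have in_T: "X @ z @ [v] \<in> T" if "v \<in> U" for v using that by (simp add: U_def Z_def)
  have dist: "distinct (X @ z)"
  proof -
    obtain v where "v \<in> U" using \<open>U \<noteq> {}\<close> by blast
    from in_T[OF this] have "distinct (take (2 * (r * h) + m) (X @ z @ [v]))"
      using T(1) by (simp add: segments_def r_def h_def)
    then show ?thesis using lX lz by simp
  qed
  have transversal: "map (\<lambda>c. X ! (c * (2 * r) + \<sigma> c)) [0..<h] @ z @ [v] \<in> patterns G m W E \<B>"
    if "v \<in> U" "\<And>c. c < h \<Longrightarrow> \<sigma> c < 2 * r" for v \<sigma>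
  proof -
    have "X @ z @ [v] \<in> blow_up (2 * r) h (patterns G m W E \<B>)"
      using in_T[OF that(1)] T(1) by (simp add: segments_def r_def h_def)
    then obtain X' zs where e: "X @ z @ [v] = X' @ zs" "length X' = 2 * r * h"
      and tr: "\<forall>\<sigma>. (\<forall>c<h. \<sigma> c < 2 * r) \<longrightarrow> map (\<lambda>c. X' ! (c * (2 * r) + \<sigma> c)) [0..<h] @ zs \<in> patterns G m W E \<B>"
      unfolding blow_up_def by blast
    have "X' = X" "zs = z @ [v]" using e lX by auto
    then show ?thesis using tr that(2) by blast
  qed
  define vx where "vx c p = X ! (c * (2 * r) + p)" for c p
  have pick: "\<exists>ys v. ys @ [v] \<in> patterns G m W E \<B> \<and> length ys = h + m \<and> ys ! c = vx c p \<and> ys ! c' = vx c' p' \<and> (\<forall>i<m. ys ! (h + i) = z ! i)"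
    if "c < h" "c' < h" "c \<noteq> c'" "p < 2 * r" "p' < 2 * r" for c c' p p'
  proof -
    obtain v where v: "v \<in> U" using \<open>U \<noteq> {}\<close> by blast
    define \<sigma> where "\<sigma> = (\<lambda>_. 0)(c := p, c' := p')"
    define ys where "ys = map (\<lambda>c. X ! (c * (2 * r) + \<sigma> c)) [0..<h] @ z"
    have "ys @ [v] \<in> patterns G m W E \<B>"
      using transversal[OF v, of \<sigma>] that by (simp add: ys_def \<sigma>_def)
    moreover have "ys ! c = vx c p" "ys ! c' = vx c' p'"
      using that by (auto simp: ys_def \<sigma>_def vx_def nth_append)
    moreover have "\<forall>i<m. ys ! (h + i) = z ! i" by (simp add: ys_def nth_append)
    moreover have "length ys = h + m" by (simp add: ys_def lz)
    ultimately show ?thesis by blast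
  qed
  have h1: "1 < h" "m < h" using m mh by auto
  have G_slots: "{vx d p, vx c p'} \<in> G" if asm: "m \<le> c" "c < h" "d \<in> earlier m c" "p < 2 * r" "p' < 2 * r" for c d p p'
  proof -
    have "d < c" using earlier_less[OF _ asm(1,3)] m by simp
    then obtain ys v where "ys @ [v] \<in> patterns G m W E \<B>" "ys ! d = vx d p" "ys ! c = vx c p'"
      using pick[of d c p p'] asm by auto
    then show ?thesis using patterns_adjacent(2)[of ys v G m W E \<B> c d] asm m h3 by auto
  qed
  have B_pat: "length (take m ys) = m \<and> take m ys @ [v] \<in> \<B>" if "ys @ [v] \<in> patterns G m W E \<B>" for ys v
    using that m unfolding patterns_def by auto
  have G_B: "{vx c p, vx c' p'} \<in> G" if asm: "c < m" "c' < m" "c \<noteq> c'" "p < 2 * r" "p' < 2 * r" for c c' p p'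
  proof -
    obtain ys v where ys: "ys @ [v] \<in> patterns G m W E \<B>" "ys ! c = vx c p" "ys ! c' = vx c' p'"
      using pick[of c c' p p'] asm h1 by auto
    from clique[of "take m ys" v] B_pat[OF ys(1)]
    have "\<forall>i j. i < j \<longrightarrow> j < m \<longrightarrow> {ys ! i, ys ! j} \<in> G" by auto
    then have "{ys ! c, ys ! c'} \<in> G" using asm by (metis insert_commute linorder_neqE_nat)
    then show ?thesis using ys by simp
  qed
  have other: "\<exists>c'<h. c' \<noteq> c" for c using h1 by (metis less_trans zero_less_one zero_neq_one)
  have vx_W: "vx c p \<in> W" if asm: "c < h" "p < 2 * r" for c p
  proof -
    obtain c' where c': "c' < h" "c' \<noteq> c" using other by blast
    obtain ys v where ys: "ys @ [v] \<in> patterns G m W E \<B>" "ys ! c = vx c p" "length ys = h + m"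
      using pick[of c c' p p] asm c' by auto
    show ?thesis
    proof (cases "c < m")
      case True
      then have "vx c p \<in> set (take m ys)"
        using ys asm by (metis in_set_conv_nth length_take min_less_iff_conj nth_take trans_less_add1)
      then show ?thesis using clique[of "take m ys" v] B_pat[OF ys(1)] by blast
    next
      case False
      then show ?thesis using patterns_adjacent(1)[OF ys(1), of c] ys(2) asm h3 by auto
    qed
  qed
  have z_nth: "\<exists>ys v. ys @ [v] \<in> patterns G m W E \<B> \<and> (\<forall>i<m. ys ! (h + i) = z ! i)"
    using pick[of 0 1 0 0] h1 r_def by auto
  have z_W: "set z \<subseteq> W"
  proof
    fix x assume "x \<in> set z"
    then obtain i where i: "i < m" "x = z ! i" using lz by (metis in_set_conv_nth)
    obtain ys v where "ys @ [v] \<in> patterns G m W E \<B>" "ys ! (h + i) = z ! i" using z_nth i by blast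
    then show "x \<in> W" using patterns_adjacent(1)[of ys v G m W E \<B> "h + i"] i h3 mh by auto
  qed
  have e_h: "earlier m (h + j) = {j..<m} \<union> {h..<h + j}" if "j < m" for j
    using mh that by (simp add: earlier_def h_def)
  have z_z: "{z ! i, z ! j} \<in> G" if "i < j" "j < m" for i j
  proof -
    obtain ys v where ys: "ys @ [v] \<in> patterns G m W E \<B>" "\<forall>i<m. ys ! (h + i) = z ! i" using z_nth by blast
    have "{ys ! (h + i), ys ! (h + j)} \<in> G"
      by (rule patterns_adjacent(2)[OF ys(1)]) (use that h3 mh m e_h in auto)
    then show ?thesis using ys(2) that by auto
  qed
  have B_z: "{vx d p, z ! j} \<in> G" if asm: "j \<le> d" "d < m" "p < 2 * r" for d j p
  proof -
    obtain c' where c': "c' < h" "c' \<noteq> d" using other by blast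
    obtain ys v where ys: "ys @ [v] \<in> patterns G m W E \<B>" "ys ! d = vx d p" "\<forall>i<m. ys ! (h + i) = z ! i"
      using pick[of d c' p p] asm c' h1 by auto
    have "{ys ! d, ys ! (h + j)} \<in> G"
      by (rule patterns_adjacent(2)[OF ys(1)]) (use asm h3 mh m e_h in auto)
    then show ?thesis using ys asm by auto
  qed
  have E_A: "{e, vx (m + l) p} \<in> G" if asm: "l < m" "e \<in> set (drop l E)" "p < 2 * r" for e l p
  proof -
    obtain ys v where ys: "ys @ [v] \<in> patterns G m W E \<B>" "ys ! (m + l) = vx (m + l) p"
      using pick[of "m + l" 0 p 0] asm h1 mh r_def by auto
    show ?thesis using patterns_adjacent(3)[OF ys(1), of "m + l" e] asm ys(2) h3 mh m by auto
  qed
  define N where "N = 2 * m * r"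
  \<comment> \<open>Entry \<open>l\<close> of the walk contributes the copies \<open>2 * (l div m)\<close> and \<open>2 * (l div m) + 1\<close> of its coordinate.\<close>
  define P where "P = map (\<lambda>i. vx (slot m (i div 2)) (2 * (i div 2 div m) + i mod 2)) [0..<N]"
  have lP: "length P = N" by (simp add: P_def)
  have P_nth: "P ! i = vx (slot m (i div 2)) (2 * (i div 2 div m) + i mod 2)" if "i < N" for i
    using that by (simp add: P_def)
  have slot_h: "slot m l < h" for l using slot_less[of m l] m by (simp add: h_def)
  have idx: "2 * (i div 2 div m) + i mod 2 < 2 * r" if "i < N" for i
  proof -
    have "i div 2 < r * m" using that by (simp add: N_def less_mult_imp_div_less algebra_simps)
    then have "i div 2 div m < r" by (rule less_mult_imp_div_less)
    moreover have "i mod 2 < 2" by simp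
    ultimately show ?thesis by linarith
  qed
  have P_P: "{P ! i, P ! j} \<in> G \<union> R" if ij: "i < j" "j < N" "j \<le> i + m" for i j
  proof (cases "i div 2 = j div 2")
    case True
    define l where "l = i div 2"
    have i: "i = 2 * l" and j: "j = 2 * l + 1" using True ij(1) unfolding l_def by presburger+
    define q where "q = slot m l * r + l div m"
    have "l div m < r" using idx[of j] j ij by (simp add: l_def)
    then have "q < Suc (slot m l) * r" by (simp add: q_def)
    also have "\<dots> \<le> h * r" using slot_h[of l] by (intro mult_le_mono1) (simp add: Suc_le_eq)
    finally have "q < h * r" .
    then have "{X ! (2 * q), X ! (2 * q + 1)} \<in> R" using X(2)[of q] by (simp add: a' mult.commute)
    moreover have ij2: "i div 2 = l" "i mod 2 = 0" "j div 2 = l" "j mod 2 = 1" using i j by auto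
    have "P ! i = vx (slot m l) (2 * (l div m))" "P ! j = vx (slot m l) (2 * (l div m) + 1)"
      using P_nth[of i] P_nth[of j] ij unfolding ij2 by simp_all
    then have "P ! i = X ! (2 * q)" "P ! j = X ! (2 * q + 1)"
      by (simp_all add: vx_def q_def algebra_simps)
    ultimately show ?thesis by simp
  next
    case False
    define l l' where "l = i div 2" and "l' = j div 2"
    have "l < l'" using False ij(1) unfolding l_def l'_def by linarith
    moreover have "l' \<le> l + (m - 1)" using ij(3) m unfolding l_def l'_def by linarith
    ultimately consider "slot m l < m" "slot m l' < m" "slot m l \<noteq> slot m l'"
      | "m \<le> slot m l'" "slot m l \<in> earlier m (slot m l')"
      | "m \<le> slot m l" "slot m l' \<in> earlier m (slot m l)"
      using slots_related[OF m] by blast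
    then have "{P ! i, P ! j} \<in> G"
    proof cases
      case 1
      then show ?thesis using G_B idx[of i] idx[of j] ij by (simp add: P_nth l_def l'_def)
    next
      case 2
      then show ?thesis using G_slots slot_h idx[of i] idx[of j] ij by (simp add: P_nth l_def l'_def)
    next
      case 3
      then show ?thesis using G_slots[of "slot m l" "slot m l'"] slot_h idx[of i] idx[of j] ij
        by (simp add: P_nth l_def l'_def insert_commute)
    qed
    then show ?thesis by simp
  qed
  have mN: "2 * m \<le> N" using t by (simp add: N_def r_def)
  have EP: "power_path m (G \<union> R) (E @ P)"
    unfolding power_path_iff_nth
  proof (intro allI impI)
    fix i j assume ij: "i < j" "j < length (E @ P)" "j \<le> i + m"
    consider "j < m" | "i < m" "m \<le> j" | "m \<le> i" by linarith
    then show "{(E @ P) ! i, (E @ P) ! j} \<in> G \<union> R"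
    proof cases
      case 1
      then show ?thesis using E ij unfolding power_path_iff_nth by (simp add: nth_append)
    next
      case 2
      define b where "b = j - m"
      have b: "b \<le> i" "b < N" using ij 2 E lP by (auto simp: b_def)
      have "slot m (b div 2) = m + b div 2" using b 2 by (simp add: slot_def)
      moreover have "E ! i \<in> set (drop (b div 2) E)"
      proof -
        have "E ! i = drop (b div 2) E ! (i - b div 2)" "i - b div 2 < length (drop (b div 2) E)"
          using b 2 E by auto
        then show ?thesis by (metis nth_mem)
      qed
      ultimately have "{E ! i, P ! b} \<in> G" using E_A[of "b div 2" "E ! i"] b 2 idx[of b] by (simp add: P_nth)
      then show ?thesis using 2 E by (simp add: nth_append b_def)
    next
      case 3
      then show ?thesis using P_P[of "i - m" "j - m"] ij E lP by (simp add: nth_append)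
    qed
  qed
  have Pz: "power_path m (G \<union> R) (P @ z)"
    unfolding power_path_iff_nth
  proof (intro allI impI)
    fix i j assume ij: "i < j" "j < length (P @ z)" "j \<le> i + m"
    consider "j < N" | "i < N" "N \<le> j" | "N \<le> i" by linarith
    then show "{(P @ z) ! i, (P @ z) ! j} \<in> G \<union> R"
    proof cases
      case 1
      then show ?thesis using P_P ij lP by (simp add: nth_append)
    next
      case 2
      define b where "b = j - N"
      have b: "b < m" using ij lz lP 2 by (auto simp: b_def)
      have ge: "N + b \<le> i + m" using ij 2 by (simp add: b_def)
      define l where "l = i div 2"
      have l: "l < m * r" "m * r + b \<le> l + m" using 2 ge b unfolding l_def N_def by linarith+
      define d where "d = l - (m + t) * m"
      have "m * r = (m + t) * m + m" by (simp add: r_def algebra_simps)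
      then have d: "l = (m + t) * m + d" "d < m" "b \<le> d" using l by (simp_all add: d_def)
      then have "l div m = m + t" "l mod m = d" by simp_all
      then have "slot m l = d" using t by (simp add: slot_def)
      then have "{P ! i, z ! b} \<in> G" using B_z[of b d] d idx[of i] 2 by (simp add: P_nth l_def)
      then show ?thesis using 2 lP by (simp add: nth_append b_def)
    next
      case 3
      then show ?thesis using z_z[of "i - N" "j - N"] ij lP lz by (simp add: nth_append)
    qed
  qed
  have path: "power_path m (G \<union> R) (E @ P @ z)"
    by (rule power_path_glue[OF EP Pz]) (use mN lP m in auto)
  have P_inj: "i = j" if "P ! i = P ! j" "i < N" "j < N" for i j
  proof -
    define p where "p i = 2 * (i div 2 div m) + i mod 2" for i :: nat
    have bound: "slot m (i div 2) * (2 * r) + p i < length X" if "i < N" for i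
    proof -
      have "slot m (i div 2) * (2 * r) + p i < Suc (slot m (i div 2)) * (2 * r)"
        using idx[OF that] by (simp add: p_def)
      also have "\<dots> \<le> h * (2 * r)" using slot_h[of "i div 2"] by (intro mult_le_mono1) simp
      finally show ?thesis using lX by (simp add: mult.commute mult.left_commute)
    qed
    have "X ! (slot m (i div 2) * (2 * r) + p i) = X ! (slot m (j div 2) * (2 * r) + p j)"
      using that by (simp add: P_nth vx_def p_def)
    then have e: "slot m (i div 2) * (2 * r) + p i = slot m (j div 2) * (2 * r) + p j"
      using dist bound that nth_eq_iff_index_eq[of X] by auto
    have "p i < 2 * r" "p j < 2 * r" using idx that by (simp_all add: p_def)
    then have s: "slot m (i div 2) = slot m (j div 2)" and p: "p i = p j"
      using mult_add_less_cancel[OF e] by simp_all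
    from p have "i div 2 div m = j div 2 div m" "i mod 2 = j mod 2"
      using mult_add_less_cancel[of "i div 2 div m" 2 "i mod 2" "j div 2 div m" "j mod 2"]
      unfolding p_def by (simp_all add: mult.commute)
    moreover have "i div 2 = j div 2"
    proof -
      have "i div 2 mod m = j div 2 mod m \<or> i div 2 = j div 2"
      proof (cases "slot m (i div 2) < m")
        case True
        then have "slot m (i div 2) = i div 2 mod m" "slot m (j div 2) = j div 2 mod m"
          using slot_small[of m "i div 2"] slot_small[of m "j div 2"] True s m by simp_all
        then show ?thesis using s by argo
      next
        case False
        then have "slot m (i div 2) = m + i div 2" "slot m (j div 2) = m + j div 2"
          using slot_ge[of m "i div 2"] slot_ge[of m "j div 2"] False s m by simp_all
        with s have "m + i div 2 = m + j div 2" by argo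
        then show ?thesis by simp
      qed
      then show ?thesis using \<open>i div 2 div m = j div 2 div m\<close> by (metis div_mult_mod_eq)
    qed
    ultimately show ?thesis by (metis div_mult_mod_eq)
  qed
  have P_X: "set P \<subseteq> set X"
  proof
    fix x assume "x \<in> set P"
    then obtain i where i: "i < N" "x = P ! i" using lP by (metis in_set_conv_nth)
    have "slot m (i div 2) * (2 * r) + (2 * (i div 2 div m) + i mod 2) < Suc (slot m (i div 2)) * (2 * r)"
      using idx[OF i(1)] by simp
    also have "\<dots> \<le> h * (2 * r)" using slot_h[of "i div 2"] by (intro mult_le_mono1) simp
    finally have "slot m (i div 2) * (2 * r) + (2 * (i div 2 div m) + i mod 2) < length X"
      using lX by (simp add: mult.commute mult.left_commute)
    then show "x \<in> set X" using i by (simp add: P_nth vx_def)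
  qed
  have "distinct P" using P_inj lP unfolding distinct_conv_nth by metis
  then have distPz: "distinct (P @ z)" using dist P_X by auto
  have P_W: "set P \<subseteq> W"
  proof
    fix x assume "x \<in> set P"
    then obtain i where i: "i < N" "x = P ! i" using lP by (metis in_set_conv_nth)
    then show "x \<in> W" using vx_W[OF slot_h idx[OF i(1)]] by (simp add: P_nth)
  qed
  define S Q where "S = take (2 * m * (m + 1)) P" and "Q = drop (2 * m * (m + 1)) P"
  have SQ: "P = S @ Q" by (simp add: S_def Q_def)
  have N_eq: "N = 2 * m * (m + 1) + 2 * m * t" by (simp add: N_def r_def algebra_simps)
  have lS: "length S = 2 * m * (m + 1)" and lQ: "length Q = 2 * m * t"
    using lP N_eq by (simp_all add: S_def Q_def)
  define loop where "loop p = map (\<lambda>i. vx i p) [0..<m]" for p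
  have loop: "loop p @ [v] \<in> \<B>" "length (loop p) = m" if "p < 2 * r" "v \<in> U" for p v
  proof -
    have "map (\<lambda>c. X ! (c * (2 * r) + p)) [0..<h] @ z @ [v] \<in> patterns G m W E \<B>"
      using transversal[OF that(2), of "\<lambda>_. p"] that(1) by simp
    then have "take m (map (\<lambda>c. X ! (c * (2 * r) + p)) [0..<h] @ z) @ [v] \<in> \<B>"
      using B_pat[of "map (\<lambda>c. X ! (c * (2 * r) + p)) [0..<h] @ z" v] by simp
    moreover have "take m (map (\<lambda>c. X ! (c * (2 * r) + p)) [0..<h] @ z) = loop p"
      using h1 by (simp add: loop_def vx_def take_map)
    ultimately show "loop p @ [v] \<in> \<B>" by (simp only:)
  qed (simp add: loop_def)
  have Q_nth: "Q ! (2 * m * s + i) = loop (2 * (m + 1 + s) + i mod 2) ! (i div 2)" if "s < t" "i < 2 * m" for s i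
  proof -
    have "Suc s * (2 * m) \<le> t * (2 * m)" using that by (intro mult_le_mono1) simp
    then have b: "2 * m * s + i < 2 * m * t" using that by (simp add: algebra_simps)
    define k where "k = 2 * m * (m + 1) + (2 * m * s + i)"
    have "Q ! (2 * m * s + i) = P ! k" using b lQ lP N_eq by (simp add: Q_def k_def)
    moreover have "k < N" using b N_eq by (simp add: k_def)
    moreover have k2: "k div 2 = (m + 1 + s) * m + i div 2"
    proof -
      have "k = 2 * ((m + 1 + s) * m) + i" by (simp add: k_def algebra_simps)
      then show ?thesis by simp
    qed
    moreover have "k div 2 div m = m + 1 + s" "k div 2 mod m = i div 2"
      unfolding k2 by (rule mult_add_div_mod, use that in linarith)+
    moreover have "k mod 2 = i mod 2"
    proof -
      have "k = 2 * ((m + 1 + s) * m) + i" by (simp add: k_def algebra_simps)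
      then show ?thesis by (simp only: mod_mult_self4)
    qed
    ultimately have "Q ! (2 * m * s + i) = vx (i div 2) (2 * (m + 1 + s) + i mod 2)"
      by (simp add: P_nth slot_def)
    moreover have "i div 2 < m" using that by linarith
    ultimately show ?thesis by (simp add: loop_def)
  qed
  have p_bound: "2 * (m + 1 + s) + e < 2 * r" if "s < t" "e < 2" for s e using that by (simp add: r_def)
  have U_ex: "\<exists>v. v \<in> U" using \<open>U \<noteq> {}\<close> by blast
  show ?thesis
    unfolding has_segment_def
  proof (rule exI[of _ S], rule exI[of _ Q], rule exI[of _ z], rule exI[of _ U], intro conjI allI impI ballI)
    show "distinct (S @ Q @ z)" "power_path m (G \<union> R) (E @ S @ Q @ z)"
      using distPz path unfolding SQ by simp_all
    show "set (S @ Q @ z) \<subseteq> W" using P_W z_W unfolding SQ by auto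
    show "real (card U) \<ge> \<gamma> / 2 ^ (a + 1) * real (card V)" using U_card by (simp add: n_def)
  next
    fix x v assume "x \<in> set Q" "v \<in> U"
    then obtain k where k: "k < 2 * m * t" "x = Q ! k" using lQ by (metis in_set_conv_nth)
    define s i where "s = k div (2 * m)" and "i = k mod (2 * m)"
    have si: "s < t" "i < 2 * m" "k = 2 * m * s + i"
      using k(1) m by (simp_all add: s_def i_def less_mult_imp_div_less mult.commute)
    then have "x = loop (2 * (m + 1 + s) + i mod 2) ! (i div 2)" using Q_nth k(2) by simp
    moreover have "i div 2 < m" using si by linarith
    ultimately have "x \<in> set (loop (2 * (m + 1 + s) + i mod 2))" by (simp add: loop_def)
    moreover have "2 * (m + 1 + s) + i mod 2 < 2 * r" using p_bound[OF si(1), of "i mod 2"] by simp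
    ultimately show "\<exists>B. B @ [v] \<in> \<B> \<and> length B = m \<and> x \<in> set B" using loop \<open>v \<in> U\<close> by blast
  next
    fix f :: "'a \<Rightarrow> real" and b
    assume cost: "\<forall>B v. B @ [v] \<in> \<B> \<longrightarrow> length B = m \<longrightarrow> sum_list (map f B) \<le> b"
    have loop_cost: "sum_list (map f (loop p)) \<le> b" if "p < 2 * r" for p
      using cost loop that U_ex by blast
    have "sum_list (map f Q) = (\<Sum>k<2 * m * t. f (Q ! k))"
      by (simp add: sum_list_sum_nth lQ atLeast0LessThan)
    also have "\<dots> = (\<Sum>s<t. \<Sum>i<2 * m. f (Q ! (2 * m * s + i)))"
      using sum_lessThan_mult[of "\<lambda>k. f (Q ! k)" "2 * m" t] by simp
    also have "\<dots> = (\<Sum>s<t. \<Sum>i<2 * m. f (loop (2 * (m + 1 + s) + i mod 2) ! (i div 2)))"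
      using Q_nth by (intro sum.cong) auto
    also have "\<dots> \<le> (\<Sum>s<t. 2 * b)"
    proof (rule sum_mono)
      fix s assume "s \<in> {..<t}"
      then have s: "s < t" by simp
      have "(\<Sum>i<2 * m. f (loop (2 * (m + 1 + s) + i mod 2) ! (i div 2))) =
            (\<Sum>i<m. f (loop (2 * (m + 1 + s)) ! i)) + (\<Sum>i<m. f (loop (2 * (m + 1 + s) + 1) ! i))"
        by (simp add: sum_lessThan_double)
      also have "\<dots> = sum_list (map f (loop (2 * (m + 1 + s)))) + sum_list (map f (loop (2 * (m + 1 + s) + 1)))"
        by (simp add: sum_list_sum_nth loop_def atLeast0LessThan)
      also have "\<dots> \<le> b + b"
        using p_bound[OF s, of 0] p_bound[OF s, of 1] by (intro add_mono loop_cost) auto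
      finally show "(\<Sum>i<2 * m. f (loop (2 * (m + 1 + s) + i mod 2) ! (i div 2))) \<le> 2 * b" by simp
    qed
    finally show "sum_list (map f Q) \<le> 2 * real t * b" by simp
  next
    fix i assume i: "i < 2 * m"
    obtain v where "v \<in> U" using U_ex by blast
    have "2 * (m + 1 + (t - 1)) + i mod 2 < 2 * r" using p_bound[of "t - 1" "i mod 2"] t by simp
    then show "\<exists>B v. B @ [v] \<in> \<B> \<and> length B = m \<and> Q ! (2 * m * (t - 1) + i) = B ! (i div 2)"
      using Q_nth[of "t - 1" i] i t loop \<open>v \<in> U\<close> by (metis diff_less less_one order_less_le_trans zero_less_one)
  qed (use lS lQ lz UV in auto)
qed

section \<open>A potential function and cliques of low cost\<close>

text \<open>
  Removing path segments from the set \<open>W\<close> of unvisited vertices should not decrease the proportion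
  \<open>card (W \<inter> neighbours G v) / card W\<close> for any \<open>v\<close>. If segments were chosen at random, this
  would hold approximately by concentration of measure. The potential is the derandomized version: it
  is dominated by the vertices whose proportion is low, and it is kept small by removing vertices of
  no more than average cost, that is, vertices not adjacent to too many of the dominating ones.
\<close>
definition weight :: "real \<Rightarrow> 'a edges \<Rightarrow> 'a set \<Rightarrow> 'a \<Rightarrow> real" where
  "weight \<eta> G W v = exp (- \<eta> * (real (card (W \<inter> neighbours G v)) / real (card W)))"

definition potential :: "real \<Rightarrow> 'a edges \<Rightarrow> 'a set \<Rightarrow> 'a set \<Rightarrow> real" where
  "potential \<eta> G V W = (\<Sum>v\<in>V. weight \<eta> G W v)"

definition cost :: "real \<Rightarrow> 'a edges \<Rightarrow> 'a set \<Rightarrow> 'a set \<Rightarrow> 'a \<Rightarrow> real" where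
  "cost \<eta> G V W u = (\<Sum>v\<in>V. if u \<in> neighbours G v then weight \<eta> G W v else 0)"

lemma cost_nonneg: "0 \<le> cost \<eta> G V W u"
  unfolding cost_def by (intro sum_nonneg) (auto simp: weight_def)

lemma potential_nonneg: "0 \<le> potential \<eta> G V W"
  unfolding potential_def by (intro sum_nonneg) (auto simp: weight_def)

lemma cost_le_potential: "cost \<eta> G V W u \<le> potential \<eta> G V W"
  unfolding cost_def potential_def by (intro sum_mono) (auto simp: weight_def)

lemma sum_cost:
  assumes "finite S"
  shows "(\<Sum>u\<in>S. cost \<eta> G V W u) = (\<Sum>v\<in>V. weight \<eta> G W v * real (card (S \<inter> neighbours G v)))"
proof -
  have "(\<Sum>u\<in>S. cost \<eta> G V W u) = (\<Sum>v\<in>V. \<Sum>u\<in>S. if u \<in> neighbours G v then weight \<eta> G W v else 0)"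
    unfolding cost_def by (rule sum.swap)
  also have "\<dots> = (\<Sum>v\<in>V. \<Sum>u\<in>S \<inter> neighbours G v. weight \<eta> G W v)"
    using assms by (intro sum.cong refl sum.inter_restrict[symmetric])
  finally show ?thesis by (simp add: mult.commute)
qed

text \<open>The tail of the exponential series is dominated by a geometric series.\<close>
lemma exp_le_quadratic:
  fixes x :: real
  assumes "\<bar>x\<bar> \<le> 1"
  shows "exp x \<le> 1 + x + x\<^sup>2"
proof (cases "x \<ge> 0")
  case True
  then show ?thesis using exp_bound[of x] assms by simp
next
  case False
  define z where "z = - x"
  have z: "0 < z" "z \<le> 1" using False assms by (auto simp: z_def)
  have "1 + z \<le> exp z" by (rule exp_ge_add_one_self)
  then have "exp (- z) \<le> 1 / (1 + z)"
    using z by (simp add: exp_minus inverse_eq_divide frac_le)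
  also have "\<dots> \<le> 1 - z + z\<^sup>2"
  proof -
    have "(1 - z + z\<^sup>2) * (1 + z) = 1 + z ^ 3" by (simp add: algebra_simps power2_eq_square power3_eq_cube)
    then show ?thesis using z by (simp add: pos_divide_le_eq)
  qed
  finally show ?thesis by (simp add: z_def)
qed

text \<open>
  If \<open>T\<close> had exactly average cost, the change of the potential would vanish to first order. This
  leaves the excess \<open>\<delta>\<close> of the cost and the quadratic term.
\<close>
lemma potential_step:
  assumes fin: "finite W" and T: "T \<subseteq> W" "card T < card W"
    and \<eta>: "0 \<le> \<eta>" "\<eta> * (real (card T) / real (card W - card T)) \<le> 1"
    and cheap: "(\<Sum>u\<in>T. cost \<eta> G V W u) \<le>
       real (card T) * ((\<Sum>u\<in>W. cost \<eta> G V W u) / real (card W) + \<delta> * potential \<eta> G V W)"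
  shows "potential \<eta> G V (W - T) \<le> potential \<eta> G V W *
     (1 + \<eta> * \<delta> * (real (card T) / real (card W - card T)) + (\<eta> * (real (card T) / real (card W - card T)))\<^sup>2)"
proof -
  define s w q where "s = real (card T)" and "w = real (card W)" and "q = s / (w - s)"
  have finT: "finite T" using fin T(1) finite_subset by blast
  have ws: "w - s = real (card W - card T)" "w - s > 0" "w > 0" using T(2) by (auto simp: s_def w_def of_nat_diff)
  have q: "q = real (card T) / real (card W - card T)" "0 \<le> q" using ws by (auto simp: q_def s_def)
  define d t where "d v = real (card (W \<inter> neighbours G v))" and "t v = real (card (T \<inter> neighbours G v))" for v
  have bound: "weight \<eta> G (W - T) v \<le> weight \<eta> G W v * (1 + (\<eta> * q)\<^sup>2) +
      \<eta> / (w - s) * (weight \<eta> G W v * t v - s * (weight \<eta> G W v * d v / w))" for v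
  proof -
    have "T \<inter> neighbours G v \<subseteq> W \<inter> neighbours G v" using T(1) by auto
    then have "card ((W - T) \<inter> neighbours G v) = card (W \<inter> neighbours G v) - card (T \<inter> neighbours G v)"
      using finT fin by (subst card_Diff_subset[symmetric]) (auto intro!: arg_cong[where f = card])
    moreover have "card (T \<inter> neighbours G v) \<le> card (W \<inter> neighbours G v)"
      using T(1) fin by (intro card_mono) auto
    ultimately have dv: "real (card ((W - T) \<inter> neighbours G v)) = d v - t v" by (simp add: d_def t_def of_nat_diff)
    have cW: "real (card (W - T)) = w - s" using T fin finT ws(1) by (simp add: card_Diff_subset)
    \<comment> \<open>The increment of the exponent in the weight of \<open>v\<close>.\<close>
    define x where "x = \<eta> / (w - s) * (t v - s * (d v / w))"
    have t: "0 \<le> t v" "t v \<le> s" unfolding t_def s_def using finT by (auto intro: card_mono)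
    have r: "0 \<le> d v / w" "d v / w \<le> 1" using fin ws(3) by (auto simp: d_def w_def intro!: card_mono)
    have "s * (d v / w) \<le> s * 1" using r by (intro mult_left_mono) (auto simp: s_def)
    moreover have "0 \<le> s * (d v / w)" using r by (intro mult_nonneg_nonneg) (auto simp: s_def)
    ultimately have abs: "\<bar>t v - s * (d v / w)\<bar> \<le> s" using t by linarith
    have "\<bar>x\<bar> = \<eta> / (w - s) * \<bar>t v - s * (d v / w)\<bar>" using \<eta>(1) ws(2) by (simp add: x_def abs_mult)
    also have "\<dots> \<le> \<eta> / (w - s) * s" using abs \<eta>(1) ws(2) by (intro mult_left_mono) auto
    finally have x: "\<bar>x\<bar> \<le> \<eta> * q" by (simp add: q_def)
    then have "\<bar>x\<bar> \<le> 1" using \<eta>(2) q(1) by simp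
    have eq: "(d v - t v) / (w - s) = d v / w - (t v - s * (d v / w)) / (w - s)"
      using ws by (simp add: field_simps)
    have x_eq: "x = \<eta> * ((t v - s * (d v / w)) / (w - s))" by (simp add: x_def)
    have "- \<eta> * (A - X) = - \<eta> * A + \<eta> * X" for A X :: real by (simp add: algebra_simps)
    then have "- \<eta> * ((d v - t v) / (w - s)) = - \<eta> * (d v / w) + x"
      unfolding eq x_eq by blast
    then have "weight \<eta> G (W - T) v = exp (- \<eta> * (d v / w) + x)"
      unfolding weight_def dv cW by simp
    also have "\<dots> = weight \<eta> G W v * exp x" by (simp only: weight_def d_def w_def exp_add)
    also have "\<dots> \<le> weight \<eta> G W v * (1 + x + x\<^sup>2)"
      using exp_le_quadratic[OF \<open>\<bar>x\<bar> \<le> 1\<close>] by (intro mult_left_mono) (auto simp: weight_def)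
    also have "\<dots> \<le> weight \<eta> G W v * (1 + x + (\<eta> * q)\<^sup>2)"
    proof -
      have "\<bar>x\<bar>\<^sup>2 \<le> (\<eta> * q)\<^sup>2" using x by (intro power_mono) auto
      then show ?thesis by (intro mult_left_mono) (auto simp: weight_def)
    qed
    also have "\<dots> = weight \<eta> G W v * (1 + (\<eta> * q)\<^sup>2) + \<eta> / (w - s) * (weight \<eta> G W v * t v - s * (weight \<eta> G W v * d v / w))"
      by (simp add: x_def algebra_simps)
    finally show ?thesis .
  qed
  define \<Phi> where "\<Phi> = potential \<eta> G V W"
  have "potential \<eta> G V (W - T) \<le> (\<Sum>v\<in>V. weight \<eta> G W v * (1 + (\<eta> * q)\<^sup>2) +
      \<eta> / (w - s) * (weight \<eta> G W v * t v - s * (weight \<eta> G W v * d v / w)))"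
    unfolding potential_def using bound by (rule sum_mono)
  also have "\<dots> = \<Phi> * (1 + (\<eta> * q)\<^sup>2) +
      \<eta> / (w - s) * ((\<Sum>v\<in>V. weight \<eta> G W v * t v) - s * ((\<Sum>v\<in>V. weight \<eta> G W v * d v) / w))"
  proof -
    have "(\<Sum>v\<in>V. f v * c + K * (A v - s * (B v / w))) = (\<Sum>v\<in>V. f v) * c + K * ((\<Sum>v\<in>V. A v) - s * ((\<Sum>v\<in>V. B v) / w))"
      for K c :: real and f A B
      by (simp add: sum.distrib sum_subtractf flip: sum_distrib_left sum_distrib_right sum_divide_distrib)
    then show ?thesis unfolding \<Phi>_def potential_def .
  qed
  also have "(\<Sum>v\<in>V. weight \<eta> G W v * t v) = (\<Sum>u\<in>T. cost \<eta> G V W u)"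
    unfolding t_def using sum_cost[OF finT] by metis
  also have "(\<Sum>v\<in>V. weight \<eta> G W v * d v) = (\<Sum>u\<in>W. cost \<eta> G V W u)"
    unfolding d_def using sum_cost[OF fin] by metis
  also have "\<Phi> * (1 + (\<eta> * q)\<^sup>2) + \<eta> / (w - s) * ((\<Sum>u\<in>T. cost \<eta> G V W u) - s * ((\<Sum>u\<in>W. cost \<eta> G V W u) / w))
      \<le> \<Phi> * (1 + (\<eta> * q)\<^sup>2) + \<eta> / (w - s) * (s * (\<delta> * \<Phi>))"
  proof -
    have "(\<Sum>u\<in>T. cost \<eta> G V W u) - s * ((\<Sum>u\<in>W. cost \<eta> G V W u) / w) \<le> s * (\<delta> * \<Phi>)"
      using cheap unfolding s_def w_def \<Phi>_def by (simp add: algebra_simps)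
    then show ?thesis using \<eta>(1) ws(2) by (intro add_left_mono mult_left_mono) auto
  qed
  also have "\<dots> = \<Phi> * (1 + \<eta> * \<delta> * q + (\<eta> * q)\<^sup>2)"
    by (simp add: q_def algebra_simps)
  finally show ?thesis unfolding \<Phi>_def q(1) .
qed

text \<open>
  Cliques of at most about average cost \<open>y\<close>. Sort \<open>W\<close> by cost and choose the \<open>j\<close>-th
  vertex \<open>b j\<close> of a clique among the first \<open>j * w / m + p\<close> vertices, where \<open>w = card W\<close>.
  The \<open>j\<close> earlier vertices of the clique exclude at most \<open>j * w / m\<close> of these, so there are
  still about \<open>p\<close> choices. On the other hand, the at least \<open>w / m - p\<close> vertices that come
  after this range but still within the range for \<open>j + 1\<close> all cost at least as much as
  \<open>b j\<close>. These groups are disjoint for different \<open>j\<close>, which bounds the cost of the clique by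
  the total cost of \<open>W\<close>.
\<close>
lemma low_cost_sets:
  fixes y :: "'a \<Rightarrow> real"
  assumes m: "0 < m" and fin: "finite W" and y: "\<And>u. u \<in> W \<Longrightarrow> 0 \<le> y u"
    and p: "1 \<le> p" "real p \<le> real (card W) / real m"
    and miss: "\<And>v. v \<in> V \<Longrightarrow> real (card (W - neighbours G v)) \<le> real (card W) / real m"
  shows "\<exists>U. (\<forall>j<m. U j \<subseteq> W) \<and>
    (\<forall>j<m. \<forall>S\<subseteq>V. finite S \<longrightarrow> card S \<le> j \<longrightarrow> real (card {x \<in> U j. \<forall>s\<in>S. {s, x} \<in> G}) \<ge> real p - 1) \<and>
    (\<forall>b. (\<forall>j<m. b j \<in> U j) \<longrightarrow> (real (card W) / real m - real p) * (\<Sum>j<m. y (b j)) \<le> (\<Sum>u\<in>W. y u))"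
proof -
  define w where "w = card W"
  obtain ws0 where ws0: "distinct ws0" "set ws0 = W" using finite_distinct_list[OF fin] by blast
  define ws where "ws = sort_key y ws0"
  have ws: "distinct ws" "set ws = W" "sorted (map y ws)" using ws0 by (simp_all add: ws_def)
  have lws: "length ws = w" using ws distinct_card by (metis w_def)
  \<comment> \<open>The ends of the ranges; the last one is all of \<open>W\<close>.\<close>
  define M where "M j = (if j < m then (j * w) div m + p else w)" for j
  have quot: "real (j * w) / real m - 1 < real ((j * w) div m)" "real ((j * w) div m) \<le> real (j * w) / real m" for j
  proof -
    show "real ((j * w) div m) \<le> real (j * w) / real m" by (rule of_nat_div_le_of_nat)
    have "j * w < Suc ((j * w) div m) * m" using m by (simp add: dividend_less_div_times)
    then have "real (j * w) < real (Suc ((j * w) div m) * m)" by (rule of_nat_less_iff[THEN iffD2])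
    then have "real (j * w) < (real ((j * w) div m) + 1) * real m" by (simp only: of_nat_mult of_nat_Suc add.commute)
    then have "real (j * w) / real m < real ((j * w) div m) + 1" using m by (subst pos_divide_less_eq) auto
    then show "real (j * w) / real m - 1 < real ((j * w) div m)" by linarith
  qed
  have gap: "real (M j) + (real w / real m - real p) \<le> real (M (Suc j))" if j: "j < m" for j
  proof (cases "Suc j < m")
    case True
    have "real (Suc j * w) / real m = real (j * w) / real m + real w / real m"
      by (simp add: add_divide_distrib)
    then show ?thesis using True j quot(1)[of "Suc j"] quot(2)[of j] p(1) by (simp add: M_def)
  next
    case False
    then have "Suc j = m" using j by simp
    then have mj: "real j + 1 = real m" by (metis of_nat_Suc add.commute)
    have "real (j * w) / real m + real w / real m = (real j + 1) * real w / real m"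
      by (simp add: add_divide_distrib[symmetric] algebra_simps)
    then have "real (j * w) / real m + real w / real m = real w" unfolding mj using m by simp
    then show ?thesis using False j quot(2)[of j] by (simp add: M_def)
  qed
  have pw: "0 \<le> real w / real m - real p" using p by (simp add: w_def)
  have M_mono: "M j \<le> M (Suc j)" if "j < m" for j using gap[OF that] pw by linarith
  have M_le: "M j \<le> w" if "j \<le> m" for j
    using that by (induction rule: inc_induct) (auto simp: M_def[of m] intro: order_trans[OF M_mono])
  define U where "U j = set (take (M j) ws)" for j
  show ?thesis
  proof (intro exI[of _ U] conjI allI impI)
    fix j assume "j < m"
    show "U j \<subseteq> W" unfolding U_def using ws(2) set_take_subset by metis
  next
    fix j S assume j: "j < m" and S: "S \<subseteq> V" "finite S" "card S \<le> j"
    let ?N = "\<lambda>s. W - neighbours G s"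
    have UW: "U j \<subseteq> W" unfolding U_def using ws(2) set_take_subset by metis
    then have "U j \<subseteq> {x \<in> U j. \<forall>s\<in>S. {s, x} \<in> G} \<union> (\<Union>s\<in>S. ?N s)" by (auto simp: neighbours_def)
    moreover have finU: "finite (U j)" by (simp add: U_def)
    ultimately have "card (U j) \<le> card ({x \<in> U j. \<forall>s\<in>S. {s, x} \<in> G} \<union> (\<Union>s\<in>S. ?N s))"
      using fin S by (intro card_mono) auto
    also have "\<dots> \<le> card {x \<in> U j. \<forall>s\<in>S. {s, x} \<in> G} + (\<Sum>s\<in>S. card (?N s))"
      using card_UN_le[OF S(2), of ?N] card_Un_le[of "{x \<in> U j. \<forall>s\<in>S. {s, x} \<in> G}" "\<Union>s\<in>S. ?N s"] by linarith
    finally have "real (card (U j)) \<le> real (card {x \<in> U j. \<forall>s\<in>S. {s, x} \<in> G} + (\<Sum>s\<in>S. card (?N s)))"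
      by (rule of_nat_mono)
    then have "real (card (U j)) \<le> real (card {x \<in> U j. \<forall>s\<in>S. {s, x} \<in> G}) + (\<Sum>s\<in>S. real (card (?N s)))"
      by simp
    also have "(\<Sum>s\<in>S. real (card (?N s))) \<le> (\<Sum>s\<in>S. real w / real m)"
      using miss S(1) by (intro sum_mono) (auto simp: w_def)
    also have "\<dots> = real (card S) * (real w / real m)" by simp
    also have "\<dots> \<le> real j * (real w / real m)" using S(3) by (intro mult_right_mono) auto
    also have "\<dots> = real (j * w) / real m" by simp
    finally have "real (card (U j)) \<le> real (card {x \<in> U j. \<forall>s\<in>S. {s, x} \<in> G}) + real (j * w) / real m" by simp
    moreover have "card (U j) = M j"
      using distinct_card[of "take (M j) ws"] ws(1) lws M_le[of j] j by (simp add: U_def)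
    ultimately show "real p - 1 \<le> real (card {x \<in> U j. \<forall>s\<in>S. {s, x} \<in> G})"
      using quot(1)[of j] j by (simp add: M_def)
  next
    fix b assume b: "\<forall>j<m. b j \<in> U j"
    have y_ws: "0 \<le> y (ws ! i)" if "i < w" for i using y ws(2) lws that by (metis nth_mem)
    have "(real w / real m - real p) * (\<Sum>i<j. y (b i)) \<le> (\<Sum>i<M j. y (ws ! i))" if "j \<le> m" for j
      using that
    proof (induction j)
      case 0
      have "0 \<le> (\<Sum>i<M 0. y (ws ! i))" using y_ws M_le[of 0] by (intro sum_nonneg) auto
      then show ?case by simp
    next
      case (Suc j)
      then have j: "j < m" by simp
      have "(\<Sum>i<M (Suc j). y (ws ! i)) = (\<Sum>i<M j. y (ws ! i)) + (\<Sum>i=M j..<M (Suc j). y (ws ! i))"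
        using M_mono[OF j] by (simp add: lessThan_atLeast0 sum.atLeastLessThan_concat)
      moreover have "(\<Sum>i=M j..<M (Suc j). y (b j)) \<le> (\<Sum>i=M j..<M (Suc j). y (ws ! i))"
      proof (rule sum_mono)
        fix i assume i: "i \<in> {M j..<M (Suc j)}"
        have "b j \<in> set (take (M j) ws)" using b j by (simp add: U_def)
        then obtain i0 where i0: "i0 < M j" "i0 < w" "b j = ws ! i0"
          using lws by (auto simp: in_set_conv_nth)
        have "i < w" using i M_le[of "Suc j"] j by simp
        then have "map y ws ! i0 \<le> map y ws ! i"
          using ws(3) i i0 lws by (intro sorted_nth_mono) auto
        then show "y (b j) \<le> y (ws ! i)" using i0 \<open>i < w\<close> lws by simp
      qed
      moreover have "(\<Sum>i=M j..<M (Suc j). y (b j)) = (real (M (Suc j)) - real (M j)) * y (b j)"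
        using M_mono[OF j] by (simp add: of_nat_diff)
      moreover have "(real w / real m - real p) * y (b j) \<le> (real (M (Suc j)) - real (M j)) * y (b j)"
      proof (rule mult_right_mono)
        have "b j \<in> W" using b j ws(2) set_take_subset[of "M j" ws] by (auto simp: U_def)
        then show "0 \<le> y (b j)" by (rule y)
      qed (use gap[OF j] in linarith)
      ultimately show ?case using Suc.IH j by (simp add: algebra_simps)
    qed
    from this[of m] have "(real w / real m - real p) * (\<Sum>i<m. y (b i)) \<le> (\<Sum>i<w. y (ws ! i))"
      by (simp add: M_def)
    also have "(\<Sum>i<w. y (ws ! i)) = (\<Sum>u\<in>W. y u)"
      using sum_list_distinct_conv_sum_set[OF ws(1), of y] ws(2) lws
      by (simp add: sum_list_sum_nth atLeast0LessThan)
    finally show "(real (card W) / real m - real p) * (\<Sum>j<m. y (b j)) \<le> (\<Sum>u\<in>W. y u)"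
      unfolding w_def .
  qed
qed

definition cliques :: "'a edges \<Rightarrow> 'a set list \<Rightarrow> 'a list set" where
  "cliques G Us = {B. length B = length Us \<and> (\<forall>i<length Us. B ! i \<in> Us ! i) \<and>
     (\<forall>i j. i < j \<longrightarrow> j < length Us \<longrightarrow> {B ! i, B ! j} \<in> G)}"

lemma cliques_subset: "(\<And>U. U \<in> set Us \<Longrightarrow> U \<subseteq> W) \<Longrightarrow> cliques G Us \<subseteq> tuples W (length Us)"
  unfolding cliques_def tuples_def by (fastforce simp: in_set_conv_nth)

lemma card_cliques:
  assumes V: "finite V" and Us: "\<And>U. U \<in> set Us \<Longrightarrow> U \<subseteq> V" and "0 \<le> q"
    and big: "\<And>j S. j < length Us \<Longrightarrow> S \<subseteq> V \<Longrightarrow> finite S \<Longrightarrow> card S \<le> j \<Longrightarrow>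
               real (card {x \<in> Us ! j. \<forall>s\<in>S. {s, x} \<in> G}) \<ge> q"
  shows "real (card (cliques G Us)) \<ge> q ^ length Us"
proof -
  define C where "C xs = {x \<in> Us ! length xs. \<forall>s\<in>set xs. {s, x} \<in> G}" for xs
  have "cliques G Us = {B. length B = length Us \<and> (\<forall>j<length Us. B ! j \<in> C (take j B))}"
  proof (intro set_eqI iffI)
    fix B assume "B \<in> cliques G Us"
    then show "B \<in> {B. length B = length Us \<and> (\<forall>j<length Us. B ! j \<in> C (take j B))}"
      by (auto simp: cliques_def C_def in_set_conv_nth)
  next
    fix B assume B: "B \<in> {B. length B = length Us \<and> (\<forall>j<length Us. B ! j \<in> C (take j B))}"
    have "{B ! i, B ! j} \<in> G" if "i < j" "j < length Us" for i j
    proof -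
      have "B ! i \<in> set (take j B)" using that B by (auto simp: in_set_conv_nth)
      then show ?thesis using B that by (auto simp: C_def)
    qed
    then show "B \<in> cliques G Us" using B by (auto simp: cliques_def C_def)
  qed
  moreover have "real (card {B. length B = length Us \<and> (\<forall>j<length Us. B ! j \<in> C (take j B))}) \<ge> q ^ length Us"
  proof (rule conjunct2[OF card_greedy_tuples[OF V \<open>0 \<le> q\<close>]])
    fix xs assume xs: "length xs < length Us" "set xs \<subseteq> V"
    show "C xs \<subseteq> V" using Us[of "Us ! length xs"] xs by (auto simp: C_def)
    show "q \<le> real (card (C xs))" unfolding C_def
      using big[OF xs(1) xs(2)] card_length[of xs] by simp
  qed
  ultimately show ?thesis by simp
qed

lemma card_cliques_rev: "card (cliques G (rev Us)) = card (cliques G Us)"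
proof -
  have sub: "rev ` cliques G Us \<subseteq> cliques G (rev Us)" for Us :: "'a set list"
  proof clarify
    fix B assume B: "B \<in> cliques G Us"
    let ?n = "length Us"
    have "rev B ! i \<in> rev Us ! i" if "i < ?n" for i
      using that B by (auto simp: cliques_def rev_nth)
    moreover have "{rev B ! i, rev B ! j} \<in> G" if "i < j" "j < ?n" for i j
    proof -
      have "{B ! (?n - Suc j), B ! (?n - Suc i)} \<in> G" using that B by (auto simp: cliques_def)
      then show ?thesis using that B by (simp add: cliques_def rev_nth insert_commute)
    qed
    ultimately show "rev B \<in> cliques G (rev Us)" using B by (simp add: cliques_def)
  qed
  have "cliques G (rev Us) \<subseteq> rev ` cliques G Us"
  proof
    fix B assume "B \<in> cliques G (rev Us)"
    then have "rev B \<in> cliques G Us" using sub[of "rev Us"] by auto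
    then show "B \<in> rev ` cliques G Us" by (metis image_eqI rev_rev_ident)
  qed
  then have "rev ` cliques G Us = cliques G (rev Us)" using sub by blast
  moreover have "inj_on rev (cliques G Us)" by simp
  ultimately show ?thesis by (metis card_image)
qed

section \<open>Target families and the extension property\<close>

text \<open>Here the tag is arbitrary; it only gives these families the same form as the absorbing ones.\<close>
definition tagged_cliques :: "'a edges \<Rightarrow> 'a set \<Rightarrow> 'a set list \<Rightarrow> 'a list set" where
  "tagged_cliques G V Us = {B @ [v] | B v. B \<in> cliques G Us \<and> v \<in> V}"

text \<open>Cliques in the neighbourhood of their tag: blocks built from them absorb the tag.\<close>
definition absorbing_cliques :: "'a edges \<Rightarrow> nat \<Rightarrow> 'a set \<Rightarrow> 'a set \<Rightarrow> 'a list set" where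
  "absorbing_cliques G m W S = {B @ [v] | B v. B \<in> cliques G (replicate m (W \<inter> neighbours G v)) \<and> v \<in> S}"

text \<open>
  All target families used in the construction. Their number is only exponential in \<open>n\<close>, since each
  is determined by a bounded number of subsets of \<open>V\<close>; this is why cliques of low cost are
  described by sets from which their vertices are chosen.
\<close>
definition targets :: "'a edges \<Rightarrow> 'a set \<Rightarrow> nat \<Rightarrow> 'a set \<Rightarrow> 'a list set set" where
  "targets G V m W = absorbing_cliques G m W ` Pow V \<union> tagged_cliques G V ` tuples (Pow W) m"

lemma targets_props:
  assumes "\<B> \<in> targets G V m W" "W \<subseteq> V"
  shows "\<B> \<subseteq> tuples V (m + 1)"
    and "B @ [v] \<in> \<B> \<Longrightarrow> set B \<subseteq> W \<and> (\<forall>i j. i < j \<longrightarrow> j < m \<longrightarrow> {B ! i, B ! j} \<in> G)"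
proof -
  have main: "b \<in> tuples V (m + 1) \<and> set (butlast b) \<subseteq> W \<and> (\<forall>i j. i < j \<longrightarrow> j < m \<longrightarrow> {butlast b ! i, butlast b ! j} \<in> G)"
    if b: "b \<in> \<B>" for b
  proof -
    have "\<exists>B v Us. b = B @ [v] \<and> v \<in> V \<and> B \<in> cliques G Us \<and> length Us = m \<and> (\<forall>U\<in>set Us. U \<subseteq> W)"
      using assms(1) unfolding targets_def
    proof (elim UnE imageE)
      fix S assume S: "S \<in> Pow V" "\<B> = absorbing_cliques G m W S"
      then obtain B v where "b = B @ [v]" "B \<in> cliques G (replicate m (W \<inter> neighbours G v))" "v \<in> S"
        using b unfolding absorbing_cliques_def by blast
      then show ?thesis using S
        by (intro exI[of _ B] exI[of _ v] exI[of _ "replicate m (W \<inter> neighbours G v)"]) auto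
    next
      fix Us assume Us: "Us \<in> tuples (Pow W) m" "\<B> = tagged_cliques G V Us"
      then obtain B v where "b = B @ [v]" "B \<in> cliques G Us" "v \<in> V"
        using b unfolding tagged_cliques_def by blast
      then show ?thesis using Us
        by (intro exI[of _ B] exI[of _ v] exI[of _ Us]) (auto simp: tuples_def)
    qed
    then obtain B v Us where *: "b = B @ [v]" "v \<in> V" "B \<in> cliques G Us" "length Us = m" "\<forall>U\<in>set Us. U \<subseteq> W"
      by blast
    then have "B \<in> tuples W m" using cliques_subset[of Us W G] by auto
    then show ?thesis using * assms(2) by (auto simp: tuples_def cliques_def)
  qed
  show "\<B> \<subseteq> tuples V (m + 1)" using main by blast
  show "set B \<subseteq> W \<and> (\<forall>i j. i < j \<longrightarrow> j < m \<longrightarrow> {B ! i, B ! j} \<in> G)" if "B @ [v] \<in> \<B>"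
    using main[OF that] by simp
qed

lemma card_tagged_cliques:
  assumes "finite V"
  shows "card (tagged_cliques G V Us) = card (cliques G Us) * card V"
proof -
  have "tagged_cliques G V Us = (\<lambda>(B, v). B @ [v]) ` (cliques G Us \<times> V)"
    unfolding tagged_cliques_def by auto
  moreover have "inj_on (\<lambda>(B, v). B @ [v]) (cliques G Us \<times> V)" by (auto simp: inj_on_def)
  ultimately show ?thesis by (simp add: card_image card_cartesian_product)
qed

text \<open>The \<open>j\<close>-th vertex of the clique has \<open>j + 1 \<le> m\<close> prescribed neighbours, including \<open>v\<close>.\<close>
lemma card_star_cliques:
  assumes dens: "min_density G V W (1 - 1 / real m + \<epsilon>)" and V: "finite V" "W \<subseteq> V" "v \<in> V"
    and m: "0 < m" "0 \<le> \<epsilon>" "\<epsilon> \<le> 1 / real m"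
  shows "real (card (cliques G (replicate m (W \<inter> neighbours G v)))) \<ge> (\<epsilon> * real (card W)) ^ m"
proof -
  have finW: "finite W" using V finite_subset by blast
  have "real (card (cliques G (replicate m (W \<inter> neighbours G v)))) \<ge>
      (\<epsilon> * real (card W)) ^ length (replicate m (W \<inter> neighbours G v))"
  proof (rule card_cliques[OF V(1)])
    fix j S assume "j < length (replicate m (W \<inter> neighbours G v))" and S: "S \<subseteq> V" "finite S" "card S \<le> j"
    then have j: "j < m" by simp
    have "card (insert v S) \<le> m" using S(2,3) j by (simp add: card_insert_if)
    then have "real (card {x \<in> W. \<forall>s\<in>insert v S. {s, x} \<in> G}) \<ge> \<epsilon> * real (card W)"
      using S V m by (intro common_neighbours[OF dens finW]) auto
    moreover have "{x \<in> W. \<forall>s\<in>insert v S. {s, x} \<in> G} = {x \<in> replicate m (W \<inter> neighbours G v) ! j. \<forall>s\<in>S. {s, x} \<in> G}"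
      using j by (auto simp: neighbours_def)
    ultimately show "\<epsilon> * real (card W) \<le> real (card {x \<in> replicate m (W \<inter> neighbours G v) ! j. \<forall>s\<in>S. {s, x} \<in> G})"
      by simp
  qed (use V m in auto)
  then show ?thesis by simp
qed

lemma card_absorbing_cliques:
  assumes dens: "min_density G V W (1 - 1 / real m + \<epsilon>)" and V: "finite V" "W \<subseteq> V" "S \<subseteq> V"
    and m: "0 < m" "0 \<le> \<epsilon>" "\<epsilon> \<le> 1 / real m"
  shows "real (card (absorbing_cliques G m W S)) \<ge> real (card S) * (\<epsilon> * real (card W)) ^ m"
proof -
  let ?C = "\<lambda>v. cliques G (replicate m (W \<inter> neighbours G v))"
  have finC: "finite (?C v)" for v
  proof (rule finite_subset)
    show "?C v \<subseteq> tuples W m" using cliques_subset[of "replicate m (W \<inter> neighbours G v)" W G] by auto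
    show "finite (tuples W m)" using V finite_subset by blast
  qed
  have finS: "finite S" using V finite_subset by blast
  have eq: "absorbing_cliques G m W S = (\<lambda>(v, B). B @ [v]) ` (SIGMA v:S. ?C v)"
    unfolding absorbing_cliques_def by auto
  have "inj_on (\<lambda>(v, B). B @ [v]) (SIGMA v:S. ?C v)" by (auto simp: inj_on_def)
  then have "card (absorbing_cliques G m W S) = (\<Sum>v\<in>S. card (?C v))"
    unfolding eq using finS finC by (simp add: card_image)
  moreover have "(\<Sum>v\<in>S. real (card (?C v))) \<ge> (\<Sum>v\<in>S. (\<epsilon> * real (card W)) ^ m)"
    using card_star_cliques[OF dens V(1,2) _ m] V(3) by (intro sum_mono) auto
  ultimately show ?thesis by simp
qed

text \<open>
  Cliques after which the path can be continued with its own beginning \<open>F\<close>. If the last loop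
  runs around such a clique, its \<open>i\<close>-th pair is at distance at most \<open>m\<close> from no other
  vertices of \<open>F\<close> than the first \<open>i + 1\<close>.
\<close>
definition closing_sets :: "'a edges \<Rightarrow> 'a set \<Rightarrow> 'a list \<Rightarrow> 'a set list" where
  "closing_sets G W F = map (\<lambda>i. {x \<in> W. \<forall>f\<in>set (take (Suc i) F). {f, x} \<in> G}) [0..<length F]"

text \<open>
  The vertices are chosen in reverse order: with \<open>i + 1\<close> neighbours prescribed in \<open>F\<close> and
  \<open>m - 1 - i\<close> among the vertices already chosen, there are \<open>m\<close> conditions in each step.
\<close>
lemma card_closing_cliques:
  assumes dens: "min_density G V W (1 - 1 / real m + \<epsilon>)" and V: "finite V" "W \<subseteq> V" and F: "F \<in> tuples V m"
    and m: "0 < m" "0 \<le> \<epsilon>" "\<epsilon> \<le> 1 / real m"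
  shows "real (card (cliques G (closing_sets G W F))) \<ge> (\<epsilon> * real (card W)) ^ m"
proof -
  have finW: "finite W" using V finite_subset by blast
  have lF: "length F = m" "set F \<subseteq> V" using F by (auto simp: tuples_def)
  let ?Us = "rev (closing_sets G W F)"
  have "real (card (cliques G ?Us)) \<ge> (\<epsilon> * real (card W)) ^ length ?Us"
  proof (rule card_cliques[OF V(1)])
    fix U assume "U \<in> set ?Us"
    then show "U \<subseteq> V" using V(2) by (auto simp: closing_sets_def)
  next
    fix j S assume "j < length ?Us" and S: "S \<subseteq> V" "finite S" "card S \<le> j"
    then have j: "j < m" by (simp add: closing_sets_def lF)
    have U: "?Us ! j = {x \<in> W. \<forall>f\<in>set (take (m - j) F). {f, x} \<in> G}"
      using j by (simp add: closing_sets_def lF rev_nth Suc_diff_Suc)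
    have "card (set (take (m - j) F) \<union> S) \<le> (m - j) + j"
      using card_Un_le[of "set (take (m - j) F)" S] card_length[of "take (m - j) F"] S(3) by simp
    then have "real (card {x \<in> W. \<forall>s\<in>set (take (m - j) F) \<union> S. {s, x} \<in> G}) \<ge> \<epsilon> * real (card W)"
      using S lF j m set_take_subset[of "m - j" F] by (intro common_neighbours[OF dens finW]) auto
    moreover have "{x \<in> W. \<forall>s\<in>set (take (m - j) F) \<union> S. {s, x} \<in> G} = {x \<in> ?Us ! j. \<forall>s\<in>S. {s, x} \<in> G}"
      unfolding U by auto
    ultimately show "\<epsilon> * real (card W) \<le> real (card {x \<in> ?Us ! j. \<forall>s\<in>S. {s, x} \<in> G})" by simp
  qed (use m in auto)
  then show ?thesis unfolding card_cliques_rev by (simp add: closing_sets_def lF)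
qed

text \<open>
  What the certificate guarantees about \<open>R\<close>, uniformly in the unvisited set \<open>W\<close>, the end
  \<open>E\<close> of the path and the target family. From here on, \<open>R\<close> is used only through this
  property.
\<close>
definition extendable :: "'a edges \<Rightarrow> 'a edges \<Rightarrow> 'a set \<Rightarrow> nat \<Rightarrow> real \<Rightarrow> nat \<Rightarrow> real \<Rightarrow> real \<Rightarrow> real \<Rightarrow> bool" where
  "extendable G R V m \<epsilon> t \<omega> c g \<longleftrightarrow> (\<forall>W E \<B>. W \<subseteq> V \<longrightarrow> E \<in> tuples V m \<longrightarrow> power_path m (G \<union> R) E \<longrightarrow>
     min_density G V W (1 - 1 / real m + \<epsilon>) \<longrightarrow> real (card W) \<ge> \<omega> * real (card V) \<longrightarrow>
     \<B> \<in> targets G V m W \<longrightarrow> real (card \<B>) \<ge> c * real (card V) ^ (m + 1) \<longrightarrow>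
     has_segment G R V m t g W E \<B>)"

lemma extendable_if_hit:
  assumes m: "2 \<le> m" and t: "1 \<le> t" and V: "finite V" "V \<noteq> {}"
    and a: "a = (m + 1 + t) * (m * (m + 2))" and \<gamma>: "0 < \<gamma>"
    and dense: "\<And>W E \<B>. W \<subseteq> V \<Longrightarrow> E \<in> tuples V m \<Longrightarrow>
     min_density G V W (1 - 1 / real m + \<epsilon>) \<Longrightarrow> real (card W) \<ge> \<omega> * real (card V) \<Longrightarrow>
     \<B> \<subseteq> tuples V (m + 1) \<Longrightarrow> real (card \<B>) \<ge> c * real (card V) ^ (m + 1) \<Longrightarrow>
     segments G m W E \<B> (m + 1 + t) \<subseteq> tuples V (2 * a + (m + 1)) \<and>
     real (card (segments G m W E \<B> (m + 1 + t))) \<ge> \<gamma> * real (card V) ^ (2 * a + (m + 1))"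
    and hit: "\<And>W E \<B> Q. W \<subseteq> V \<Longrightarrow> E \<in> tuples V m \<Longrightarrow> \<B> \<in> targets G V m W \<Longrightarrow>
     segments G m W E \<B> (m + 1 + t) \<subseteq> tuples V (2 * a + (m + 1)) \<Longrightarrow>
     Q \<in> queries V a (m + 1) \<gamma> (segments G m W E \<B> (m + 1 + t)) \<Longrightarrow> R \<inter> Q \<noteq> {}"
  shows "extendable G R V m \<epsilon> t \<omega> c (\<gamma> / 2 ^ (a + 1))"
  unfolding extendable_def
proof (intro allI impI)
  fix W E \<B> assume W: "W \<subseteq> V" and E: "E \<in> tuples V m" "power_path m (G \<union> R) E"
    and dens: "min_density G V W (1 - 1 / real m + \<epsilon>)" "real (card W) \<ge> \<omega> * real (card V)"
    and \<B>: "\<B> \<in> targets G V m W" "real (card \<B>) \<ge> c * real (card V) ^ (m + 1)"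
  note tp = targets_props[OF \<B>(1) W]
  have d: "segments G m W E \<B> (m + 1 + t) \<subseteq> tuples V (2 * a + (m + 1))"
     "real (card (segments G m W E \<B> (m + 1 + t))) \<ge> \<gamma> * real (card V) ^ (2 * a + (m + 1))"
    using dense[OF W E(1) dens tp(1) \<B>(2)] by auto
  have lE: "length E = m" using E by (simp add: tuples_def)
  show "has_segment G R V m t (\<gamma> / 2 ^ (a + 1)) W E \<B>"
    using segment_exists[OF m t V lE E(2) tp(2) a refl d(1) d(2) \<gamma> hit[OF W E(1) \<B>(1) d(1)]] .
qed

section \<open>Building the cycle\<close>
definition absorb_count :: "nat \<Rightarrow> 'a edges \<Rightarrow> 'a list list \<Rightarrow> 'a \<Rightarrow> nat" where
  "absorb_count m G bs v = length (filter (\<lambda>b. absorbs m G b v) bs)"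

lemma absorb_count_append: "absorb_count m G (bs @ bs') v = absorb_count m G bs v + absorb_count m G bs' v"
  by (simp add: absorb_count_def)

text \<open>
  The path is kept as a list of blocks, so that absorbing blocks can be recognized. Its first block
  \<open>hd bs\<close> is a single clique of \<open>m\<close> vertices, to which the path finally returns.
\<close>
definition partial_path :: "'a edges \<Rightarrow> 'a edges \<Rightarrow> 'a set \<Rightarrow> nat \<Rightarrow> 'a list list \<Rightarrow> bool" where
  "partial_path G R V m bs \<longleftrightarrow> bs \<noteq> [] \<and> length (hd bs) = m \<and> distinct (concat bs) \<and> set (concat bs) \<subseteq> V \<and>
     power_path m (G \<union> R) (concat bs)"

lemma partial_path_card:
  assumes "partial_path G R V m bs" "finite V"
  shows "card (V - set (concat bs)) = card V - length (concat bs)" "length (concat bs) \<le> card V"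
    "m \<le> length (concat bs)"
proof -
  have "card (set (concat bs)) = length (concat bs)" "set (concat bs) \<subseteq> V"
    using assms(1) distinct_card[of "concat bs"] unfolding partial_path_def by blast+
  then show "card (V - set (concat bs)) = card V - length (concat bs)" "length (concat bs) \<le> card V"
    using assms(2) card_mono[of V "set (concat bs)"] by (simp_all add: card_Diff_subset)
  show "m \<le> length (concat bs)" using assms(1) by (cases bs) (auto simp: partial_path_def)
qed

lemma extend_partial_path:
  assumes ext: "extendable G R V m \<epsilon> t \<omega> c g" and part: "partial_path G R V m bs" and V: "finite V"
    and W: "W = V - set (concat bs)" and dens: "min_density G V W (1 - 1 / real m + \<epsilon>)" "real (card W) \<ge> \<omega> * real (card V)"
    and \<B>: "\<B> \<in> targets G V m W" "real (card \<B>) \<ge> c * real (card V) ^ (m + 1)"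
  obtains S Q z U where "length S = 2 * m * (m + 1)" "length Q = 2 * m * t" "length z = m"
    "distinct (S @ Q @ z)" "set (S @ Q @ z) \<subseteq> W" "partial_path G R V m (bs @ [S, Q, z])"
    "U \<subseteq> V" "real (card U) \<ge> g * real (card V)"
    "\<And>x v. x \<in> set Q \<Longrightarrow> v \<in> U \<Longrightarrow> \<exists>B. B @ [v] \<in> \<B> \<and> length B = m \<and> x \<in> set B"
    "\<And>(f :: 'a \<Rightarrow> real) b. (\<And>B v. B @ [v] \<in> \<B> \<Longrightarrow> length B = m \<Longrightarrow> sum_list (map f B) \<le> b) \<Longrightarrow> sum_list (map f Q) \<le> 2 * real t * b"
    "\<And>i. i < 2 * m \<Longrightarrow> \<exists>B v. B @ [v] \<in> \<B> \<and> length B = m \<and> Q ! (2 * m * (t - 1) + i) = B ! (i div 2)"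
proof -
  define xs E where "xs = take (length (concat bs) - m) (concat bs)" and "E = drop (length (concat bs) - m) (concat bs)"
  have xE: "concat bs = xs @ E" by (simp add: xs_def E_def)
  have lE: "length E = m" using partial_path_card(3)[OF part V] by (simp add: E_def)
  have p: "distinct (concat bs)" "set (concat bs) \<subseteq> V" "power_path m (G \<union> R) (xs @ E)"
    using part xE by (auto simp: partial_path_def)
  have "E \<in> tuples V m" using p(2) lE unfolding xE by (simp add: tuples_def)
  moreover have "power_path m (G \<union> R) E" using p(3) by (rule power_path_suffix)
  moreover have "W \<subseteq> V" using W by blast
  ultimately have "has_segment G R V m t g W E \<B>"
    using ext dens \<B> unfolding extendable_def by simp
  then obtain S Q z U where *: "length S = 2 * m * (m + 1)" "length Q = 2 * m * t" "length z = m"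
    "distinct (S @ Q @ z)" "set (S @ Q @ z) \<subseteq> W" "power_path m (G \<union> R) (E @ S @ Q @ z)"
    "U \<subseteq> V" "real (card U) \<ge> g * real (card V)"
    "\<forall>x\<in>set Q. \<forall>v\<in>U. \<exists>B. B @ [v] \<in> \<B> \<and> length B = m \<and> x \<in> set B"
    "\<forall>(f :: 'a \<Rightarrow> real) b. (\<forall>B v. B @ [v] \<in> \<B> \<longrightarrow> length B = m \<longrightarrow> sum_list (map f B) \<le> b) \<longrightarrow> sum_list (map f Q) \<le> 2 * real t * b"
    "\<forall>i<2 * m. \<exists>B v. B @ [v] \<in> \<B> \<and> length B = m \<and> Q ! (2 * m * (t - 1) + i) = B ! (i div 2)"
    unfolding has_segment_def by (elim exE conjE) (rule that)
  have "power_path m (G \<union> R) (xs @ E @ (S @ Q @ z))"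
    by (rule power_path_glue[OF p(3) *(6)]) (simp add: lE)
  then have pp: "power_path m (G \<union> R) (concat (bs @ [S, Q, z]))" by (simp add: xE)
  have part': "partial_path G R V m (bs @ [S, Q, z])"
    unfolding partial_path_def
  proof (intro conjI pp)
    show "distinct (concat (bs @ [S, Q, z]))" using p(1) *(4,5) W by auto
    show "set (concat (bs @ [S, Q, z])) \<subseteq> V" using p(2) *(5) W by auto
  qed (use part in \<open>auto simp: partial_path_def\<close>)
  show ?thesis
    by (rule that[OF *(1-5) part' *(7,8)]) (use *(9-11) in blast)+
qed

text \<open>
  As long as linearly many vertices have fewer than \<open>\<tau>\<close> absorbing blocks, a segment can be
  targeted at cliques tagged with such vertices. Its block \<open>Q\<close> of \<open>2 * m\<close> vertices absorbs
  at least \<open>g * card V\<close> of them. Hence this happens at most \<open>\<tau> / g\<close> times.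
\<close>
lemma many_absorbers:
  fixes \<tau> :: nat
  assumes m: "2 \<le> m" and V: "finite V" "V \<noteq> {}" and g: "0 < g" and \<epsilon>: "0 < \<epsilon>" "\<epsilon> \<le> 1 / real m" and \<sigma>: "0 < \<sigma>"
    and ext: "extendable G R V m \<epsilon> 1 (1 / 2) c g" and c: "c \<le> \<sigma> * (\<epsilon> / 2) ^ m"
    and room: "\<And>X. X \<subseteq> V \<Longrightarrow> real (card X) \<le> K \<Longrightarrow>
       min_density G V (V - X) (1 - 1 / real m + \<epsilon>) \<and> real (card (V - X)) \<ge> 1 / 2 * real (card V)"
    and start: "partial_path G R V m [F]"
    and L: "L = 2 * m * (m + 1) + 2 * m + m" and budget: "real m + real L * (real \<tau> / g) \<le> K"
  shows "\<exists>bs. partial_path G R V m (F # bs) \<and> real (length (concat (F # bs))) \<le> real m + real L * (real \<tau> / g) \<and>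
           real (card {v \<in> V. absorb_count m G (F # bs) v < \<tau>}) < \<sigma> * real (card V)"
proof -
  define n where "n = real (card V)"
  have n: "n > 0" using V by (simp add: n_def card_gt_0_iff)
  \<comment> \<open>Truncation at \<open>\<tau>\<close> bounds \<open>\<Psi>\<close>, while each segment increases it by \<open>g * n\<close>.\<close>
  define \<Psi> where "\<Psi> bs = (\<Sum>v\<in>V. min (absorb_count m G bs v) \<tau>)" for bs
  define P where "P j \<longleftrightarrow> (\<exists>bs. partial_path G R V m (F # bs) \<and> length (concat (F # bs)) = m + L * j \<and>
     g * n * real j \<le> real (\<Psi> (F # bs)))" for j
  have bound: "real j \<le> real \<tau> / g" if "P j" for j
  proof -
    from that obtain bs where "g * n * real j \<le> real (\<Psi> (F # bs))" unfolding P_def by blast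
    also have "\<Psi> (F # bs) \<le> (\<Sum>v\<in>V. \<tau>)" unfolding \<Psi>_def by (intro sum_mono) simp
    then have "real (\<Psi> (F # bs)) \<le> real (card V * \<tau>)" by (intro of_nat_mono) simp
    finally have "n * (g * real j) \<le> n * real \<tau>" by (simp add: n_def mult_ac)
    then show ?thesis using n g by (simp add: field_simps)
  qed
  have "length F = m" using start by (simp add: partial_path_def)
  then have P0: "P 0" unfolding P_def using start by (intro exI[of _ "[]"]) auto
  have "\<exists>j. P j \<and> (\<forall>i. P i \<longrightarrow> i \<le> j)"
  proof (rule ex_has_greatest_nat[where f = "\<lambda>j. j" and b = "Suc (nat \<lceil>real \<tau> / g\<rceil>)"])
    show "P 0" by (rule P0)
    show "\<forall>y. P y \<longrightarrow> y < Suc (nat \<lceil>real \<tau> / g\<rceil>)"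
    proof (intro allI impI)
      fix y assume "P y"
      then have "real y \<le> real \<tau> / g" by (rule bound)
      then show "y < Suc (nat \<lceil>real \<tau> / g\<rceil>)" by linarith
    qed
  qed
  then obtain j where j: "P j" "\<And>i. P i \<Longrightarrow> i \<le> j" by blast
  from j(1) obtain bs where bs: "partial_path G R V m (F # bs)" "length (concat (F # bs)) = m + L * j"
    "g * n * real j \<le> real (\<Psi> (F # bs))" unfolding P_def by blast
  have len: "real (length (concat (F # bs))) \<le> real m + real L * (real \<tau> / g)"
    unfolding bs(2) using mult_left_mono[OF bound[OF j(1)], of "real L"] by simp
  define D where "D = {v \<in> V. absorb_count m G (F # bs) v < \<tau>}"
  have "real (card D) < \<sigma> * n"
  proof (rule ccontr)
    assume "\<not> real (card D) < \<sigma> * n"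
    then have D: "\<sigma> * n \<le> real (card D)" by simp
    define X W where "X = set (concat (F # bs))" and "W = V - X"
    have XV: "X \<subseteq> V" using bs(1) by (simp add: partial_path_def X_def)
    have "card X \<le> length (concat (F # bs))" unfolding X_def by (rule card_length)
    then have "real (card X) \<le> K" using len budget by linarith
    then have W: "min_density G V W (1 - 1 / real m + \<epsilon>)" "real (card W) \<ge> 1 / 2 * real (card V)"
      using room[OF XV] by (auto simp: W_def)
    define \<B> where "\<B> = absorbing_cliques G m W D"
    have DV: "D \<subseteq> V" by (auto simp: D_def)
    have "real (card \<B>) \<ge> real (card D) * (\<epsilon> * real (card W)) ^ m"
      unfolding \<B>_def using m \<epsilon> DV by (intro card_absorbing_cliques[OF W(1) V(1)]) (auto simp: W_def)
    moreover have eW: "\<epsilon> / 2 * n \<le> \<epsilon> * real (card W)"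
      using mult_left_mono[OF W(2), of \<epsilon>] \<epsilon> by (simp add: n_def)
    have "real (card D) * (\<epsilon> * real (card W)) ^ m \<ge> (\<sigma> * n) * (\<epsilon> / 2 * n) ^ m"
      by (intro mult_mono power_mono D eW) (use \<epsilon> n in auto)
    moreover have "(\<sigma> * n) * (\<epsilon> / 2 * n) ^ m = \<sigma> * (\<epsilon> / 2) ^ m * n ^ (m + 1)"
      by (simp only: power_mult_distrib power_add power_one_right mult_ac)
    moreover have "c * n ^ (m + 1) \<le> \<sigma> * (\<epsilon> / 2) ^ m * n ^ (m + 1)"
      using c n by (intro mult_right_mono) auto
    ultimately have \<B>_card: "c * n ^ (m + 1) \<le> real (card \<B>)" by linarith
    have \<B>_t: "\<B> \<in> targets G V m W" using DV by (auto simp: targets_def \<B>_def)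
    obtain S Q z U where e: "length S = 2 * m * (m + 1)" "length Q = 2 * m * 1" "length z = m"
      "distinct (S @ Q @ z)" "set (S @ Q @ z) \<subseteq> W" "partial_path G R V m ((F # bs) @ [S, Q, z])"
      "U \<subseteq> V" "real (card U) \<ge> g * real (card V)"
      "\<And>x v. x \<in> set Q \<Longrightarrow> v \<in> U \<Longrightarrow> \<exists>B. B @ [v] \<in> \<B> \<and> length B = m \<and> x \<in> set B"
      using extend_partial_path[OF ext bs(1) V(1) W_def[unfolded X_def] W \<B>_t \<B>_card[unfolded n_def]] by metis
    have U: "absorbs m G Q v \<and> v \<in> D" if v: "v \<in> U" for v
    proof -
      have *: "{v, x} \<in> G \<and> v \<in> D" if x: "x \<in> set Q" for x
      proof -
        obtain B where B: "B @ [v] \<in> \<B>" "length B = m" "x \<in> set B" using e(9)[OF x v] by blast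
        then have "B \<in> cliques G (replicate m (W \<inter> neighbours G v))" "v \<in> D"
          by (auto simp: \<B>_def absorbing_cliques_def)
        then show ?thesis using B(2,3) by (auto simp: cliques_def in_set_conv_nth neighbours_def)
      qed
      have "Q \<noteq> []" using e(2) m by auto
      then show ?thesis using * e(2) unfolding absorbs_def by (metis list.set_intros(1) mult_1_right neq_Nil_conv)
    qed
    define bs' where "bs' = bs @ [S, Q, z]"
    have "\<Psi> (F # bs) + card U \<le> \<Psi> (F # bs')"
    proof -
      have "\<Psi> (F # bs) + card U = (\<Sum>v\<in>V. min (absorb_count m G (F # bs) v) \<tau> + (if v \<in> U then 1 else 0))"
        using V(1) e(7) by (simp add: \<Psi>_def sum.distrib sum.If_cases Int_absorb1)
      also have "\<dots> \<le> \<Psi> (F # bs')"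
        unfolding \<Psi>_def
      proof (rule sum_mono)
        fix v assume "v \<in> V"
        have ac: "absorb_count m G (F # bs') v = absorb_count m G (F # bs) v + absorb_count m G [S, Q, z] v"
          using absorb_count_append[of m G "F # bs" "[S, Q, z]" v] by (simp add: bs'_def)
        show "min (absorb_count m G (F # bs) v) \<tau> + (if v \<in> U then 1 else 0) \<le> min (absorb_count m G (F # bs') v) \<tau>"
        proof (cases "v \<in> U")
          case True
          then have "1 \<le> absorb_count m G [S, Q, z] v" using U by (auto simp: absorb_count_def)
          moreover have "absorb_count m G (F # bs) v < \<tau>" using U[OF True] by (simp add: D_def)
          ultimately show ?thesis using True ac by simp
        qed (simp add: ac)
      qed
      finally show ?thesis .
    qed
    then have "real (\<Psi> (F # bs)) + real (card U) \<le> real (\<Psi> (F # bs'))"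
      by (metis of_nat_add of_nat_le_iff)
    then have "g * n * real (Suc j) \<le> real (\<Psi> (F # bs'))"
      using bs(3) e(8) by (simp add: n_def algebra_simps)
    moreover have "partial_path G R V m (F # bs')" using e(6) by (simp add: bs'_def)
    moreover have "length (concat (F # bs')) = m + L * Suc j"
      using bs(2) e(1-3) by (simp add: bs'_def L)
    ultimately have "P (Suc j)" unfolding P_def by blast
    then show False using j(2)[of "Suc j"] by simp
  qed
  then show ?thesis using bs(1) len unfolding D_def n_def by blast
qed

text \<open>
  For each vertex of \<open>D\<close> there are many cliques in its neighbourhood, so a segment with an
  absorbing block for it exists, and the vertex is inserted into this block at once.
\<close>
lemma cover_set:
  assumes m: "2 \<le> m" and V: "finite V" "V \<noteq> {}" and \<epsilon>: "0 < \<epsilon>" "\<epsilon> \<le> 1 / real m"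
    and ext: "extendable G R V m \<epsilon> 1 (1 / 2) c g" and c: "c \<le> (\<epsilon> / 2) ^ m" and g: "0 < g"
    and room: "\<And>X. X \<subseteq> V \<Longrightarrow> real (card X) \<le> K \<Longrightarrow>
       min_density G V (V - X) (1 - 1 / real m + \<epsilon>) \<and> real (card (V - X)) \<ge> 1 / 2 * real (card V)"
    and start: "partial_path G R V m bs"
    and L: "L = 2 * m * (m + 1) + 2 * m + m"
    and D: "finite D" "D \<subseteq> V" "real (length (concat bs)) + real (Suc L) * real (card D) \<le> K"
  shows "\<exists>bs'. partial_path G R V m (bs @ bs') \<and> D \<subseteq> set (concat (bs @ bs')) \<and>
           length (concat (bs @ bs')) \<le> length (concat bs) + Suc L * card D"
  using D
proof (induction D rule: finite_induct)
  case empty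
  then show ?case using start by (intro exI[of _ "[]"]) auto
next
  case (insert v D)
  have cD: "card (insert v D) = Suc (card D)" using insert.hyps by simp
  have "real (length (concat bs)) + real (Suc L) * real (card D) \<le> K"
    using insert.prems(2) unfolding cD by (simp add: algebra_simps)
  then obtain bs' where bs': "partial_path G R V m (bs @ bs')" "D \<subseteq> set (concat (bs @ bs'))"
    "length (concat (bs @ bs')) \<le> length (concat bs) + Suc L * card D"
    using insert.IH insert.prems(1) by auto
  show ?case
  proof (cases "v \<in> set (concat (bs @ bs'))")
    case True
    then show ?thesis using bs' cD by (intro exI[of _ bs']) auto
  next
    case False
    define X W where "X = set (concat (bs @ bs'))" and "W = V - X"
    have XV: "X \<subseteq> V" using bs'(1) unfolding partial_path_def X_def by blast
    have "card X \<le> length (concat (bs @ bs'))" unfolding X_def by (rule card_length)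
    then have "card X \<le> length (concat bs) + Suc L * card D" using bs'(3) by simp
    then have "real (card X) \<le> real (length (concat bs) + Suc L * card D)" by (rule of_nat_mono)
    also have "\<dots> \<le> K" using insert.prems(2) unfolding cD by (simp add: algebra_simps)
    finally have W: "min_density G V W (1 - 1 / real m + \<epsilon>)" "real (card W) \<ge> 1 / 2 * real (card V)"
      using room[OF XV] by (auto simp: W_def)
    have v: "v \<in> V" using insert.prems(1) by simp
    define n where "n = real (card V)"
    have n: "n > 0" using V by (simp add: n_def card_gt_0_iff)
    define Us where "Us = replicate m (W \<inter> neighbours G v)"
    define \<B> where "\<B> = tagged_cliques G V Us"
    have \<B>_t: "\<B> \<in> targets G V m W" by (auto simp: targets_def \<B>_def Us_def tuples_def)
    have "real (card (cliques G Us)) \<ge> (\<epsilon> * real (card W)) ^ m"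
      unfolding Us_def using m \<epsilon> v by (intro card_star_cliques[OF W(1) V(1)]) (auto simp: W_def)
    moreover have "(\<epsilon> * real (card W)) ^ m \<ge> (\<epsilon> / 2 * n) ^ m"
      using W(2) \<epsilon> n by (intro power_mono) (auto simp: n_def)
    ultimately have "(\<epsilon> / 2 * n) ^ m * n \<le> real (card (cliques G Us)) * n"
      using n by (intro mult_right_mono) auto
    moreover have "(\<epsilon> / 2) ^ m * n ^ (m + 1) = (\<epsilon> / 2 * n) ^ m * n"
      by (simp only: power_mult_distrib power_add power_one_right mult_ac)
    moreover have "real (card \<B>) = real (card (cliques G Us)) * n"
      using V(1) by (simp add: \<B>_def card_tagged_cliques n_def)
    ultimately have "(\<epsilon> / 2) ^ m * n ^ (m + 1) \<le> real (card \<B>)" by linarith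
    moreover have "c * n ^ (m + 1) \<le> (\<epsilon> / 2) ^ m * n ^ (m + 1)" using c n by (intro mult_right_mono) auto
    ultimately have \<B>_card: "c * n ^ (m + 1) \<le> real (card \<B>)" by linarith
    obtain S Q z U where e: "length S = 2 * m * (m + 1)" "length Q = 2 * m * 1" "length z = m"
      "distinct (S @ Q @ z)" "set (S @ Q @ z) \<subseteq> W" "partial_path G R V m ((bs @ bs') @ [S, Q, z])"
      "U \<subseteq> V" "real (card U) \<ge> g * real (card V)"
      "\<And>x v. x \<in> set Q \<Longrightarrow> v \<in> U \<Longrightarrow> \<exists>B. B @ [v] \<in> \<B> \<and> length B = m \<and> x \<in> set B"
      using extend_partial_path[OF ext bs'(1) V(1) W_def[unfolded X_def] W \<B>_t \<B>_card[unfolded n_def]] by metis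
    have "0 < g * real (card V)" using g n by (simp add: n_def)
    then have "U \<noteq> {}" using e(8) by auto
    then obtain u where "u \<in> U" by blast
    have Q: "absorbs m G Q v"
      unfolding absorbs_def
    proof (intro conjI ballI)
      fix x assume "x \<in> set Q"
      then obtain B where "B @ [u] \<in> \<B>" "length B = m" "x \<in> set B" using e(9) \<open>u \<in> U\<close> by blast
      then show "{v, x} \<in> G"
        by (auto simp: \<B>_def tagged_cliques_def cliques_def Us_def in_set_conv_nth neighbours_def)
    qed (use e(2) in simp)
    have len: "length (concat ((bs @ bs') @ [S, Q, z])) \<le> length (concat bs) + Suc L * card D + L"
      using bs'(3) e(1-3) by (simp add: L)
    show ?thesis
    proof (cases "v \<in> set (S @ Q @ z)")
      case True
      then show ?thesis using e(6) bs'(2) len cD by (intro exI[of _ "bs' @ [S, Q, z]"]) auto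
    next
      case nv: False
      define Q' where "Q' = take m Q @ v # drop m Q"
      have setQ: "set Q' = insert v (set Q)"
      proof -
        have "set Q = set (take m Q) \<union> set (drop m Q)" by (metis append_take_drop_id set_append)
        then show ?thesis by (auto simp: Q'_def)
      qed
      have pp: "power_path m (G \<union> R) (concat (bs @ bs' @ [S, Q', z]))"
      proof -
        have "power_path m (G \<union> R) ((concat (bs @ bs') @ S) @ Q @ z)"
          using e(6) by (simp add: partial_path_def)
        from power_path_absorb[OF this Q] show ?thesis by (simp add: Q'_def)
      qed
      have dist: "distinct (concat (bs @ bs' @ [S, Q', z]))"
      proof -
        have d: "distinct (concat ((bs @ bs') @ [S, Q, z]))" using e(6) by (simp add: partial_path_def)
        then have "distinct (take m Q @ drop m Q)" by simp
        then have "distinct Q'" using nv unfolding Q'_def distinct_append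
          by (auto dest: in_set_takeD in_set_dropD)
        then show ?thesis using d nv False setQ by auto
      qed
      have "set (concat (bs @ bs' @ [S, Q', z])) \<subseteq> V"
        using e(6) v setQ by (auto simp: partial_path_def)
      then have "partial_path G R V m (bs @ bs' @ [S, Q', z])"
        using pp dist start unfolding partial_path_def by simp
      moreover have "insert v D \<subseteq> set (concat (bs @ bs' @ [S, Q', z]))" using bs'(2) setQ by auto
      moreover have "length (concat (bs @ bs' @ [S, Q', z])) \<le> length (concat bs) + Suc L * card (insert v D)"
        using len unfolding cD by (simp add: Q'_def)
      ultimately show ?thesis by (intro exI[of _ "bs' @ [S, Q', z]"]) auto
    qed
  qed
qed

text \<open>
  The last segment runs around a clique that fits before the first block \<open>F\<close>; its final clique
  \<open>z\<close> is dropped. All vertices still missing, including those of \<open>z\<close>, lie in \<open>W\<close> and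
  are absorbed by blocks of the path.
\<close>
lemma close_and_absorb:
  assumes m: "2 \<le> m" and n: "m < n" and G: "G \<in> graphs n" "R \<subseteq> all_edges n" and V: "V = {1..n}"
    and \<epsilon>: "0 < \<epsilon>" "\<epsilon> \<le> 1 / real m" and t: "1 \<le> t" and \<omega>: "0 < \<omega>"
    and ext: "extendable G R V m \<epsilon> t \<omega> c g" and c: "c \<le> (\<epsilon> * \<omega>) ^ m"  and g: "0 < g"
    and part: "partial_path G R V m bs"
    and W: "W = V - set (concat bs)" "min_density G V W (1 - 1 / real m + \<epsilon>)" "real (card W) \<ge> \<omega> * real (card V)"
    and absorb: "\<And>v. v \<in> W \<Longrightarrow> card W \<le> absorb_count m G bs v"
  shows "G \<union> R \<in> power_ham m n"
proof -
  have finV: "finite V" "V \<noteq> {}" using V n by auto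
  have cV: "card V = n" by (simp add: V)
  obtain F bs0 where bs: "bs = F # bs0" "length F = m" using part by (cases bs) (auto simp: partial_path_def)
  have p: "distinct (concat bs)" "set (concat bs) \<subseteq> V" "power_path m (G \<union> R) (concat bs)"
    using part by (auto simp: partial_path_def)
  have F: "F \<in> tuples V m" using p(2) bs by (auto simp: tuples_def)
  define Us where "Us = closing_sets G W F"
  define \<B> where "\<B> = tagged_cliques G V Us"
  have WV: "W \<subseteq> V" using W(1) by blast
  have \<B>_t: "\<B> \<in> targets G V m W"
    using bs(2) by (auto simp: targets_def \<B>_def Us_def closing_sets_def tuples_def)
  have "real (card (cliques G Us)) \<ge> (\<epsilon> * real (card W)) ^ m"
    unfolding Us_def using m \<epsilon> by (intro card_closing_cliques[OF W(2) finV(1) WV F]) auto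
  moreover have "(\<epsilon> * real (card W)) ^ m \<ge> (\<epsilon> * \<omega> * real n) ^ m"
    using W(3) \<epsilon> \<omega> by (intro power_mono) (auto simp: cV mult.assoc)
  ultimately have "(\<epsilon> * \<omega> * real n) ^ m * real n \<le> real (card (cliques G Us)) * real n"
    by (intro mult_right_mono) auto
  moreover have "(\<epsilon> * \<omega>) ^ m * real n ^ (m + 1) = (\<epsilon> * \<omega> * real n) ^ m * real n"
    by (simp only: power_mult_distrib power_add power_one_right mult_ac)
  moreover have "real (card \<B>) = real (card (cliques G Us)) * real n"
    using finV(1) by (simp add: \<B>_def card_tagged_cliques cV)
  ultimately have "(\<epsilon> * \<omega>) ^ m * real n ^ (m + 1) \<le> real (card \<B>)" by linarith
  moreover have "c * real n ^ (m + 1) \<le> (\<epsilon> * \<omega>) ^ m * real n ^ (m + 1)" using c by (intro mult_right_mono) auto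
  ultimately have \<B>_card: "c * real (card V) ^ (m + 1) \<le> real (card \<B>)" unfolding cV by linarith
  obtain S Q z U where e: "length S = 2 * m * (m + 1)" "length Q = 2 * m * t" "length z = m"
      "distinct (S @ Q @ z)" "set (S @ Q @ z) \<subseteq> W" "partial_path G R V m (bs @ [S, Q, z])"
      "U \<subseteq> V" "real (card U) \<ge> g * real (card V)"
      "\<And>i. i < 2 * m \<Longrightarrow> \<exists>B v. B @ [v] \<in> \<B> \<and> length B = m \<and> Q ! (2 * m * (t - 1) + i) = B ! (i div 2)"
    using extend_partial_path[OF ext part finV(1) W \<B>_t \<B>_card] by metis
  have ppF: "power_path m (G \<union> R) F" using p(3) bs(1) by (simp add: power_path_prefix)
  have "power_path m (G \<union> R) ((concat bs @ S @ Q) @ z)" using e(6) by (simp add: partial_path_def)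
  then have ppQ: "power_path m (G \<union> R) ((concat bs @ S) @ Q)" using power_path_prefix by fastforce
  have tm: "2 * m * t = 2 * m * (t - 1) + 2 * m" using t by (cases t) auto
  have QF: "power_path m (G \<union> R) (Q @ F)"
    unfolding power_path_iff_nth
  proof (intro allI impI)
    fix i j assume ij: "i < j" "j < length (Q @ F)" "j \<le> i + m"
    consider "j < length Q" | "i < length Q" "length Q \<le> j" | "length Q \<le> i" by linarith
    then show "{(Q @ F) ! i, (Q @ F) ! j} \<in> G \<union> R"
    proof cases
      case 1
      have "power_path m (G \<union> R) Q" using ppQ by (rule power_path_suffix)
      then show ?thesis using 1 ij unfolding power_path_iff_nth by (simp add: nth_append)
    next
      case 2
      define j' i' where "j' = j - length Q" and "i' = i - 2 * m * (t - 1)"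
      have j': "j' < m" using ij bs(2) 2 by (simp add: j'_def)
      have "length Q + j' \<le> i + m" using ij 2 by (simp add: j'_def)
      then have i': "i = 2 * m * (t - 1) + i'" "i' < 2 * m" "m + j' \<le> i'"
        using 2 e(2) tm by (auto simp: i'_def)
      obtain B v where B: "B @ [v] \<in> \<B>" "length B = m" "Q ! i = B ! (i' div 2)" using e(9) i' by blast
      have "B \<in> cliques G Us" using B(1) by (auto simp: \<B>_def tagged_cliques_def)
      moreover have "length Us = m" using bs(2) by (simp add: Us_def closing_sets_def)
      ultimately have "B ! (i' div 2) \<in> Us ! (i' div 2)" using i' by (auto simp: cliques_def)
      moreover have "i' div 2 < m" using i' by linarith
      ultimately have "\<forall>f\<in>set (take (Suc (i' div 2)) F). {f, Q ! i} \<in> G"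
        using B(3) bs(2) by (simp add: Us_def closing_sets_def)
      moreover have "F ! j' \<in> set (take (Suc (i' div 2)) F)"
      proof -
        have "j' < Suc (i' div 2)" using i' j' by linarith
        then show ?thesis using j' bs(2) by (auto simp: in_set_conv_nth intro!: exI[of _ j'])
      qed
      ultimately have "{F ! j', Q ! i} \<in> G" by blast
      then show ?thesis using 2 by (simp add: nth_append j'_def insert_commute)
    next
      case 3
      then show ?thesis using ppF ij bs(2) unfolding power_path_iff_nth by (auto simp: nth_append)
    qed
  qed
  define bs1 where "bs1 = bs0 @ [S, Q]"
  have "m \<le> length Q" using e(2) t by (simp add: tm)
  then have "power_path m (G \<union> R) ((concat bs @ S) @ Q @ F)" by (rule power_path_glue[OF ppQ QF])
  then have pp1: "power_path m (G \<union> R) (F @ concat bs1 @ F)" by (simp add: bs1_def bs(1))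
  have e6: "distinct (concat (bs @ [S, Q, z]))" "set (concat (bs @ [S, Q, z])) \<subseteq> V"
    using e(6) by (simp_all add: partial_path_def)
  define L where "L = V - set F - set (concat bs1)"
  have L: "L \<subseteq> W" by (auto simp: L_def W(1) bs(1) bs1_def)
  have finW: "finite W" using finV(1) WV finite_subset by blast
  have "\<exists>zs. distinct zs \<and> set zs = set (concat bs1) \<union> L \<and> power_path m (G \<union> R) (F @ zs @ F)"
  proof (rule absorb_all[where G = G])
    show "finite L" using L finW finite_subset by blast
    show "distinct (concat bs1)" using e6(1) by (auto simp: bs1_def bs(1))
    fix v assume "v \<in> L"
    then have "v \<in> W" using L by blast
    then have "card W \<le> absorb_count m G bs v" by (rule absorb)
    moreover have "card L \<le> card W" using L finW by (rule card_mono[rotated])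
    moreover have "absorb_count m G bs v = absorb_count m G bs0 v"
      using m bs by (simp add: absorb_count_def absorbs_def)
    moreover have "absorb_count m G bs0 v \<le> absorb_count m G bs1 v"
      unfolding bs1_def absorb_count_append by simp
    ultimately show "card L \<le> length (filter (\<lambda>b. absorbs m G b v) bs1)"
      unfolding absorb_count_def by linarith
  qed (auto simp: L_def pp1)
  then obtain zs where zs: "distinct zs" "set zs = set (concat bs1) \<union> L" "power_path m (G \<union> R) (F @ zs @ F)"
    by blast
  have F_out: "set F \<inter> set (concat bs1) = {}" "distinct F" using e6(1) by (auto simp: bs1_def bs(1))
  have sub: "set F \<subseteq> V" "set (concat bs1) \<subseteq> V" using e6(2) by (auto simp: bs1_def bs(1))
  show ?thesis
  proof (rule power_hamI)
    show "G \<union> R \<in> graphs n" using G by (auto simp: graphs_def)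
    show "distinct (F @ zs)" using F_out zs(1,2) by (auto simp: L_def)
    show "set (F @ zs) = {1..n}" using zs(2) sub V by (auto simp: L_def)
    show "power_path m (G \<union> R) ((F @ zs) @ take m (F @ zs))" using zs(3) bs(2) by simp
  qed (use m n in auto)
qed

text \<open>
  The sets of \<open>low_cost_sets\<close> with \<open>p\<close> a small multiple of \<open>card W\<close>: large enough to give
  densely many cliques, and small enough to exceed the average cost only slightly.
\<close>
lemma cheap_target:
  assumes m: "0 < m" and V: "finite V" "V \<noteq> {}" "W \<subseteq> V" and \<epsilon>: "0 < \<epsilon>" "\<epsilon> \<le> 1 / real m"
    and dens: "min_density G V W (1 - 1 / real m + \<epsilon>)" and \<delta>: "0 < \<delta>" "\<delta> \<le> 1" and \<mu>: "0 < \<mu>"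
    and W: "real (card W) \<ge> \<mu> / 2 * real (card V)" and large: "\<delta> * \<mu> * real (card V) \<ge> 32 * real m"
  shows "\<exists>\<B>\<in>targets G V m W. real (card \<B>) \<ge> (\<delta> * \<mu> / (16 * real m)) ^ m * real (card V) ^ (m + 1) \<and>
    (\<forall>B v. B @ [v] \<in> \<B> \<longrightarrow> length B = m \<longrightarrow> sum_list (map (cost \<eta> G V W) B) \<le>
       real m * ((\<Sum>u\<in>W. cost \<eta> G V W u) / real (card W) + \<delta> / 2 * potential \<eta> G V W))"
proof -
  define n w where "n = real (card V)" and "w = real (card W)"
  have n: "n > 0" using V by (simp add: n_def card_gt_0_iff)
  have w: "w \<ge> \<mu> / 2 * n" "w > 0" using W mult_pos_pos[OF \<mu> n] by (auto simp: n_def w_def)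
  have finW: "finite W" using V finite_subset by blast
  define x0 where "x0 = \<delta> * w / (4 * real m)"
  define p where "p = nat \<lfloor>x0\<rfloor>"
  have "\<delta> * (\<mu> / 2 * n) \<le> \<delta> * w" using w(1) \<delta>(1) by (intro mult_left_mono) auto
  then have dw: "\<delta> * \<mu> * n / 2 \<le> \<delta> * w" by simp
  then have "16 * real m \<le> \<delta> * w" using large by (simp add: n_def)
  then have x0: "4 \<le> x0" using m by (simp add: x0_def field_simps)
  then have p: "real p \<le> x0" "x0 < real p + 1" unfolding p_def by linarith+
  then have p1: "1 \<le> p" using x0 by linarith
  have "x0 \<le> w / real m" using \<delta> w(2) m by (simp add: x0_def field_simps)
  then have pw: "real p \<le> real (card W) / real m" using p by (simp add: w_def)
  have miss: "real (card (W - neighbours G v)) \<le> real (card W) / real m" if "v \<in> V" for v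
  proof -
    have "card (W - neighbours G v) = card W - card (W \<inter> neighbours G v)" using finW by (metis card_Diff_subset_Int finite_Int)
    moreover have "card (W \<inter> neighbours G v) \<le> card W" using finW by (intro card_mono) auto
    moreover have "(1 - 1 / real m + \<epsilon>) * w \<le> real (card (W \<inter> neighbours G v))"
      using dens that unfolding min_density_def w_def by blast
    ultimately have "real (card (W - neighbours G v)) \<le> w - (1 - 1 / real m + \<epsilon>) * w" by (simp add: w_def of_nat_diff)
    also have "\<dots> = w / real m - \<epsilon> * w" by (simp add: algebra_simps)
    also have "\<dots> \<le> w / real m" using \<epsilon> w by simp
    finally show ?thesis by (simp add: w_def)
  qed
  define y where "y = cost \<eta> G V W"
  have y0: "0 \<le> y u" for u unfolding y_def by (rule cost_nonneg)
  have "\<exists>U. (\<forall>j<m. U j \<subseteq> W) \<and>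
    (\<forall>j<m. \<forall>S\<subseteq>V. finite S \<longrightarrow> card S \<le> j \<longrightarrow> real p - 1 \<le> real (card {x \<in> U j. \<forall>s\<in>S. {s, x} \<in> G})) \<and>
    (\<forall>b. (\<forall>j<m. b j \<in> U j) \<longrightarrow> (real (card W) / real m - real p) * (\<Sum>j<m. y (b j)) \<le> (\<Sum>u\<in>W. y u))"
    by (rule low_cost_sets[OF m finW y0 p1 pw miss])
  then obtain U where U0: "\<forall>j<m. U j \<subseteq> W"
    "\<forall>j<m. \<forall>S\<subseteq>V. finite S \<longrightarrow> card S \<le> j \<longrightarrow> real p - 1 \<le> real (card {x \<in> U j. \<forall>s\<in>S. {s, x} \<in> G})"
    "\<forall>b. (\<forall>j<m. b j \<in> U j) \<longrightarrow> (real (card W) / real m - real p) * (\<Sum>j<m. y (b j)) \<le> (\<Sum>u\<in>W. y u)"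
    by (elim exE conjE) (rule that)
  note U = U0[rule_format]
  define Us where "Us = map U [0..<m]"
  have lUs: "length Us = m" by (simp add: Us_def)
  define \<B> where "\<B> = tagged_cliques G V Us"
  have "U ` {0..<m} \<subseteq> Pow W" by (rule image_subsetI, rule PowI, rule U(1)) simp
  then have "Us \<in> tuples (Pow W) m" by (simp add: Us_def tuples_def)
  then have \<B>_t: "\<B> \<in> targets G V m W" unfolding targets_def \<B>_def by blast
  have "real (card (cliques G Us)) \<ge> (real p - 1) ^ length Us"
  proof (rule card_cliques[OF V(1)])
    show "U' \<subseteq> V" if a: "U' \<in> set Us" for U'
    proof -
      from a obtain j where "j < m" "U' = U j" by (auto simp: Us_def)
      then show ?thesis using U(1)[of j] V(3) by blast
    qed
    show "0 \<le> real p - 1" using p1 by simp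
    fix j S assume "j < length Us" "S \<subseteq> V" "finite S" "card S \<le> j"
    then show "real p - 1 \<le> real (card {x \<in> Us ! j. \<forall>s\<in>S. {s, x} \<in> G})"
      using U(2)[of j S] by (simp add: Us_def)
  qed
  moreover have "(\<delta> * \<mu> / (16 * real m) * n) ^ m \<le> (real p - 1) ^ m"
  proof (intro power_mono)
    have "\<delta> * \<mu> / (16 * real m) * n = \<delta> * \<mu> * n / 2 / (8 * real m)" by simp
    also have "\<dots> \<le> \<delta> * w / (8 * real m)" using dw m by (intro divide_right_mono) auto
    also have "\<dots> = x0 / 2" by (simp add: x0_def)
    also have "\<dots> \<le> real p - 1" using x0 p by linarith
    finally show "\<delta> * \<mu> / (16 * real m) * n \<le> real p - 1" .
  qed (use \<delta> \<mu> n in auto)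
  ultimately have "(\<delta> * \<mu> / (16 * real m) * n) ^ m * n \<le> real (card (cliques G Us)) * n"
    using n lUs by (intro mult_right_mono) auto
  moreover have "(\<delta> * \<mu> / (16 * real m) * n) ^ m * n = (\<delta> * \<mu> / (16 * real m)) ^ m * n ^ (m + 1)"
    by (simp only: power_mult_distrib power_add power_one_right mult_ac)
  moreover have "real (card \<B>) = real (card (cliques G Us)) * n"
    using V(1) by (simp add: \<B>_def card_tagged_cliques n_def)
  ultimately have \<B>_card: "(\<delta> * \<mu> / (16 * real m)) ^ m * n ^ (m + 1) \<le> real (card \<B>)" by linarith
  define avg where "avg = (\<Sum>u\<in>W. y u) / w"
  define \<Phi> where "\<Phi> = potential \<eta> G V W"
  have avg0: "0 \<le> avg" unfolding avg_def using y0 w by (intro divide_nonneg_pos sum_nonneg) auto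
  have "(\<Sum>u\<in>W. y u) \<le> (\<Sum>u\<in>W. \<Phi>)" unfolding y_def \<Phi>_def by (intro sum_mono cost_le_potential)
  then have avg_le: "avg \<le> \<Phi>" using w by (simp add: avg_def w_def divide_le_eq mult.commute)
  have "sum_list (map y B) \<le> real m * (avg + \<delta> / 2 * \<Phi>)" if B: "B @ [v] \<in> \<B>" "length B = m" for B v
  proof -
    have "B \<in> cliques G Us" using B(1) by (auto simp: \<B>_def tagged_cliques_def)
    then have "\<forall>j<m. B ! j \<in> U j" using lUs by (auto simp: cliques_def Us_def)
    then have "(real (card W) / real m - real p) * (\<Sum>j<m. y (B ! j)) \<le> (\<Sum>u\<in>W. y u)" using U0(3) by simp
    then have le: "(w / real m - real p) * sum_list (map y B) \<le> avg * w"
      using w B(2) by (simp add: avg_def w_def sum_list_sum_nth atLeast0LessThan)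
    have sl0: "0 \<le> sum_list (map y B)" using y0 by (intro sum_list_nonneg) auto
    have "w / real m * (1 - \<delta> / 4) = w / real m - x0" by (simp add: x0_def algebra_simps)
    also have "\<dots> \<le> w / real m - real p" using p by simp
    finally have "w / real m * (1 - \<delta> / 4) * sum_list (map y B) \<le> avg * w"
      using le mult_right_mono[OF _ sl0] by (meson order_trans)
    then have "w * ((1 - \<delta> / 4) * sum_list (map y B)) \<le> w * (real m * avg)" using m by (simp add: field_simps)
    then have a: "(1 - \<delta> / 4) * sum_list (map y B) \<le> real m * avg" using w(2) by simp
    have "sum_list (map y B) \<le> (1 + \<delta> / 2) * ((1 - \<delta> / 4) * sum_list (map y B))"
    proof -
      have "\<delta> * \<delta> \<le> 1 * \<delta>" using \<delta> by (intro mult_right_mono) auto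
      then have "1 \<le> (1 + \<delta> / 2) * (1 - \<delta> / 4)" using \<delta> by (simp add: algebra_simps)
      from mult_right_mono[OF this sl0] show ?thesis by (simp add: mult.assoc)
    qed
    also have "\<dots> \<le> (1 + \<delta> / 2) * (real m * avg)" using a \<delta> by (intro mult_left_mono) auto
    also have "\<dots> = real m * (avg + \<delta> / 2 * avg)" by (simp add: algebra_simps)
    also have "\<dots> \<le> real m * (avg + \<delta> / 2 * \<Phi>)" using avg_le \<delta> by (intro mult_left_mono add_left_mono) auto
    finally show ?thesis .
  qed
  then show ?thesis
    using \<B>_t \<B>_card unfolding avg_def \<Phi>_def y_def n_def w_def by blast
qed

text \<open>
  Segments with cheap targets are added as long as more than \<open>\<mu> / 2 * n\<close> vertices are unvisited.
  Nothing is known about the cost of the connecting parts \<open>S\<close> and \<open>z\<close>, but for large \<open>t\<close>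
  they form only a small proportion of a segment. With \<open>\<eta> = sqrt n\<close> the potential grows by a
  factor of at most \<open>exp (\<kappa> * s)\<close> per segment of \<open>s\<close> vertices, hence by a factor of at most
  \<open>exp (\<kappa> * n)\<close> in total. As every single weight is bounded by the potential, the minimum density
  drops from \<open>\<rho>\<close> by at most \<open>(ln n + \<kappa> * n) / \<eta>\<close>.
\<close>
lemma cover_most:
  fixes n \<mu> \<delta> \<epsilon> \<kappa> \<eta> :: real and s :: nat
  assumes m: "2 \<le> m" and V: "finite V" "V \<noteq> {}" and n: "n = real (card V)" and \<epsilon>: "0 < \<epsilon>" "\<epsilon> \<le> 1 / real m"
    and t: "1 \<le> t" "real (2 * m * (m + 1) + m) \<le> \<delta> * real (m * t)" and s: "s = 2 * m * (m + 1) + 2 * m * t + m"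
    and \<mu>: "0 < \<mu>" and \<delta>: "0 < \<delta>" "\<delta> \<le> 1" and c: "c \<le> (\<delta> * \<mu> / (16 * real m)) ^ m"
    and ext: "extendable G R V m \<epsilon> t (\<mu> / 4) c g"
    and \<eta>: "\<eta> = sqrt n" and \<kappa>: "\<kappa> = 4 * \<eta> * \<delta> / (\<mu> * n) + 16 * real s / (\<mu>\<^sup>2 * n)"
    and large: "\<delta> * \<mu> * n \<ge> 32 * real m" "real s \<le> \<mu> / 4 * n" "\<eta> * (4 * real s / (\<mu> * n)) \<le> 1"
      "ln n + \<kappa> * n \<le> \<eta> * (\<rho> - (1 - 1 / real m + \<epsilon>))"
    and start: "partial_path G R V m bs" and W0: "real (card (V - set (concat bs))) \<ge> \<mu> / 4 * n"
      "min_density G V (V - set (concat bs)) \<rho>"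
  shows "\<exists>bs'. partial_path G R V m (bs @ bs') \<and>
     \<mu> / 4 * n \<le> real (card (V - set (concat (bs @ bs')))) \<and> real (card (V - set (concat (bs @ bs')))) \<le> \<mu> / 2 * n \<and>
     min_density G V (V - set (concat (bs @ bs'))) (1 - 1 / real m + \<epsilon>)"
proof -
  have n0: "n > 0" using V by (simp add: n card_gt_0_iff)
  have \<eta>0: "\<eta> > 0" "\<eta>\<^sup>2 = n" using n0 by (simp_all add: \<eta>)
  have \<kappa>0: "0 \<le> \<kappa>" using \<eta>0 \<mu> \<delta> n0 by (simp add: \<kappa>)
  define rest where "rest bs' = V - set (concat (bs @ bs'))" for bs'
  define Inv where "Inv bs' \<longleftrightarrow> partial_path G R V m (bs @ bs') \<and> \<mu> / 4 * n \<le> real (card (rest bs')) \<and>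
     potential \<eta> G V (rest bs') \<le> n * exp (- \<eta> * \<rho> + \<kappa> * (n - real (card (rest bs'))))" for bs'
  have finr: "finite (rest bs')" for bs' using V(1) by (simp add: rest_def)
  have restV: "rest bs' \<subseteq> V" for bs' by (auto simp: rest_def)
  have pos: "real (card (rest bs')) > 0" if "Inv bs'" for bs'
    using that mult_pos_pos[OF \<mu> n0] by (auto simp: Inv_def)
  have dens: "min_density G V (rest bs') (1 - 1 / real m + \<epsilon>)" if I: "Inv bs'" for bs'
    unfolding min_density_def
  proof
    fix v assume v: "v \<in> V"
    define r where "r = real (card (rest bs' \<inter> neighbours G v)) / real (card (rest bs'))"
    have "exp (- \<eta> * r) \<le> potential \<eta> G V (rest bs')"
      unfolding potential_def r_def using V(1) v
      by (intro order_trans[OF _ member_le_sum[of v]]) (auto simp: weight_def)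
    also have "\<dots> \<le> n * exp (- \<eta> * \<rho> + \<kappa> * (n - real (card (rest bs'))))" using I by (simp add: Inv_def)
    also have "\<dots> \<le> n * exp (- \<eta> * \<rho> + \<kappa> * n)" using n0 \<kappa>0 by (simp add: mult_left_mono)
    also have "\<dots> = exp (ln n + (- \<eta> * \<rho> + \<kappa> * n))" using n0 by (simp only: exp_add exp_ln)
    finally have "- \<eta> * r \<le> ln n + (- \<eta> * \<rho> + \<kappa> * n)" by simp
    then have "\<eta> * (1 - 1 / real m + \<epsilon>) \<le> \<eta> * r" using large(4) by (simp add: algebra_simps)
    then have "1 - 1 / real m + \<epsilon> \<le> r" using \<eta>0(1) by simp
    then show "(1 - 1 / real m + \<epsilon>) * real (card (rest bs')) \<le> real (card (rest bs' \<inter> neighbours G v))"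
      using pos[OF I] unfolding r_def by (simp add: pos_le_divide_eq)
  qed
  have "Inv []"
  proof -
    have r0: "rest [] = V - set (concat bs)" by (simp add: rest_def)
    have cpos: "real (card (rest [])) > 0" using W0(1) mult_pos_pos[OF \<mu> n0] unfolding r0 by linarith
    have "weight \<eta> G (rest []) v \<le> exp (- \<eta> * \<rho>)" if "v \<in> V" for v
    proof -
      have "\<rho> * real (card (rest [])) \<le> real (card (rest [] \<inter> neighbours G v))"
        using W0(2) that unfolding min_density_def r0 by blast
      then have "\<rho> \<le> real (card (rest [] \<inter> neighbours G v)) / real (card (rest []))"
        using cpos by (simp add: pos_le_divide_eq)
      from mult_left_mono[OF this, of \<eta>] show ?thesis using \<eta>0(1) by (simp add: weight_def)
    qed
    then have "potential \<eta> G V (rest []) \<le> (\<Sum>v\<in>V. exp (- \<eta> * \<rho>))" unfolding potential_def by (rule sum_mono)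
    also have "\<dots> = n * exp (- \<eta> * \<rho>)" by (simp add: n)
    also have "\<dots> \<le> n * exp (- \<eta> * \<rho> + \<kappa> * (n - real (card (rest []))))"
      using n0 \<kappa>0 card_mono[OF V(1) restV] by (simp add: n)
    finally show ?thesis using start W0(1) unfolding Inv_def r0 by simp
  qed
  then obtain bs' where I: "Inv bs'" and min: "\<And>bs''. Inv bs'' \<Longrightarrow> card (rest bs') \<le> card (rest bs'')"
    using ex_has_least_nat[of Inv "[]" "\<lambda>bs'. card (rest bs')"] by blast
  have "real (card (rest bs')) \<le> \<mu> / 2 * n"
  proof (rule ccontr)
    assume many: "\<not> real (card (rest bs')) \<le> \<mu> / 2 * n"
    define W w where "W = rest bs'" and "w = real (card W)"
    have w: "\<mu> / 2 * n < w" using many by (simp add: W_def w_def)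
    have d: "min_density G V W (1 - 1 / real m + \<epsilon>)" unfolding W_def by (rule dens[OF I])
    define avg \<Phi> where "avg = (\<Sum>u\<in>W. cost \<eta> G V W u) / w" and "\<Phi> = potential \<eta> G V W"
    have "0 < m" using m by simp
    have "\<mu> / 2 * real (card V) \<le> real (card W)" using w by (simp add: n w_def)
    from cheap_target[OF \<open>0 < m\<close> V restV \<epsilon> dens[OF I] \<delta> \<mu> this[unfolded W_def] large(1)[unfolded n], of \<eta>]
    obtain \<B> where \<B>: "\<B> \<in> targets G V m W" "real (card \<B>) \<ge> (\<delta> * \<mu> / (16 * real m)) ^ m * real (card V) ^ (m + 1)"
      "\<And>B v. B @ [v] \<in> \<B> \<Longrightarrow> length B = m \<Longrightarrow> sum_list (map (cost \<eta> G V W) B) \<le> real m * (avg + \<delta> / 2 * \<Phi>)"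
      unfolding W_def[symmetric] avg_def \<Phi>_def w_def by blast
    have "c * real (card V) ^ (m + 1) \<le> (\<delta> * \<mu> / (16 * real m)) ^ m * real (card V) ^ (m + 1)"
      using c by (intro mult_right_mono) auto
    then have \<B>_card: "c * real (card V) ^ (m + 1) \<le> real (card \<B>)" using \<B>(2) by linarith
    have part: "partial_path G R V m (bs @ bs')" using I by (simp add: Inv_def)
    have W4: "\<mu> / 4 * real (card V) \<le> real (card W)" using I by (simp add: Inv_def W_def n)
    show False
    proof (rule extend_partial_path[OF ext part V(1) W_def[unfolded rest_def] d W4 \<B>(1) \<B>_card])
      fix S Q z U assume e: "length S = 2 * m * (m + 1)" "length Q = 2 * m * t" "length z = m"
        "distinct (S @ Q @ z)" "set (S @ Q @ z) \<subseteq> W" "partial_path G R V m ((bs @ bs') @ [S, Q, z])"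
        and Q_cost: "\<And>(f :: 'a \<Rightarrow> real) b. (\<And>B v. B @ [v] \<in> \<B> \<Longrightarrow> length B = m \<Longrightarrow> sum_list (map f B) \<le> b) \<Longrightarrow> sum_list (map f Q) \<le> 2 * real t * b"
      define T where "T = set (S @ Q @ z)"
      have cT: "card T = s" unfolding T_def using distinct_card[OF e(4)] e(1-3) by (simp add: s)
      have finW: "finite W" unfolding W_def by (rule finr)
      have "real s < w"
      proof -
        have "\<mu> / 4 * n < \<mu> / 2 * n" using \<mu> n0 by simp
        then show ?thesis using large(2) w by linarith
      qed
      then have cTW: "card T < card W" by (simp add: cT w_def)
      have ws: "real (card W - card T) = w - real s" using cTW by (simp add: w_def cT of_nat_diff)
      define q where "q = real (card T) / real (card W - card T)"
      have "\<mu> / 4 * n \<le> w - real s" using large(2) w by (simp add: field_simps)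
      moreover have "0 < \<mu> / 4 * n" using \<mu> n0 by simp
      ultimately have "real s / (w - real s) \<le> real s / (\<mu> / 4 * n)"
        by (intro frac_le) auto
      then have q: "q \<le> 4 * real s / (\<mu> * n)" "0 \<le> q" using \<open>real s < w\<close> by (auto simp: q_def cT ws[unfolded cT] mult.commute[of "real s" 4])
      have \<Phi>0: "0 \<le> \<Phi>" unfolding \<Phi>_def by (rule potential_nonneg)
      have avg0: "0 \<le> avg" unfolding avg_def w_def by (intro divide_nonneg_nonneg sum_nonneg cost_nonneg) auto
      have triv: "sum_list (map (cost \<eta> G V W) xs) \<le> real (length xs) * \<Phi>" for xs
      proof (induction xs)
        case (Cons x xs)
        then show ?case using cost_le_potential[of \<eta> G V W x] by (simp add: \<Phi>_def algebra_simps)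
      qed simp
      have cheap: "(\<Sum>u\<in>T. cost \<eta> G V W u) \<le> real (card T) * ((\<Sum>u\<in>W. cost \<eta> G V W u) / real (card W) + \<delta> * potential \<eta> G V W)"
      proof -
        have qc: "sum_list (map (cost \<eta> G V W) Q) \<le> 2 * real t * (real m * (avg + \<delta> / 2 * \<Phi>))"
          by (rule Q_cost, rule \<B>(3))
        have "(\<Sum>u\<in>T. cost \<eta> G V W u) = sum_list (map (cost \<eta> G V W) (S @ Q @ z))"
          unfolding T_def using sum_list_distinct_conv_sum_set[OF e(4)] by metis
        also have "\<dots> = sum_list (map (cost \<eta> G V W) S) + sum_list (map (cost \<eta> G V W) Q) + sum_list (map (cost \<eta> G V W) z)" by simp
        also have "\<dots> \<le> real (2 * m * (m + 1)) * \<Phi> + 2 * real t * (real m * (avg + \<delta> / 2 * \<Phi>)) + real m * \<Phi>"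
          using triv[of S, unfolded e(1)] triv[of z, unfolded e(3)] qc by (intro add_mono)
        also have "\<dots> = real (2 * m * (m + 1) + m) * \<Phi> + real (m * t) * \<delta> * \<Phi> + real (2 * m * t) * avg"
          by (simp add: algebra_simps)
        also have "\<dots> \<le> \<delta> * real (m * t) * \<Phi> + real (m * t) * \<delta> * \<Phi> + real (2 * m * t) * avg"
          by (intro add_right_mono mult_right_mono t(2) \<Phi>0)
        also have "\<dots> = real (2 * m * t) * (\<delta> * \<Phi>) + real (2 * m * t) * avg" by (simp add: algebra_simps)
        also have "\<dots> \<le> real s * (\<delta> * \<Phi>) + real s * avg"
        proof (intro add_mono mult_right_mono)
          show "real (2 * m * t) \<le> real s" "real (2 * m * t) \<le> real s" unfolding s by (intro of_nat_mono; simp)+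
        qed (use avg0 \<Phi>0 \<delta> in auto)
        also have "\<dots> = real s * (avg + \<delta> * \<Phi>)" by (simp add: algebra_simps)
        finally show ?thesis by (simp add: cT avg_def \<Phi>_def w_def)
      qed
      have \<eta>q: "\<eta> * q \<le> 1" "0 \<le> \<eta> * q"
        using mult_left_mono[OF q(1), of \<eta>] large(3) \<eta>0(1) q(2) by auto
      have TW: "T \<subseteq> W" using e(5) by (simp add: T_def)
      define bs'' where "bs'' = bs' @ [S, Q, z]"
      have r'': "rest bs'' = W - T" by (auto simp: rest_def W_def bs''_def T_def)
      have c'': "real (card (rest bs'')) = w - real s"
      proof -
        have "finite T" using TW finW finite_subset by blast
        then have "card (W - T) = card W - card T" using TW by (rule card_Diff_subset)
        then show ?thesis unfolding r'' using ws by simp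
      qed
      have "potential \<eta> G V (W - T) \<le> \<Phi> * (1 + \<eta> * \<delta> * q + (\<eta> * q)\<^sup>2)"
        unfolding \<Phi>_def q_def using \<eta>0(1) \<eta>q(1) by (intro potential_step[OF finW TW cTW _ _ cheap]) (auto simp: q_def)
      also have "\<dots> \<le> \<Phi> * exp (\<kappa> * real s)"
      proof (rule mult_left_mono[OF _ \<Phi>0])
        have "1 + (\<eta> * \<delta> * q + (\<eta> * q)\<^sup>2) \<le> exp (\<eta> * \<delta> * q + (\<eta> * q)\<^sup>2)" by (rule exp_ge_add_one_self)
        also have "\<eta> * \<delta> * q + (\<eta> * q)\<^sup>2 \<le> \<kappa> * real s"
        proof -
          have "\<eta> * \<delta> * q \<le> \<eta> * \<delta> * (4 * real s / (\<mu> * n))" using q(1) \<eta>0 \<delta> by (intro mult_left_mono) auto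
          moreover have "(\<eta> * q)\<^sup>2 \<le> (\<eta> * (4 * real s / (\<mu> * n)))\<^sup>2"
            using \<eta>q(2) mult_left_mono[OF q(1), of \<eta>] \<eta>0(1) by (intro power_mono) auto
          moreover have "(\<eta> * (4 * real s / (\<mu> * n)))\<^sup>2 = n * (4 * real s / (\<mu> * n))\<^sup>2"
            by (simp only: power_mult_distrib \<eta>0(2))
          moreover have "n * (4 * real s / (\<mu> * n))\<^sup>2 = 16 * real s / (\<mu>\<^sup>2 * n) * real s"
            using n0 \<mu> by (simp add: power2_eq_square field_simps)
          moreover have "\<eta> * \<delta> * (4 * real s / (\<mu> * n)) = 4 * \<eta> * \<delta> / (\<mu> * n) * real s" by simp
          moreover have "\<kappa> * real s = 4 * \<eta> * \<delta> / (\<mu> * n) * real s + 16 * real s / (\<mu>\<^sup>2 * n) * real s"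
            unfolding \<kappa> by (rule distrib_right)
          ultimately show ?thesis by linarith
        qed
        then have "exp (\<eta> * \<delta> * q + (\<eta> * q)\<^sup>2) \<le> exp (\<kappa> * real s)" by simp
        finally show "1 + \<eta> * \<delta> * q + (\<eta> * q)\<^sup>2 \<le> exp (\<kappa> * real s)" by (simp add: add.assoc)
      qed
      also have "\<dots> \<le> n * exp (- \<eta> * \<rho> + \<kappa> * (n - w)) * exp (\<kappa> * real s)"
        using I by (intro mult_right_mono) (auto simp: Inv_def \<Phi>_def W_def w_def)
      also have "\<dots> = n * exp (- \<eta> * \<rho> + \<kappa> * (n - (w - real s)))"
        unfolding mult.assoc exp_add[symmetric] by (simp add: algebra_simps)
      finally have "potential \<eta> G V (rest bs'') \<le> n * exp (- \<eta> * \<rho> + \<kappa> * (n - real (card (rest bs''))))"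
        using r'' c'' by (simp only:)
      moreover have "\<mu> / 4 * n \<le> real (card (rest bs''))" unfolding c'' by fact
      moreover have "partial_path G R V m (bs @ bs'')" using e(6) by (simp add: bs''_def)
      ultimately have "Inv bs''" by (simp add: Inv_def)
      then have "card (rest bs') \<le> card (rest bs'')" by (rule min)
      then have "w \<le> w - real s" using c'' by (simp add: w_def W_def)
      moreover have "0 < s" using m by (simp add: s)
      ultimately show False by simp
    qed
  qed
  then show ?thesis using I dens[OF I] unfolding Inv_def rest_def by blast
qed

section \<open>The certificate for higher powers\<close>
definition queried :: "'a edges \<Rightarrow> 'a set \<Rightarrow> nat \<Rightarrow> nat \<Rightarrow> real \<Rightarrow> (nat \<times> real \<times> 'a list set) set" where
  "queried G V m t \<gamma> = {((m + 1 + t) * (m * (m + 2)), \<gamma>, segments G m W E \<B> (m + 1 + t)) | W E \<B>.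
     W \<subseteq> V \<and> E \<in> tuples V m \<and> \<B> \<in> targets G V m W \<and>
     segments G m W E \<B> (m + 1 + t) \<subseteq> tuples V (2 * ((m + 1 + t) * (m * (m + 2))) + (m + 1))}"

text \<open>
  There are \<open>2 ^ n\<close> sets \<open>W\<close>, polynomially many lists \<open>E\<close>, and each target family is
  given by a subset of \<open>V\<close> or by \<open>m\<close> subsets of \<open>W\<close>.
\<close>
lemma card_queried:
  assumes V: "finite V" "card V = n" "1 \<le> n" and m: "0 < m"
  shows "finite (queried G V m t \<gamma>)" "real (card (queried G V m t \<gamma>)) \<le> (2 ^ (2 * m + 2)) ^ n"
proof -
  let ?f = "\<lambda>(W, E, \<B>). ((m + 1 + t) * (m * (m + 2)), \<gamma>, segments G m W E \<B> (m + 1 + t))"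
  let ?I = "SIGMA W:Pow V. tuples V m \<times> targets G V m W"
  have tg: "finite (targets G V m W)" "card (targets G V m W) \<le> 2 ^ (m * n + 1)" if "W \<in> Pow V" for W
  proof -
    have W: "finite W" "card W \<le> n" using that V finite_subset card_mono[of V W] by auto
    have f1: "finite (Pow V)" "finite (tuples (Pow W) m)" using V(1) W(1) by auto
    then show "finite (targets G V m W)" unfolding targets_def by blast
    have "card (targets G V m W) \<le> card (absorbing_cliques G m W ` Pow V) + card (tagged_cliques G V ` tuples (Pow W) m)"
      unfolding targets_def by (rule card_Un_le)
    also have "\<dots> \<le> card (Pow V) + card (tuples (Pow W) m)"
      using f1 by (intro add_mono card_image_le)
    also have "\<dots> = 2 ^ n + (2 ^ card W) ^ m" using V W(1) by (simp add: card_Pow card_tuples)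
    also have "(2 ^ card W) ^ m \<le> ((2 :: nat) ^ n) ^ m" using W(2) by (intro power_mono power_increasing) auto
    also have "((2 :: nat) ^ n) ^ m = 2 ^ (m * n)" by (simp add: power_mult[symmetric] mult.commute)
    also have "(2 :: nat) ^ n \<le> 2 ^ (m * n)" using m by (intro power_increasing) auto
    finally show "card (targets G V m W) \<le> 2 ^ (m * n + 1)" by simp
  qed
  have sub: "queried G V m t \<gamma> \<subseteq> ?f ` ?I"
  proof
    fix x assume "x \<in> queried G V m t \<gamma>"
    then obtain W E \<B> where "x = ?f (W, E, \<B>)" "W \<subseteq> V" "E \<in> tuples V m" "\<B> \<in> targets G V m W"
      unfolding queried_def by (elim CollectE exE conjE) simp
    then show "x \<in> ?f ` ?I" by (intro image_eqI[of _ ?f "(W, E, \<B>)"]) simp_all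
  qed
  have finI: "finite ?I" using V(1) tg(1) by (intro finite_SigmaI finite_cartesian_product) auto
  show "finite (queried G V m t \<gamma>)" by (rule finite_subset[OF sub finite_imageI[OF finI]])
  have "card (queried G V m t \<gamma>) \<le> card (?f ` ?I)" using finI by (intro card_mono[OF _ sub]) auto
  also have "\<dots> \<le> card ?I" by (rule card_image_le[OF finI])
  also have "\<dots> = (\<Sum>W\<in>Pow V. card (tuples V m \<times> targets G V m W))"
    using V(1) tg(1) by (intro card_SigmaI) auto
  also have "\<dots> \<le> (\<Sum>W\<in>Pow V. 2 ^ (m * n) * 2 ^ (m * n + 1))"
  proof (rule sum_mono)
    fix W assume W: "W \<in> Pow V"
    have "n \<le> 2 ^ n" using less_exp[of n] by simp
    then have "n ^ m \<le> (2 ^ n) ^ m" by (rule power_mono) simp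
    also have "\<dots> = 2 ^ (m * n)" by (simp add: power_mult[symmetric] mult.commute)
    finally show "card (tuples V m \<times> targets G V m W) \<le> 2 ^ (m * n) * 2 ^ (m * n + 1)"
      using tg(2)[OF W] V by (simp add: card_cartesian_product card_tuples mult_mono)
  qed
  also have "\<dots> = 2 ^ n * (2 ^ (m * n) * 2 ^ (m * n + 1))" using V by (simp add: card_Pow)
  also have "\<dots> = 2 ^ (n + (m * n + (m * n + 1)))" by (simp only: power_add)
  also have "\<dots> \<le> (2 :: nat) ^ ((2 * m + 2) * n)" using V(3) by (intro power_increasing) (auto simp: algebra_simps)
  finally have "real (card (queried G V m t \<gamma>)) \<le> real (2 ^ ((2 * m + 2) * n))" by (rule of_nat_mono)
  then show "real (card (queried G V m t \<gamma>)) \<le> (2 ^ (2 * m + 2)) ^ n" by (simp only: of_nat_power of_nat_numeral power_mult)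
qed

lemma queried_distinct:
  assumes "(a, c, T) \<in> queried G V m t \<gamma>" "ts \<in> T"
  shows "distinct (take (2 * a) ts)"
proof -
  obtain W E \<B> where a: "a = (m + 1 + t) * (m * (m + 2))" and T: "T = segments G m W E \<B> (m + 1 + t)"
    using assms(1) by (auto simp: queried_def)
  have "distinct (take (2 * ((m + 1 + t) * (m * (m + 2))) + m) ts)"
    using assms(2) unfolding T segments_def by blast
  then have "distinct (take (2 * a + m) ts)" unfolding a .
  then have "distinct (take (2 * a) (take (2 * a + m) ts))" by (rule distinct_take)
  then show ?thesis by (simp add: min_def)
qed

lemma min_density_mono: "min_density G V W d \<Longrightarrow> d' \<le> d \<Longrightarrow> min_density G V W d'"
  unfolding min_density_def by (meson mult_right_mono of_nat_0_le_iff order_trans)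

text \<open>
  Removing at most \<open>\<epsilon> * n\<close> vertices reduces each neighbourhood by at most \<open>\<epsilon> * n\<close>, so
  that the surplus of \<open>4 * \<epsilon>\<close> in the density drops to no less than \<open>2 * \<epsilon>\<close>.
\<close>
lemma min_density_after_removal:
  assumes G: "G \<in> graphs n" and deg: "real (min_degree n G) \<ge> (1 - 1 / real m + 4 * \<epsilon>) * real n"
    and m: "0 < m" and \<epsilon>: "0 < \<epsilon>" and X: "real (card X) \<le> \<epsilon> * real n" "finite X"
  shows "min_density G {1..n} ({1..n} - X) (1 - 1 / real m + 2 * \<epsilon>)"
  unfolding min_density_def
proof
  fix v assume v: "v \<in> {1..n}"
  let ?N = "neighbours G v" and ?W = "{1..n} - X"
  have "?N \<subseteq> (?W \<inter> ?N) \<union> X" using neighbours_subset[OF G, of v] by auto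
  then have "card ?N \<le> card ((?W \<inter> ?N) \<union> X)" using X(2) by (intro card_mono) auto
  also have "\<dots> \<le> card (?W \<inter> ?N) + card X" by (rule card_Un_le)
  finally have "real (card ?N) \<le> real (card (?W \<inter> ?N)) + real (card X)" by linarith
  moreover have "(1 - 1 / real m + 4 * \<epsilon>) * real n \<le> real (card ?N)" by (rule card_neighbours_ge[OF G deg v])
  moreover have "(1 - 1 / real m + 2 * \<epsilon>) * real (card ?W) \<le> (1 - 1 / real m + 2 * \<epsilon>) * real n"
  proof (rule mult_left_mono)
    have "card ?W \<le> card {1..n}" by (rule card_mono) auto
    then show "real (card ?W) \<le> real n" by simp
    have "1 / real m \<le> 1" using m by simp
    then show "0 \<le> 1 - 1 / real m + 2 * \<epsilon>" using \<epsilon> by linarith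
  qed
  moreover have "(1 - 1 / real m + 4 * \<epsilon>) * real n = (1 - 1 / real m + 2 * \<epsilon>) * real n + 2 * (\<epsilon> * real n)"
    by (simp add: algebra_simps)
  moreover have "0 \<le> \<epsilon> * real n" using \<epsilon> by simp
  ultimately show "(1 - 1 / real m + 2 * \<epsilon>) * real (card ?W) \<le> real (card (?W \<inter> ?N))"
    using X(1) by linarith
qed

lemma single_clique_path:
  assumes G: "G \<in> graphs n" and V: "V = {1..n}" "1 \<le> n" and m: "0 < m" and \<epsilon>: "0 < \<epsilon>" "\<epsilon> \<le> 1 / real m"
    and dens: "min_density G V V (1 - 1 / real m + \<epsilon>)"
  shows "\<exists>F. partial_path G R V m [F]"
proof -
  have finV: "finite V" "card V = n" using V by auto
  have "real (card (cliques G (replicate m V))) \<ge> (\<epsilon> * real n) ^ length (replicate m V)"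
  proof (rule card_cliques[OF finV(1)])
    fix j S assume "j < length (replicate m V)" "S \<subseteq> V" "finite S" "card S \<le> j"
    then show "\<epsilon> * real n \<le> real (card {x \<in> replicate m V ! j. \<forall>s\<in>S. {s, x} \<in> G})"
      using common_neighbours[OF dens finV(1), of S] m \<epsilon> finV(2) by auto
  qed (use \<epsilon> in auto)
  moreover have "0 < (\<epsilon> * real n) ^ length (replicate m V)" using \<epsilon> V(2) by simp
  ultimately have "0 < real (card (cliques G (replicate m V)))" by linarith
  then have "cliques G (replicate m V) \<noteq> {}" by (metis card.empty of_nat_0 less_irrefl)
  then obtain F where "F \<in> cliques G (replicate m V)" by blast
  then have F: "length F = m" "\<forall>i<m. F ! i \<in> V" "\<forall>i j. i < j \<longrightarrow> j < m \<longrightarrow> {F ! i, F ! j} \<in> G"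
    by (auto simp: cliques_def)
  have "card {F ! i, F ! j} = 2" if "i < j" "j < m" for i j
    using F(3) that G by (auto simp: graphs_def all_edges_def)
  then have ne: "F ! i \<noteq> F ! j" if "i < j" "j < m" for i j using that by fastforce
  have "distinct F" unfolding distinct_conv_nth
  proof (intro allI impI)
    fix i j assume "i < length F" "j < length F" "i \<noteq> j"
    then show "F ! i \<noteq> F ! j" using ne[of i j] ne[of j i] F(1) by (cases "i < j") auto
  qed
  moreover have "set F \<subseteq> V" using F(1,2) by (auto simp: in_set_conv_nth)
  moreover have "power_path m (G \<union> R) F" using F unfolding power_path_iff_nth by auto
  ultimately show ?thesis using F(1) unfolding partial_path_def by (intro exI[of _ F]) auto
qed

lemma eventually_ge_linear:
  fixes c C :: real
  assumes "0 < c"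
  shows "\<forall>\<^sub>F n in sequentially. C \<le> c * real n"
  using eventually_ge_at_top[of "nat \<lceil>C / c\<rceil>"]
proof eventually_elim
  case (elim n)
  then have "C / c \<le> real n" by linarith
  then show ?case using assms by (simp add: divide_le_eq mult.commute)
qed

lemma eventually_ge_sqrt:
  fixes c C :: real
  assumes "0 < c"
  shows "\<forall>\<^sub>F n in sequentially. C \<le> c * sqrt (real n)"
proof -
  have "filterlim (\<lambda>n. sqrt (real n)) at_top sequentially"
    by (rule filterlim_compose[OF sqrt_at_top filterlim_real_sequentially])
  then have "\<forall>\<^sub>F n in sequentially. C / c \<le> sqrt (real n)" by (simp add: filterlim_at_top)
  then show ?thesis by eventually_elim (use assms in \<open>simp add: divide_le_eq mult.commute\<close>)
qed

lemma eventually_ln_le_sqrt: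
  fixes c :: real
  assumes "0 < c"
  shows "\<forall>\<^sub>F n in sequentially. ln (real n) \<le> c * sqrt (real n)"
proof -
  have lim: "filterlim (\<lambda>n. sqrt (real n)) at_top sequentially"
    by (rule filterlim_compose[OF sqrt_at_top filterlim_real_sequentially])
  have "(\<lambda>n. ln (sqrt (real n)) / sqrt (real n)) \<longlonglongrightarrow> 0"
    by (rule filterlim_compose[OF ln_x_over_x_tendsto_0 lim])
  then have "\<forall>\<^sub>F n in sequentially. ln (sqrt (real n)) / sqrt (real n) < c / 2"
    using assms by (intro order_tendstoD(2)[where y = 0]) auto
  then show ?thesis using eventually_gt_at_top[of 0]
  proof eventually_elim
    case (elim n)
    then have "0 < sqrt (real n)" by simp
    then have "ln (sqrt (real n)) < c / 2 * sqrt (real n)" using elim by (simp add: divide_less_eq)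
    moreover have "ln (sqrt (real n)) = ln (real n) / 2" using elim by (simp add: ln_sqrt)
    ultimately show ?case by simp
  qed
qed

text \<open>
  The certificate serves segments of two kinds: those with one loop, for absorbers and exceptional
  vertices, with constants \<open>c1\<close>, \<open>\<gamma>1\<close>, \<open>g1\<close>, and those with \<open>t\<close> loops, for
  covering most vertices and for closing the cycle, with constants \<open>c3\<close>, \<open>\<gamma>3\<close>,
  \<open>g3\<close>. The number \<open>\<tau>\<close> of absorbers per vertex is about \<open>\<mu> * n\<close>, and at most
  \<open>\<mu> / 2 * n\<close> vertices remain to be absorbed. The constants are chosen in the order
  \<open>\<epsilon>, \<sigma>, c1, \<gamma>1, g1, \<mu>, \<delta>, t, c3, \<gamma>3\<close>: first the cost of the
  absorbers is fixed, then the number of leftover vertices they can handle, and then the precision with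
  which the densities have to be controlled until so few vertices are left.
\<close>
theorem power_ham_certified:
  fixes \<alpha> :: real
  assumes m: "2 \<le> m" and \<alpha>: "1 - 1 / real m < \<alpha>" "\<alpha> < 1"
  shows "\<exists>\<gamma>>0. \<exists>D>0. \<exists>n0. \<forall>n\<ge>n0. \<forall>G\<in>graphs n. real (min_degree n G) \<ge> \<alpha> * real n \<longrightarrow>
           certified \<gamma> D n G (power_ham m n)"
proof -
  have m0: "0 < m" using m by simp
  define \<epsilon> where "\<epsilon> = (\<alpha> - (1 - 1 / real m)) / 4"
  have \<epsilon>: "0 < \<epsilon>" "\<epsilon> \<le> 1 / real m" "\<alpha> = 1 - 1 / real m + 4 * \<epsilon>"
  proof -
    have "x = y + 4 * ((x - y) / 4)" for x y :: real by (simp add: field_simps)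
    then show \<alpha>_eq: "\<alpha> = 1 - 1 / real m + 4 * \<epsilon>" unfolding \<epsilon>_def by blast
    then show "0 < \<epsilon>" using \<alpha>(1) by linarith
    have "0 \<le> 1 / real m" by simp
    then show "\<epsilon> \<le> 1 / real m" using \<alpha>(2) \<alpha>_eq by linarith
  qed
  have "1 / real m \<le> 1" using m0 by simp
  then have \<epsilon>1: "\<epsilon> \<le> 1" using \<epsilon>(2) by linarith
  define L where "L = 2 * m * (m + 1) + 2 * m + m"
  \<comment> \<open>Covering \<open>\<sigma> * n\<close> exceptional vertices takes at most \<open>\<epsilon> / 8 * n\<close> vertices.\<close>
  define \<sigma> where "\<sigma> = \<epsilon> / (8 * real (Suc L))"
  have \<sigma>: "0 < \<sigma>" "real (Suc L) * \<sigma> = \<epsilon> / 8" using \<epsilon>(1) by (simp_all add: \<sigma>_def del: of_nat_Suc)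
  have \<sigma>1: "\<sigma> \<le> 1"
  proof -
    have "\<sigma> \<le> \<epsilon> / 1" unfolding \<sigma>_def using \<epsilon>(1) by (intro divide_left_mono) auto
    then show ?thesis using \<epsilon>1 by simp
  qed
  define c1 where "c1 = \<sigma> * (\<epsilon> / 2) ^ m"
  have c1: "0 < c1" "c1 \<le> (\<epsilon> / 2) ^ m"
    using \<sigma>(1) \<sigma>1 \<epsilon>(1) mult_right_mono[OF \<sigma>1, of "(\<epsilon> / 2) ^ m"] by (simp_all add: c1_def)
  define a1 where "a1 = (m + 1 + 1) * (m * (m + 2))"
  have "0 < m + 1 + (1 :: nat)" "(0 :: real) < 1 / 2" by simp_all
  from segments_dense[OF m0 this(1) \<epsilon>(1,2) this(2) c1(1), where 'a = nat, folded a1_def]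
  obtain \<gamma>1 n1 where \<gamma>1: "0 < \<gamma>1" and dense1: "\<forall>G (V :: nat set) W E \<B>. n1 \<le> card V \<longrightarrow> finite V \<longrightarrow> W \<subseteq> V \<longrightarrow> E \<in> tuples V m \<longrightarrow>
     min_density G V W (1 - 1 / real m + \<epsilon>) \<longrightarrow> real (card W) \<ge> 1 / 2 * real (card V) \<longrightarrow>
     \<B> \<subseteq> tuples V (m + 1) \<longrightarrow> real (card \<B>) \<ge> c1 * real (card V) ^ (m + 1) \<longrightarrow>
     segments G m W E \<B> (m + 1 + 1) \<subseteq> tuples V (2 * a1 + (m + 1)) \<and>
     real (card (segments G m W E \<B> (m + 1 + 1))) \<ge> \<gamma>1 * real (card V) ^ (2 * a1 + (m + 1))"
    by (elim exE conjE) (rule that)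
  define g1 where "g1 = \<gamma>1 / 2 ^ (a1 + 1)"
  have g1: "0 < g1" using \<gamma>1 by (simp add: g1_def)
  \<comment> \<open>Providing \<open>\<mu> * n\<close> absorbers per vertex takes about \<open>\<epsilon> / 16 * n\<close> vertices.\<close>
  define \<mu> where "\<mu> = min 1 (\<epsilon> * g1 / (16 * real L))"
  have "0 < L" using m0 by (simp add: L_def)
  then have L0: "0 < real L" by simp
  have \<mu>: "0 < \<mu>" "\<mu> \<le> 1" "real L * (\<mu> / g1) \<le> \<epsilon> / 16"
  proof -
    show "0 < \<mu>" "\<mu> \<le> 1" using \<epsilon>(1) g1 L0 by (simp_all add: \<mu>_def)
    have "real L * \<mu> \<le> real L * (\<epsilon> * g1 / (16 * real L))" using L0 by (intro mult_left_mono) (auto simp: \<mu>_def)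
    also have "\<dots> = \<epsilon> * g1 / 16" using L0 by simp
    finally show "real L * (\<mu> / g1) \<le> \<epsilon> / 16" using g1 by (simp add: field_simps)
  qed
  \<comment> \<open>The term of \<open>\<kappa> * n\<close> due to \<open>\<delta>\<close> becomes \<open>\<epsilon> / 2 * \<eta>\<close>, half of what the density may lose.\<close>
  define \<delta> where "\<delta> = \<epsilon> * \<mu> / 8"
  have \<delta>\<epsilon>: "\<delta> \<le> \<epsilon>"
    using \<epsilon>(1) \<mu> mult_left_mono[OF \<mu>(2), of \<epsilon>] by (simp add: \<delta>_def)
  have \<delta>: "0 < \<delta>" "\<delta> \<le> 1"
  proof -
    show "0 < \<delta>" using \<epsilon>(1) \<mu>(1) by (simp add: \<delta>_def)
    show "\<delta> \<le> 1" using \<delta>\<epsilon> \<epsilon>1 by linarith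
  qed
  \<comment> \<open>The vertices outside the loops are at most the proportion \<open>\<delta> / 2\<close> of those in the loops.\<close>
  define t where "t = Suc (nat \<lceil>real (2 * m * (m + 1) + m) / (\<delta> * real m)\<rceil>)"
  have t: "1 \<le> t" "real (2 * m * (m + 1) + m) \<le> \<delta> * real (m * t)"
  proof -
    have "real (2 * m * (m + 1) + m) / (\<delta> * real m) \<le> real t" unfolding t_def by linarith
    then have "real (2 * m * (m + 1) + m) \<le> real t * (\<delta> * real m)" using \<delta> m0 by (subst (asm) pos_divide_le_eq) auto
    then show "real (2 * m * (m + 1) + m) \<le> \<delta> * real (m * t)" by (simp only: of_nat_mult mult_ac)
  qed (simp add: t_def)
  define c3 where "c3 = (\<delta> * \<mu> / (16 * real m)) ^ m"
  have c3: "0 < c3" using \<delta>(1) \<mu>(1) m0 by (simp add: c3_def)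
  have c3_close: "c3 \<le> (\<epsilon> * (\<mu> / 4)) ^ m" unfolding c3_def
  proof (rule power_mono)
    have "\<delta> * \<mu> / (16 * real m) \<le> \<epsilon> * \<mu> / 4"
      using \<delta>\<epsilon> \<mu>(1) \<epsilon>(1) m0 by (intro frac_le mult_right_mono) auto
    then show "\<delta> * \<mu> / (16 * real m) \<le> \<epsilon> * (\<mu> / 4)" by simp
  qed (use \<delta> \<mu> in auto)
  define a3 where "a3 = (m + 1 + t) * (m * (m + 2))"
  have "0 < m + 1 + t" "0 < \<mu> / 4" using \<mu>(1) by simp_all
  from segments_dense[OF m0 this(1) \<epsilon>(1,2) this(2) c3(1), where 'a = nat, folded a3_def]
  obtain \<gamma>3 n3 where \<gamma>3: "0 < \<gamma>3" and dense3: "\<forall>G (V :: nat set) W E \<B>. n3 \<le> card V \<longrightarrow> finite V \<longrightarrow> W \<subseteq> V \<longrightarrow> E \<in> tuples V m \<longrightarrow>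
     min_density G V W (1 - 1 / real m + \<epsilon>) \<longrightarrow> real (card W) \<ge> \<mu> / 4 * real (card V) \<longrightarrow>
     \<B> \<subseteq> tuples V (m + 1) \<longrightarrow> real (card \<B>) \<ge> c3 * real (card V) ^ (m + 1) \<longrightarrow>
     segments G m W E \<B> (m + 1 + t) \<subseteq> tuples V (2 * a3 + (m + 1)) \<and>
     real (card (segments G m W E \<B> (m + 1 + t))) \<ge> \<gamma>3 * real (card V) ^ (2 * a3 + (m + 1))"
    by (elim exE conjE) (rule that)
  define g3 where "g3 = \<gamma>3 / 2 ^ (a3 + 1)"
  have g3: "0 < g3" using \<gamma>3 by (simp add: g3_def)
  define s where "s = 2 * m * (m + 1) + 2 * m * t + m"
  define c0 A where "c0 = min \<gamma>1 \<gamma>3" and "A = max a1 a3"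
  have c0: "0 < c0" using \<gamma>1 \<gamma>3 by (simp add: c0_def)
  have A: "1 \<le> A" using m0 by (simp add: A_def a1_def)
  define D :: real where "D = 2 * 2 ^ (2 * m + 2)"
  have D0: "0 < D" by (simp add: D_def)
  have \<delta>\<mu>: "0 < \<delta> * \<mu>" using \<delta>(1) \<mu>(1) by simp
  have "\<forall>\<^sub>F n in sequentially. m < n \<and> n1 \<le> n \<and> n3 \<le> n \<and>
     real m + real L / g1 \<le> \<epsilon> / 16 * real n \<and> 32 * real m \<le> \<delta> * \<mu> * real n \<and> real s \<le> \<mu> / 4 * real n \<and>
     4 * real s \<le> \<mu> * sqrt (real n) \<and> 16 * real s / \<mu>\<^sup>2 \<le> \<epsilon> / 4 * sqrt (real n) \<and> ln (real n) \<le> \<epsilon> / 4 * sqrt (real n)"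
    using \<epsilon>(1) \<mu>(1) \<delta>\<mu> by (intro eventually_conj eventually_gt_at_top eventually_ge_at_top
        eventually_ge_linear eventually_ge_sqrt eventually_ln_le_sqrt) auto
  then obtain n0 where n0: "\<And>n. n0 \<le> n \<Longrightarrow> m < n \<and> n1 \<le> n \<and> n3 \<le> n \<and>
     real m + real L / g1 \<le> \<epsilon> / 16 * real n \<and> 32 * real m \<le> \<delta> * \<mu> * real n \<and> real s \<le> \<mu> / 4 * real n \<and>
     4 * real s \<le> \<mu> * sqrt (real n) \<and> 16 * real s / \<mu>\<^sup>2 \<le> \<epsilon> / 4 * sqrt (real n) \<and> ln (real n) \<le> \<epsilon> / 4 * sqrt (real n)"
    unfolding eventually_sequentially by blast
  have "certified (c0 / 2 ^ Suc A) (D * (real A * 4 ^ A)) n G (power_ham m n)"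
    if nn: "n0 \<le> n" and G: "G \<in> graphs n" and deg: "real (min_degree n G) \<ge> \<alpha> * real n" for n G
  proof -
    define V where "V = {1..n}"
    have large: "m < n" "n1 \<le> n" "n3 \<le> n" "real m + real L / g1 \<le> \<epsilon> / 16 * real n" "32 * real m \<le> \<delta> * \<mu> * real n"
      "real s \<le> \<mu> / 4 * real n" "4 * real s \<le> \<mu> * sqrt (real n)" "16 * real s / \<mu>\<^sup>2 \<le> \<epsilon> / 4 * sqrt (real n)"
      "ln (real n) \<le> \<epsilon> / 4 * sqrt (real n)"
      using n0[OF nn] by auto
    have V: "finite V" "V \<noteq> {}" "card V = n" using large(1) by (auto simp: V_def)
    have n_pos: "0 < real n" using large(1) by simp
    have n_ge: "1 \<le> n" using large(1) by simp
    define \<T> where "\<T> = queried G V m 1 \<gamma>1 \<union> queried G V m t \<gamma>3"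
    show ?thesis
    proof (rule certifiedI[where \<T> = \<T> and b = "m + 1"])
      note cq = card_queried[OF V(1,3) n_ge m0, of G]
      show "finite \<T>" using cq(1) by (simp add: \<T>_def)
      have "card \<T> \<le> card (queried G V m 1 \<gamma>1) + card (queried G V m t \<gamma>3)" unfolding \<T>_def by (rule card_Un_le)
      then have "real (card \<T>) \<le> real (card (queried G V m 1 \<gamma>1)) + real (card (queried G V m t \<gamma>3))" by linarith
      also have "\<dots> \<le> 2 * (2 ^ (2 * m + 2)) ^ n" using cq(2)[of 1 \<gamma>1] cq(2)[of t \<gamma>3] by linarith
      also have "\<dots> \<le> 2 ^ n * (2 ^ (2 * m + 2)) ^ n"
        using power_increasing[of 1 n "2::real"] large(1) by (intro mult_right_mono) auto
      also have "\<dots> = D ^ n" unfolding D_def by (simp only: power_mult_distrib)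
      finally show "real (card \<T>) \<le> D ^ n" .
      fix a c T assume aT: "(a, c, T) \<in> \<T>"
      then have dist: "\<forall>ts\<in>T. distinct (take (2 * a) ts)" unfolding \<T>_def using queried_distinct by blast
      have "a \<le> A \<and> c0 \<le> c \<and> T \<subseteq> tuples V (2 * a + (m + 1))"
        using aT unfolding \<T>_def queried_def a1_def[symmetric] a3_def[symmetric]
        by (auto simp: A_def c0_def)
      then show "a \<le> A \<and> c0 \<le> c \<and> T \<subseteq> tuples {1..n} (2 * a + (m + 1)) \<and> (\<forall>ts\<in>T. distinct (take (2 * a) ts))"
        using dist unfolding V_def by blast
    next
      fix R assume R: "R \<subseteq> all_edges n"
        and hit: "\<And>a c T Q. (a, c, T) \<in> \<T> \<Longrightarrow> Q \<in> queries {1..n} a (m + 1) c T \<Longrightarrow> R \<inter> Q \<noteq> {}"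
      have ext1: "extendable G R V m \<epsilon> 1 (1 / 2) c1 g1" unfolding g1_def
      proof (rule extendable_if_hit[OF m order_refl V(1,2) a1_def \<gamma>1])
        fix W E \<B> Q assume "W \<subseteq> V" "E \<in> tuples V m" "\<B> \<in> targets G V m W"
          "segments G m W E \<B> (m + 1 + 1) \<subseteq> tuples V (2 * a1 + (m + 1))"
          "Q \<in> queries V a1 (m + 1) \<gamma>1 (segments G m W E \<B> (m + 1 + 1))"
        moreover from this have "(a1, \<gamma>1, segments G m W E \<B> (m + 1 + 1)) \<in> \<T>"
          unfolding \<T>_def queried_def a1_def by blast
        ultimately show "R \<inter> Q \<noteq> {}" using hit unfolding V_def by blast
      qed (use dense1 large(2) V in blast)
      have ext3: "extendable G R V m \<epsilon> t (\<mu> / 4) c3 g3" unfolding g3_def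
      proof (rule extendable_if_hit[OF m t(1) V(1,2) a3_def \<gamma>3])
        fix W E \<B> Q assume "W \<subseteq> V" "E \<in> tuples V m" "\<B> \<in> targets G V m W"
          "segments G m W E \<B> (m + 1 + t) \<subseteq> tuples V (2 * a3 + (m + 1))"
          "Q \<in> queries V a3 (m + 1) \<gamma>3 (segments G m W E \<B> (m + 1 + t))"
        moreover from this have "(a3, \<gamma>3, segments G m W E \<B> (m + 1 + t)) \<in> \<T>"
          unfolding \<T>_def queried_def a3_def by blast
        ultimately show "R \<inter> Q \<noteq> {}" using hit unfolding V_def by blast
      qed (use dense3 large(3) V in blast)
      \<comment> \<open>The total number of vertices that may be visited before the potential function takes over.\<close>
      define K where "K = \<epsilon> / 2 * real n"
      have dens2: "min_density G V (V - X) (1 - 1 / real m + 2 * \<epsilon>)" if "X \<subseteq> V" "real (card X) \<le> K" for X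
      proof -
        have "real (card X) \<le> \<epsilon> * real n" using that(2) \<epsilon>(1) n_pos by (simp add: K_def)
        moreover have "finite X" using that(1) V(1) finite_subset by blast
        ultimately show ?thesis
          unfolding V_def using min_density_after_removal[OF G deg[unfolded \<epsilon>(3)] m0 \<epsilon>(1)] by blast
      qed
      have half: "real (card (V - X)) \<ge> 1 / 2 * real (card V)" if "X \<subseteq> V" "real (card X) \<le> K" for X
      proof -
        have "finite X" using that(1) V(1) finite_subset by blast
        then have "card (V - X) = n - card X" "card X \<le> n"
          using that(1) V card_mono[OF V(1)] by (simp_all add: card_Diff_subset)
        moreover have "\<epsilon> / 2 * real n \<le> 1 / 2 * real n" using \<epsilon>1 n_pos by (intro mult_right_mono) auto
        ultimately show ?thesis using that(2) V(3) by (simp add: K_def of_nat_diff)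
      qed
      have room: "min_density G V (V - X) (1 - 1 / real m + \<epsilon>) \<and> real (card (V - X)) \<ge> 1 / 2 * real (card V)"
        if "X \<subseteq> V" "real (card X) \<le> K" for X
        using min_density_mono[OF dens2[OF that]] half[OF that] \<epsilon>(1) by simp
      have K0: "0 \<le> K" using \<epsilon>(1) by (simp add: K_def)
      have "min_density G V V (1 - 1 / real m + \<epsilon>)" using room[of "{}"] K0 by simp
      then obtain F where F: "partial_path G R V m [F]"
        using single_clique_path[OF G V_def n_ge m0 \<epsilon>(1,2)] by blast
      define \<tau> where "\<tau> = nat \<lceil>\<mu> * real n\<rceil>"
      have \<tau>: "\<mu> * real n \<le> real \<tau>" "real \<tau> \<le> \<mu> * real n + 1"
      proof -
        have "0 \<le> \<mu> * real n" using \<mu>(1) n_pos by simp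
        then show "\<mu> * real n \<le> real \<tau>" "real \<tau> \<le> \<mu> * real n + 1" unfolding \<tau>_def by linarith+
      qed
      have budget1: "real m + real L * (real \<tau> / g1) \<le> \<epsilon> / 8 * real n"
      proof -
        have "real L * (real \<tau> / g1) \<le> real L * ((\<mu> * real n + 1) / g1)"
          using \<tau>(2) g1 by (intro mult_left_mono divide_right_mono) auto
        also have "\<dots> = real L * (\<mu> / g1) * real n + real L / g1" by (simp add: add_divide_distrib algebra_simps)
        also have "\<dots> \<le> \<epsilon> / 16 * real n + real L / g1"
          using \<mu>(3) n_pos by (intro add_right_mono mult_right_mono) auto
        finally show ?thesis using large(4) by linarith
      qed
      have K8: "\<epsilon> / 8 * real n = K / 4" "\<epsilon> / 4 * real n = K / 2" by (simp_all add: K_def)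
      have "real m + real L * (real \<tau> / g1) \<le> K" using budget1 K0 unfolding K8 by linarith
      from many_absorbers[OF m V(1,2) g1 \<epsilon>(1,2) \<sigma>(1) ext1 c1_def[THEN eq_refl] room F L_def this]
      obtain bs1 where bs1: "partial_path G R V m (F # bs1)"
        "real (length (concat (F # bs1))) \<le> real m + real L * (real \<tau> / g1)"
        "real (card {v \<in> V. absorb_count m G (F # bs1) v < \<tau>}) < \<sigma> * real (card V)" by blast
      define Bad where "Bad = {v \<in> V. absorb_count m G (F # bs1) v < \<tau>}"
      have Bad: "finite Bad" "Bad \<subseteq> V" "real (card Bad) \<le> \<sigma> * real n"
        using bs1(3) V by (auto simp: Bad_def)
      have budget2: "real (length (concat (F # bs1))) + real (Suc L) * real (card Bad) \<le> K / 2"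
      proof -
        have "real (Suc L) * real (card Bad) \<le> real (Suc L) * (\<sigma> * real n)" using Bad(3) by (intro mult_left_mono) auto
        also have "\<dots> = \<epsilon> / 8 * real n" using \<sigma>(2) by (simp only: mult.assoc[symmetric])
        finally show ?thesis using bs1(2) budget1 unfolding K8 by linarith
      qed
      have "real (length (concat (F # bs1))) + real (Suc L) * real (card Bad) \<le> K" using budget2 K0 by linarith
      from cover_set[OF m V(1,2) \<epsilon>(1,2) ext1 c1(2) g1 room bs1(1) L_def Bad(1,2) this]
      obtain bs2 where bs2: "partial_path G R V m ((F # bs1) @ bs2)" "Bad \<subseteq> set (concat ((F # bs1) @ bs2))"
        "length (concat ((F # bs1) @ bs2)) \<le> length (concat (F # bs1)) + Suc L * card Bad" by blast
      define X where "X = set (concat ((F # bs1) @ bs2))"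
      have XV: "X \<subseteq> V" using bs2(1) unfolding partial_path_def X_def by blast
      have "card X \<le> length (concat (F # bs1)) + Suc L * card Bad"
        unfolding X_def using card_length bs2(3) by (rule order_trans)
      then have "real (card X) \<le> real (length (concat (F # bs1)) + Suc L * card Bad)" by (rule of_nat_mono)
      also have "\<dots> = real (length (concat (F # bs1))) + real (Suc L) * real (card Bad)" by (simp only: of_nat_add of_nat_mult)
      also have "\<dots> \<le> K" using budget2 K0 by linarith
      finally have XK: "real (card X) \<le> K" .
      have W0: "real (card (V - X)) \<ge> \<mu> / 4 * real n"
      proof -
        have "\<mu> / 4 * real n \<le> 1 / 2 * real n" using \<mu>(2) n_pos by (intro mult_right_mono) auto
        then show ?thesis using half[OF XV XK] V(3) by simp
      qed
      define \<eta> \<kappa> where "\<eta> = sqrt (real n)" and "\<kappa> = 4 * \<eta> * \<delta> / (\<mu> * real n) + 16 * real s / (\<mu>\<^sup>2 * real n)"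
      have \<eta>: "0 < \<eta>" "\<eta> * \<eta> = real n" using n_pos by (simp_all add: \<eta>_def)
      have l3: "\<eta> * (4 * real s / (\<mu> * real n)) \<le> 1"
      proof -
        have "\<eta> * (4 * real s / (\<mu> * real n)) = 4 * real s / (\<mu> * \<eta>)" unfolding \<eta>(2)[symmetric] using \<eta>(1) \<mu>(1) by simp
        also have "\<dots> \<le> 1" using large(7) \<eta>(1) \<mu>(1) by (simp add: \<eta>_def)
        finally show ?thesis .
      qed
      have l4: "ln (real n) + \<kappa> * real n \<le> \<eta> * ((1 - 1 / real m + 2 * \<epsilon>) - (1 - 1 / real m + \<epsilon>))"
      proof -
        have "\<kappa> * real n = 4 * \<eta> * \<delta> / \<mu> + 16 * real s / \<mu>\<^sup>2" unfolding \<kappa>_def using n_pos by (simp add: field_simps)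
        also have "4 * \<eta> * \<delta> / \<mu> = \<epsilon> / 2 * \<eta>" using \<mu>(1) by (simp add: \<delta>_def)
        finally have "ln (real n) + \<kappa> * real n \<le> \<epsilon> / 4 * \<eta> + (\<epsilon> / 2 * \<eta> + \<epsilon> / 4 * \<eta>)"
          using large(8,9) unfolding \<eta>_def by linarith
        also have "\<dots> = \<eta> * ((1 - 1 / real m + 2 * \<epsilon>) - (1 - 1 / real m + \<epsilon>))" by (simp add: algebra_simps)
        finally show ?thesis .
      qed
      have nV: "real n = real (card V)" using V(3) by simp
      from cover_most[OF m V(1,2) nV \<epsilon>(1,2) t s_def \<mu>(1) \<delta> c3_def[THEN eq_refl] ext3 \<eta>_def \<kappa>_def large(5,6) l3 l4
          bs2(1) W0[unfolded X_def] dens2[OF XV XK, unfolded X_def]]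
      obtain bs3 where bs3: "partial_path G R V m (((F # bs1) @ bs2) @ bs3)"
        "\<mu> / 4 * real n \<le> real (card (V - set (concat (((F # bs1) @ bs2) @ bs3))))"
        "real (card (V - set (concat (((F # bs1) @ bs2) @ bs3)))) \<le> \<mu> / 2 * real n"
        "min_density G V (V - set (concat (((F # bs1) @ bs2) @ bs3))) (1 - 1 / real m + \<epsilon>)" by blast
      define W where "W = V - set (concat (((F # bs1) @ bs2) @ bs3))"
      have absorb: "card W \<le> absorb_count m G (((F # bs1) @ bs2) @ bs3) v" if "v \<in> W" for v
      proof -
        have "v \<in> V" "v \<notin> Bad" using that bs2(2) by (auto simp: W_def)
        then have "\<tau> \<le> absorb_count m G (F # bs1) v" by (auto simp: Bad_def)
        also have "\<dots> \<le> absorb_count m G (((F # bs1) @ bs2) @ bs3) v" unfolding absorb_count_append by simp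
        finally have "\<tau> \<le> absorb_count m G (((F # bs1) @ bs2) @ bs3) v" .
        moreover have "real (card W) \<le> real \<tau>"
        proof -
          have "\<mu> / 2 * real n \<le> \<mu> * real n" using \<mu>(1) n_pos by (intro mult_right_mono) auto
          then show ?thesis using bs3(3) \<tau>(1) unfolding W_def by linarith
        qed
        ultimately show ?thesis by linarith
      qed
      show "G \<union> R \<in> power_ham m n"
        by (rule close_and_absorb[OF m large(1) G R V_def \<epsilon>(1,2) t(1) \<open>0 < \<mu> / 4\<close> ext3 c3_close g3 bs3(1) W_def
              bs3(4)[folded W_def] bs3(2)[folded W_def, unfolded nV] absorb])
    qed (use n_ge A c0 D0 in auto)
  qed
  moreover have "0 < c0 / 2 ^ Suc A" "0 < D * (real A * 4 ^ A)" using c0 D0 A by simp_all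
  ultimately show ?thesis by blast
qed

theorem theorem1p1:
  fixes k :: nat and \<alpha> :: real
  assumes "real k / (real k + 1) < \<alpha>" and "\<alpha> < 1"
  shows "\<exists>C::real. \<forall>p :: nat \<Rightarrow> real.
           range p \<subseteq> {0..1} \<longrightarrow>
           (\<forall>\<^sub>F n in sequentially. p n \<ge> C / real n) \<longrightarrow>
           ensures \<alpha> p (power_ham (k + 1))"
proof (cases "k = 0")
  case True
  then have \<alpha>: "0 < \<alpha>" using assms(1) by simp
  show ?thesis
  proof (rule ensures_if_certified[OF assms(2), where \<gamma> = "(\<alpha> / 8)\<^sup>2" and D = 4
        and N = "max 3 (nat \<lceil>12 / \<alpha>\<rceil>)"])
    fix n G assume n: "max 3 (nat \<lceil>12 / \<alpha>\<rceil>) \<le> n"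
      and G: "G \<in> graphs n" "real (min_degree n G) \<ge> \<alpha> * real n"
    have "12 / \<alpha> \<le> real n" "3 \<le> n" using n by linarith+
    then show "certified ((\<alpha> / 8)\<^sup>2) 4 n G (power_ham (k + 1) n)"
      using certified_cycle[OF \<alpha> _ _ G] True by simp
  qed (use \<alpha> in simp_all)
next
  case False
  have "real k / (real k + 1) = 1 - 1 / real (k + 1)" by (simp add: field_simps)
  then have "1 - 1 / real (k + 1) < \<alpha>" using assms(1) by simp
  moreover have "2 \<le> k + 1" using False by simp
  ultimately obtain \<gamma> D N where pos: "0 < \<gamma>" "0 < D"
    and cert: "\<And>n G. N \<le> n \<Longrightarrow> G \<in> graphs n \<Longrightarrow> real (min_degree n G) \<ge> \<alpha> * real n \<Longrightarrow>
                 certified \<gamma> D n G (power_ham (k + 1) n)"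
    using power_ham_certified[of "k + 1" \<alpha>] assms(2) by blast
  show ?thesis
    by (rule ensures_if_certified[OF assms(2) pos cert])
qed

end
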